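(* Let $C$ be the Klein quartic, let $R_1\in C\setminus\{e_1,e_2,e_3\}$ be a point with $\psi(R_1)\in C$, set $R_i=\varphi^{i-1}(R_1)$ and let $P=(L_1,\dots,L_7)$ with $L_1=\overline{R_6R_1}, L_2=\overline{R_7R_2}, L_3=\overline{R_1R_3}, L_4=\overline{R_2R_4}, L_5=\overline{R_3R_5}, L_6=\overline{R_4R_6}, L_7=\overline{R_5R_7}$ (this is a heptagon with adjoint $C$ and associated theta characteristic $\eta_{\mathrm{sym}}$). Then: (1) $\operatorname{Aut}(C)$, acting by $\sigma\cdot(L_1,\dots,L_7)=(\sigma(L_1),\dots,\sigma(L_7))$, acts freely on the orbit of $P$; each $\sigma(P)$ is a heptagon with adjoint $C$ and associated theta characteristic $\eta_{\mathrm{sym}}$; and $\varphi$ acts on $P$ by a cyclic permutation of the labels, so this orbit consists of $168$ heptagons, i.e. $24$ modulo cyclic relabeling. (2) The set of heptagons with adjoint $C$ and associated theta characteristic $\eta_{\mathrm{sym}}$ contains the union of the $\operatorname{Aut}(C)$-orbits of $(L_1,\dots,L_7)$ and of $(L_7,\dots,L_1)$, which consists of $336=14\times24$ distinct heptagons.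
   Context: Work over $\mathbb{C}$. The Klein quartic is $C=\{x^3y+y^3z+z^3x=0\}\subset\mathbb{P}^2$, with $|\operatorname{Aut}(C)|=168$, acting linearly on $\mathbb{P}^2$. Let $e_1=[1:0:0],e_2=[0:1:0],e_3=[0:0:1]$, $\zeta$ a primitive seventh root of unity, $\varphi\colon[x:y:z]\mapsto[\zeta^4x:\zeta^2y:\zeta z]$, and $\psi\colon\mathbb{P}^2\to\mathbb{P}^2$, $[x:y:z]\mapsto[(\zeta^4+2\zeta^2-2\zeta-\zeta^6)x:(\zeta^2+2\zeta-2\zeta^4-\zeta^3)y:(\zeta+2\zeta^4-2\zeta^2-\zeta^5)z]$ (for $p\in C$, $\psi(p)$ is the intersection point of the lines $\overline{p\,\varphi^2(p)}$ and $\overline{\varphi^4(p)\,\varphi^6(p)}$). $\overline{pq}$ is the line through $p,q$. $\eta_{\mathrm{sym}}$ is the unique $\operatorname{Aut}(C)$-invariant even theta characteristic of $C$, with $\eta_{\mathrm{sym}}+H\sim 2(e_1+e_2+e_3)$. A heptagon is an ordered $7$-tuple of distinct lines with no three concurrent; its residual points are the $14$ points $L_i\cap L_j$ with $i,j$ non-consecutive mod $7$; its adjoint is the unique quartic through them; the associated theta characteristic is $\sum_{\text{residual }p}p-3H$ on the (smooth) adjoint. *)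

theory Defs
  imports "HOL-Complex_Analysis.Complex_Analysis"
begin

type_synonym vec3 = "complex^3"
type_synonym ppoint = "vec3 set"
type_synonym pline = "ppoint set"
type_synonym form = "nat \<times> nat \<times> nat \<Rightarrow> complex"

definition pclass :: "vec3 \<Rightarrow> ppoint" where
  "pclass v = {c *s v | c. c \<noteq> 0}"

definition P2 :: "ppoint set" where
  "P2 = {pclass v | v. v \<noteq> 0}"

definition line_of :: "vec3 \<Rightarrow> pline" where
  "line_of l = {pclass v | v. v \<noteq> 0 \<and> (\<Sum>i\<in>UNIV. l $ i * v $ i) = 0}"

definition plines :: "pline set" where
  "plines = {line_of l | l. l \<noteq> 0}"

definition join :: "ppoint \<Rightarrow> ppoint \<Rightarrow> pline" where
  "join p q = (THE L. L \<in> plines \<and> p \<in> L \<and> q \<in> L)"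

definition monoms :: "nat \<Rightarrow> (nat \<times> nat \<times> nat) set" where
  "monoms d = {(i,j,k). i + j + k = d}"

definition feval :: "nat \<Rightarrow> form \<Rightarrow> vec3 \<Rightarrow> complex" where
  "feval d F v = (\<Sum>(i,j,k)\<in>monoms d. F (i,j,k) * (v$1)^i * (v$2)^j * (v$3)^k)"

definition vanishes :: "nat \<Rightarrow> form \<Rightarrow> ppoint \<Rightarrow> bool" where
  "vanishes d F P \<longleftrightarrow> (\<forall>v\<in>P. feval d F v = 0)"

definition nonzero_form :: "nat \<Rightarrow> form \<Rightarrow> bool" where
  "nonzero_form d F \<longleftrightarrow> (\<exists>m\<in>monoms d. F m \<noteq> 0)"

definition klein_form :: form where
  "klein_form m = (if m \<in> {(3,1,0),(0,3,1),(1,0,3)} then 1 else 0)"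

definition kleinC :: "ppoint set" where
  "kleinC = {P \<in> P2. vanishes 4 klein_form P}"

text \<open>A local holomorphic parametrisation of C at P (an immersion of a disc into the cone).\<close>
definition local_param :: "(complex \<Rightarrow> vec3) \<Rightarrow> real \<Rightarrow> ppoint \<Rightarrow> bool" where
  "local_param \<gamma> r P \<longleftrightarrow> 0 < r \<and> (\<forall>i. (\<lambda>t. \<gamma> t $ i) holomorphic_on ball 0 r)
     \<and> \<gamma> 0 \<in> P \<and> (\<forall>t\<in>ball 0 r. feval 4 klein_form (\<gamma> t) = 0)
     \<and> \<not> (\<exists>c. \<forall>i. deriv (\<lambda>t. \<gamma> t $ i) 0 = c * \<gamma> 0 $ i)"

definition mult_at :: "nat \<Rightarrow> form \<Rightarrow> ppoint \<Rightarrow> int" where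
  "mult_at d F P = (SOME n. \<exists>\<gamma> r. local_param \<gamma> r P \<and> n = zorder (\<lambda>t. feval d F (\<gamma> t)) 0)"

type_synonym divisor = "ppoint \<Rightarrow> int"

definition div_of :: "nat \<Rightarrow> form \<Rightarrow> divisor" where
  "div_of d F = (\<lambda>P. if P \<in> kleinC then mult_at d F P else 0)"

definition lin_equiv :: "divisor \<Rightarrow> divisor \<Rightarrow> bool" where
  "lin_equiv D1 D2 \<longleftrightarrow> (\<exists>d F G. (\<exists>P\<in>kleinC. \<not> vanishes d F P) \<and> (\<exists>P\<in>kleinC. \<not> vanishes d G P)
      \<and> (\<forall>P. D1 P - D2 P = div_of d F P - div_of d G P))"

definition pt_div :: "ppoint \<Rightarrow> divisor" where
  "pt_div Q = (\<lambda>P. if P = Q then 1 else 0)"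

definition e1 :: vec3 where "e1 = axis 1 1"
definition e2 :: vec3 where "e2 = axis 2 1"
definition e3 :: vec3 where "e3 = axis 3 1"

definition x_form :: form where
  "x_form m = (if m = (1,0,0) then 1 else 0)"

definition Hdiv :: divisor where
  "Hdiv = div_of 1 x_form"

text \<open>A divisor in the class of eta_sym: eta_sym + H ~ 2(e1+e2+e3).\<close>
definition eta_sym :: divisor where
  "eta_sym = (\<lambda>P. 2 * (pt_div (pclass e1) P + pt_div (pclass e2) P + pt_div (pclass e3) P) - Hdiv P)"

definition heptagon :: "pline list \<Rightarrow> bool" where
  "heptagon L \<longleftrightarrow> length L = 7 \<and> set L \<subseteq> plines \<and> distinct L \<and>
     (\<forall>i<7. \<forall>j<7. \<forall>k<7. i \<noteq> j \<and> j \<noteq> k \<and> i \<noteq> k \<longrightarrow> L!i \<inter> L!j \<inter> L!k = {})"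

definition nonconsec :: "nat \<Rightarrow> nat \<Rightarrow> bool" where
  "nonconsec i j \<longleftrightarrow> i < 7 \<and> j < 7 \<and> i \<noteq> j \<and> j \<noteq> (i + 1) mod 7 \<and> i \<noteq> (j + 1) mod 7"

definition residual :: "pline list \<Rightarrow> ppoint set" where
  "residual L = {P. \<exists>i j. nonconsec i j \<and> P \<in> L!i \<and> P \<in> L!j}"

definition adjoint_is :: "pline list \<Rightarrow> form \<Rightarrow> bool" where
  "adjoint_is L F \<longleftrightarrow> (\<forall>P\<in>residual L. vanishes 4 F P) \<and>
     (\<forall>G. nonzero_form 4 G \<and> (\<forall>P\<in>residual L. vanishes 4 G P) \<longrightarrow> (\<exists>a. \<forall>m\<in>monoms 4. G m = a * F m))"

definition residual_div :: "pline list \<Rightarrow> divisor" where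
  "residual_div L = (\<lambda>P. if P \<in> residual L then 1 else 0)"

definition theta_of :: "pline list \<Rightarrow> divisor" where
  "theta_of L = (\<lambda>P. residual_div L P - 3 * Hdiv P)"

definition good_heptagon :: "pline list \<Rightarrow> bool" where
  "good_heptagon L \<longleftrightarrow> heptagon L \<and> adjoint_is L klein_form \<and> lin_equiv (theta_of L) eta_sym"

definition pmap :: "complex^3^3 \<Rightarrow> ppoint \<Rightarrow> ppoint" where
  "pmap A = (\<lambda>P. if P \<in> P2 then (\<lambda>v. A *v v) ` P else undefined)"

definition AutC :: "(ppoint \<Rightarrow> ppoint) set" where
  "AutC = {pmap A | A. invertible A \<and> pmap A ` kleinC = kleinC}"

definition act :: "(ppoint \<Rightarrow> ppoint) \<Rightarrow> pline list \<Rightarrow> pline list" where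
  "act \<sigma> L = map (\<lambda>l. \<sigma> ` l) L"

definition orbit :: "pline list \<Rightarrow> pline list set" where
  "orbit L = {act \<sigma> L | \<sigma>. \<sigma> \<in> AutC}"

definition cyc_classes :: "pline list set \<Rightarrow> pline list set set" where
  "cyc_classes S = (\<lambda>L. {rotate k L | k. True}) ` S"

definition diag3 :: "complex \<Rightarrow> complex \<Rightarrow> complex \<Rightarrow> complex^3^3" where
  "diag3 a b c = (\<chi> i j. if i = j then (if i = 1 then a else if i = 2 then b else c) else 0)"

definition phi_mat :: "complex \<Rightarrow> complex^3^3" where
  "phi_mat z = diag3 (z^4) (z^2) z"

definition psi_mat :: "complex \<Rightarrow> complex^3^3" where
  "psi_mat z = diag3 (z^4 + 2*z^2 - 2*z - z^6) (z^2 + 2*z - 2*z^4 - z^3) (z + 2*z^4 - 2*z^2 - z^5)"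

end

theory Submission
  imports Defs
begin

text \<open>Write \<open>p = x\<^sup>3 y\<close>, \<open>q = y\<^sup>3 z\<close>, \<open>r = z\<^sup>3 x\<close>, so that the quartic is \<open>p + q + r = 0\<close>, and let \<open>D\<close> be the
  diagonal automorphism \<open>\<phi>\<close>. Away from the coordinate points the \<open>D\<close>-orbits on the curve are the fibres of
  \<open>(p : q : r)\<close>.

  The residual points of the heptagon are the \<open>D\<close>-orbits of \<open>v = R\<^sub>1\<close> and of \<open>w = \<psi>(R\<^sub>1)\<close>, on which \<open>(p : q : r)\<close>
  takes two different values. Decomposing a quartic by its weights under \<open>D\<close> shows that the quartic is the only
  one through these points. A quintic that equals, up to the factor \<open>xyz\<close>, the product of the two linear forms in
  \<open>(p, q)\<close> vanishing at \<open>v\<close> and \<open>w\<close> cuts out the residual points plus \<open>2E\<close>, where \<open>E\<close> is the sum of the coordinate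
  points.

  For an automorphism \<open>\<sigma>\<close> the theta characteristic of the image heptagon is then \<open>\<eta>\<close> as soon as there is a cubic
  cutting out \<open>2E + 2\<sigma>(E)\<close>. Up to the stabiliser of \<open>E\<close>, \<open>\<sigma>\<close> is trivial or of the form \<open>D\<^sup>m J\<close> with \<open>J\<close> the classical
  circulant involution, and the cubic comes from \<open>xyz\<close> or \<open>x\<^sup>2 y + y\<^sup>2 z + z\<^sup>2 x + xyz\<close>.

  The automorphisms permute the flexes, which are the zeros of the Hessian: the three coordinate points and
  three \<open>D\<close>-orbits. As the stabiliser of a coordinate point is generated by \<open>D\<close>, there are \<open>24 * 7 = 168\<close> of them.
  An automorphism fixing all seven lines is scalar, and none reverses their order, by the linear recurrence
  satisfied by the line coordinates.\<close>

text \<open>Invariance of \<open>eta_sym\<close> under the automorphisms is nowhere assumed. With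
  \<open>H\<close> a line section and \<open>E\<close> the sum of the coordinate points, the quintic
  gives \<open>residual + 2\<sigma>(E) ~ 5H\<close>, while the class of \<open>eta_sym\<close> is
  \<open>2E - H\<close>; the two theta characteristics agree exactly when
  \<open>2E + 2\<sigma>(E) ~ 3H\<close>, and this is what the contact cubic supplies. The uniqueness
  of the quartic serves twice: for the adjoint, and to show that a matrix preserving the curve as a
  point set rescales its equation. Flexes then give a finite set on which automorphisms act: at
  \<open>e1\<close> the tangent line \<open>y = 0\<close> meets the curve with equation
  \<open>t^3 = 0\<close>, and a matrix rescaling the equation preserves this contact.\<close>

no_notation fps_nth (infixl "$" 75)

section \<open>Ternary forms\<close>

text \<open>\<open>feval d\<close> ignores all coefficients outside \<open>monoms d\<close>, so
  forms are handled as functions; coefficients are recovered only where uniqueness of the quartic is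
  at stake.\<close>

definition is_form :: "nat \<Rightarrow> (vec3 \<Rightarrow> complex) \<Rightarrow> bool" where
  "is_form d f \<longleftrightarrow> (\<exists>F. f = feval d F)"

lemma is_formE:
  assumes "is_form d f"
  obtains F where "\<And>v. feval d F v = f v"
  using assms unfolding is_form_def by auto

lemma is_form_feval [simp]: "is_form d (feval d F)"
  unfolding is_form_def by auto

lemma finite_monoms [simp]: "finite (monoms d)"
  by (rule finite_subset[of _ "{..d} \<times> {..d} \<times> {..d}"]) (auto simp: monoms_def)

lemma is_form_monom:
  assumes "i + j + k = d"
  shows "is_form d (\<lambda>v. c * (v$1)^i * (v$2)^j * (v$3)^k)"
proof -
  have "c * (v$1)^i * (v$2)^j * (v$3)^k = feval d (\<lambda>m. if m = (i,j,k) then c else 0) v" for v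
  proof -
    have "feval d (\<lambda>m. if m = (i,j,k) then c else 0) v =
        (\<Sum>m\<in>monoms d. if m = (i,j,k) then c * (v$1)^i * (v$2)^j * (v$3)^k else 0)"
      unfolding feval_def by (rule sum.cong) (auto split: if_splits)
    also have "\<dots> = c * (v$1)^i * (v$2)^j * (v$3)^k"
      using assms by (subst sum.delta[OF finite_monoms]) (auto simp: monoms_def)
    finally show ?thesis by simp
  qed
  then show ?thesis unfolding is_form_def by auto
qed

lemma is_form_add:
  assumes "is_form d f" "is_form d g"
  shows "is_form d (\<lambda>v. f v + g v)"
proof -
  obtain F where F: "\<And>v. feval d F v = f v" using assms(1) by (rule is_formE) blast
  obtain G where G: "\<And>v. feval d G v = g v" using assms(2) by (rule is_formE) blast
  have "f v + g v = feval d (\<lambda>m. F m + G m) v" for v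
    unfolding F[symmetric] G[symmetric] feval_def sum.distrib[symmetric]
    by (rule sum.cong) (auto simp: algebra_simps)
  then show ?thesis unfolding is_form_def by auto
qed

lemma is_form_zero: "is_form d (\<lambda>v. 0)"
proof -
  have "feval d (\<lambda>m. 0) = (\<lambda>v. 0)"
    by (rule ext) (simp add: feval_def case_prod_beta)
  then show ?thesis unfolding is_form_def by metis
qed

lemma is_form_sum:
  "(\<And>i. i \<in> S \<Longrightarrow> is_form d (f i)) \<Longrightarrow> is_form d (\<lambda>v. \<Sum>i\<in>S. f i v)"
proof (induction S rule: infinite_finite_induct)
  case (insert x S)
  then show ?case using is_form_add[of d "f x" "\<lambda>v. \<Sum>i\<in>S. f i v"] by simp
qed (auto simp: is_form_zero)

lemma is_form_mult:
  assumes "is_form d f" "is_form e g"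
  shows "is_form (d + e) (\<lambda>v. f v * g v)"
proof -
  obtain F where F: "\<And>v. feval d F v = f v" using assms(1) by (rule is_formE) blast
  obtain G where G: "\<And>v. feval e G v = g v" using assms(2) by (rule is_formE) blast
  have eq: "f v * g v = (\<Sum>m\<in>monoms d. \<Sum>n\<in>monoms e. F m * G n *
       (v$1)^(fst m + fst n) * (v$2)^(fst (snd m) + fst (snd n)) * (v$3)^(snd (snd m) + snd (snd n)))" for v
    unfolding F[symmetric] G[symmetric] feval_def sum_product
    by (intro sum.cong refl) (auto simp: power_add)
  show ?thesis
    unfolding eq by (intro is_form_sum is_form_monom) (auto simp: monoms_def)
qed

lemma is_form_const: "is_form 0 (\<lambda>v. c)"
  using is_form_monom[of 0 0 0 0 c] by simp

lemma is_form_cmult: "is_form d f \<Longrightarrow> is_form d (\<lambda>v. c * f v)"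
  using is_form_mult[OF is_form_const[of c], of d f] by simp

lemma is_form_power: "is_form d f \<Longrightarrow> is_form (d * n) (\<lambda>v. f v ^ n)"
  by (induction n) (use is_form_const[of 1] is_form_mult in \<open>auto simp: add.commute\<close>)

lemma is_form_coord: "is_form 1 (\<lambda>v. v $ i)"
proof -
  consider "i = 1" | "i = 2" | "i = 3" using exhaust_3 by blast
  then show ?thesis
    using is_form_monom[of 1 0 0 1 1] is_form_monom[of 0 1 0 1 1] is_form_monom[of 0 0 1 1 1]
    by cases auto
qed

lemma is_form_linear: "is_form 1 (\<lambda>v. (A *v v) $ i)"
  unfolding matrix_vector_mult_def vec_lambda_beta
  by (intro is_form_sum is_form_cmult is_form_coord)

lemma is_form_compose:
  assumes "is_form d f"
  shows "is_form d (\<lambda>v. f (A *v v))"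
proof -
  obtain F where F: "\<And>v. feval d F v = f v" using assms(1) by (rule is_formE) blast
  have "is_form d (\<lambda>v. case m of (i,j,k) \<Rightarrow> F (i,j,k) * ((A *v v)$1)^i * ((A *v v)$2)^j * ((A *v v)$3)^k)"
    if "m \<in> monoms d" for m
  proof -
    obtain i j k where m: "m = (i,j,k)" by (cases m)
    have d: "d = 0 + 1 * i + 1 * j + 1 * k" using that m by (simp add: monoms_def)
    show ?thesis unfolding m prod.case
      by (subst d) (intro is_form_mult is_form_const is_form_power is_form_linear)
  qed
  from is_form_sum[OF this] show ?thesis
    unfolding F[symmetric] feval_def by simp
qed

lemma is_form_homogeneous:
  assumes "is_form d f"
  shows "f (c *s v) = c ^ d * f v"
proof -
  obtain F where F: "\<And>v. feval d F v = f v" using assms(1) by (rule is_formE) blast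
  show ?thesis unfolding F[symmetric] feval_def sum_distrib_left
    by (intro sum.cong refl) (auto simp: monoms_def power_mult_distrib power_add algebra_simps)
qed

definition kf :: "vec3 \<Rightarrow> complex" where
  "kf v = v$1^3 * v$2 + v$2^3 * v$3 + v$3^3 * v$1"

lemma feval_klein: "feval 4 klein_form v = kf v"
proof -
  have "feval 4 klein_form v = (\<Sum>m\<in>{(3,1,0),(0,3,1),(1,0,3)}. case m of (i,j,k) \<Rightarrow> v$1^i * v$2^j * v$3^k)"
    unfolding feval_def
    by (rule sum.mono_neutral_cong_right[OF finite_monoms]) (auto simp: monoms_def klein_form_def split: if_splits)
  also have "\<dots> = kf v" by (simp add: kf_def)
  finally show ?thesis .
qed

lemma is_form_kf: "is_form 4 kf"
  using is_form_feval[of 4 klein_form] by (simp add: feval_klein[abs_def])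

lemma feval_x_form: "feval 1 x_form v = v $ 1"
proof -
  have "feval 1 x_form v = (\<Sum>m\<in>{(1,0,0)}. case m of (i,j,k) \<Rightarrow> v$1^i * v$2^j * v$3^k)"
    unfolding feval_def
    by (rule sum.mono_neutral_cong_right[OF finite_monoms]) (auto simp: monoms_def x_form_def split: if_splits)
  then show ?thesis by simp
qed

section \<open>The projective plane\<close>

lemma vec3_eq_iff: "(v::'a^3) = w \<longleftrightarrow> v$1 = w$1 \<and> v$2 = w$2 \<and> v$3 = w$3"
  by (simp add: vec_eq_iff forall_3)

lemma mv3 [simp]:
  fixes A :: "complex^3^3"
  shows "(A *v v) $ i = A$i$1 * v$1 + A$i$2 * v$2 + A$i$3 * v$3"
  by (simp add: matrix_vector_mult_def sum_3)

lemma pclass_self [simp]: "v \<in> pclass v"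
  unfolding pclass_def by (rule CollectI, rule exI[of _ 1]) auto

lemma pclass_eq_iff: "pclass u = pclass v \<longleftrightarrow> (\<exists>c. c \<noteq> 0 \<and> u = c *s v)"
proof
  assume "pclass u = pclass v"
  then have "u \<in> pclass v" using pclass_self[of u] by simp
  then show "\<exists>c. c \<noteq> 0 \<and> u = c *s v" unfolding pclass_def by auto
next
  assume "\<exists>c. c \<noteq> 0 \<and> u = c *s v"
  then obtain c where c: "c \<noteq> 0" "u = c *s v" by auto
  show "pclass u = pclass v"
  proof (intro set_eqI iffI)
    fix x assume "x \<in> pclass u"
    then obtain a where "a \<noteq> 0" "x = a *s u" unfolding pclass_def by auto
    then show "x \<in> pclass v" unfolding pclass_def using c
      by (intro CollectI exI[of _ "a * c"]) (simp add: vector_smult_assoc)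
  next
    fix x assume "x \<in> pclass v"
    then obtain a where "a \<noteq> 0" "x = a *s v" unfolding pclass_def by auto
    then show "x \<in> pclass u" unfolding pclass_def using c
      by (intro CollectI exI[of _ "a / c"]) (simp add: vector_smult_assoc)
  qed
qed

lemma pclass_smult [simp]: "c \<noteq> 0 \<Longrightarrow> pclass (c *s v) = pclass v"
  unfolding pclass_eq_iff by blast

lemma pclass_in_P2 [simp]: "pclass v \<in> P2 \<longleftrightarrow> v \<noteq> 0"
proof
  assume "pclass v \<in> P2"
  then show "v \<noteq> 0" unfolding P2_def by (auto simp: pclass_eq_iff)
qed (auto simp: P2_def)

lemma vanishes_pclass: "vanishes d F (pclass v) \<longleftrightarrow> feval d F v = 0"
proof -
  have "feval d F (c *s v) = c ^ d * feval d F v" for c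
    by (rule is_form_homogeneous) simp
  then show ?thesis unfolding vanishes_def
    using pclass_self[of v] unfolding pclass_def by auto
qed

lemma pclass_in_kleinC [simp]: "pclass v \<in> kleinC \<longleftrightarrow> v \<noteq> 0 \<and> kf v = 0"
  unfolding kleinC_def by (simp add: vanishes_pclass feval_klein)

lemma kleinC_cases:
  assumes "X \<in> kleinC"
  obtains v where "X = pclass v" "v \<noteq> 0" "kf v = 0"
proof -
  from assms obtain v where "X = pclass v" "v \<noteq> 0" unfolding kleinC_def P2_def by auto
  with assms that show ?thesis by auto
qed

lemma pmap_pclass: "v \<noteq> 0 \<Longrightarrow> pmap A (pclass v) = pclass (A *v v)"
  by (simp add: pmap_def) (simp add: pclass_def setcompr_eq_image image_image vector_scalar_commute)

lemma invertibleE: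
  fixes A :: "complex^3^3"
  assumes "invertible A"
  obtains B where "A ** B = mat 1" "B ** A = mat 1" "\<And>v. A *v (B *v v) = v" "\<And>v. B *v (A *v v) = v"
proof -
  obtain B where "A ** B = mat 1" "B ** A = mat 1" using assms unfolding invertible_def by blast
  then show ?thesis by (metis that matrix_vector_mul_assoc matrix_vector_mul_lid)
qed

lemma matrix_eq_mv: "(\<And>v. A *v v = B *v v) \<Longrightarrow> A = (B :: complex^3^3)"
  by (simp add: matrix_eq)

definition dot :: "vec3 \<Rightarrow> vec3 \<Rightarrow> complex" where
  "dot l u = l$1 * u$1 + l$2 * u$2 + l$3 * u$3"

definition crs :: "vec3 \<Rightarrow> vec3 \<Rightarrow> vec3" where
  "crs u v = vector [u$2 * v$3 - u$3 * v$2, u$3 * v$1 - u$1 * v$3, u$1 * v$2 - u$2 * v$1]"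

lemma dot_smult [simp]: "dot (c *s l) u = c * dot l u" "dot l (c *s u) = c * dot l u"
  by (simp_all add: dot_def algebra_simps)

lemma crs_dot [simp]: "dot (crs u v) u = 0" "dot (crs u v) v = 0"
  by (simp_all add: dot_def crs_def algebra_simps)

lemma crs_eq_0D:
  assumes "crs l w = 0" "w \<noteq> 0"
  obtains c where "l = c *s w"
proof -
  have e: "l$2 * w$3 = l$3 * w$2" "l$3 * w$1 = l$1 * w$3" "l$1 * w$2 = l$2 * w$1"
    using assms(1) by (simp_all add: crs_def vec3_eq_iff)
  consider "w$1 \<noteq> 0" | "w$2 \<noteq> 0" | "w$3 \<noteq> 0" using assms(2) by (auto simp: vec3_eq_iff)
  then show ?thesis
  proof cases
    case 1 then show ?thesis using e by (intro that[of "l$1 / w$1"]) (auto simp: vec3_eq_iff field_simps)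
  next
    case 2 then show ?thesis using e by (intro that[of "l$2 / w$2"]) (auto simp: vec3_eq_iff field_simps)
  next
    case 3 then show ?thesis using e by (intro that[of "l$3 / w$3"]) (auto simp: vec3_eq_iff field_simps)
  qed
qed

text \<open>By the triple product expansion \<open>l\<close> has zero cross product with
  \<open>crs u v\<close>, hence is proportional to it.\<close>

lemma perp_both:
  assumes "dot l u = 0" "dot l v = 0" "crs u v \<noteq> 0"
  obtains c where "l = c *s crs u v"
proof (rule crs_eq_0D[OF _ assms(3)])
  have *: "crs l (crs u v) = dot l v *s u - dot l u *s v"
    by (simp add: vec3_eq_iff crs_def dot_def algebra_simps)
  show "crs l (crs u v) = 0" unfolding * assms(1,2) by simp
qed

lemma dot_commute: "dot l u = dot u l"
  by (simp add: dot_def algebra_simps)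

lemma pclass_in_line_of [simp]:
  assumes "u \<noteq> 0"
  shows "pclass u \<in> line_of l \<longleftrightarrow> dot l u = 0"
proof
  assume "pclass u \<in> line_of l"
  then obtain v where v: "pclass u = pclass v" "dot l v = 0"
    unfolding line_of_def dot_def sum_3 by auto
  then show "dot l u = 0" unfolding pclass_eq_iff by auto
next
  assume "dot l u = 0"
  then show "pclass u \<in> line_of l" unfolding line_of_def dot_def sum_3 using assms by auto
qed

lemma line_of_cases:
  assumes "X \<in> line_of l"
  obtains v where "X = pclass v" "v \<noteq> 0" "dot l v = 0"
  using assms unfolding line_of_def dot_def sum_3 by auto

lemma line_of_subset_P2: "line_of l \<subseteq> P2"
  unfolding line_of_def P2_def by auto

lemma line_of_smult: "c \<noteq> 0 \<Longrightarrow> line_of (c *s l) = line_of l"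
  by (auto elim!: line_of_cases)

text \<open>Each nonzero \<open>crs l e\<close> is a point of the first line, hence of the second;
  letting \<open>e\<close> run through the basis gives \<open>crs l m = 0\<close>.\<close>

lemma line_of_eqD:
  assumes "line_of l = line_of m" "m \<noteq> 0"
  obtains c where "l = c *s m"
proof (rule crs_eq_0D[OF _ assms(2)])
  have "dot m (crs l e) = 0" for e
  proof (cases "crs l e = 0")
    case False
    have "pclass (crs l e) \<in> line_of l" using False by (simp add: dot_commute[of l])
    then show ?thesis using False unfolding assms(1) by simp
  qed (simp add: dot_def)
  from this[of "axis 1 1"] this[of "axis 2 1"] this[of "axis 3 1"] show "crs l m = 0"
    by (simp add: dot_def crs_def vec3_eq_iff axis_def algebra_simps)
qed

lemma line_of_in_plines [simp]: "l \<noteq> 0 \<Longrightarrow> line_of l \<in> plines"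
  unfolding plines_def by auto

lemma crs_nz_imp: "crs u v \<noteq> 0 \<Longrightarrow> u \<noteq> 0 \<and> v \<noteq> 0"
  by (auto simp: crs_def vec3_eq_iff)

lemma join_pclass:
  assumes "crs u v \<noteq> 0"
  shows "join (pclass u) (pclass v) = line_of (crs u v)"
  unfolding join_def
proof (rule the_equality)
  have nz: "u \<noteq> 0" "v \<noteq> 0" using crs_nz_imp[OF assms] by auto
  show "line_of (crs u v) \<in> plines \<and> pclass u \<in> line_of (crs u v) \<and> pclass v \<in> line_of (crs u v)"
    using nz assms by simp
  fix L assume L: "L \<in> plines \<and> pclass u \<in> L \<and> pclass v \<in> L"
  then obtain l where l: "L = line_of l" "l \<noteq> 0" unfolding plines_def by auto
  with L nz have "dot l u = 0" "dot l v = 0" by auto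
  then obtain c where c: "l = c *s crs u v" using assms perp_both by blast
  with l have "c \<noteq> 0" by auto
  then show "L = line_of (crs u v)" using l c line_of_smult by auto
qed

lemma lines_meet_once:
  assumes "crs l m \<noteq> 0" "X \<in> line_of l" "X \<in> line_of m" "Y \<in> line_of l" "Y \<in> line_of m"
  shows "X = Y"
proof -
  have "Z = pclass (crs l m)" if Zl: "Z \<in> line_of l" and Zm: "Z \<in> line_of m" for Z
  proof -
    obtain u where u: "Z = pclass u" "u \<noteq> 0" "dot l u = 0" using Zl by (rule line_of_cases)
    have "dot m u = 0" using Zm u by simp
    then obtain c where "u = c *s crs l m"
      using perp_both[of u l m] u assms(1) by (auto simp: dot_commute)
    with u show ?thesis by auto
  qed
  with assms show ?thesis by metis
qed

lemma pmap_line_of: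
  assumes AB: "\<And>v. A *v (B *v v) = v" "\<And>v. B *v (A *v v) = v"
  shows "pmap A ` line_of l = line_of (transpose B *v l)"
proof -
  have dot: "dot (transpose B *v l) u = dot l (B *v u)" for u
    by (simp add: dot_def transpose_def algebra_simps)
  have nzA: "A *v v \<noteq> 0" if "v \<noteq> 0" for v using that AB(2)[of v] by (metis matrix_vector_mult_0_right)
  show ?thesis
  proof (intro set_eqI iffI)
    fix X assume "X \<in> pmap A ` line_of l"
    then obtain v where v: "v \<noteq> 0" "dot l v = 0" "X = pclass (A *v v)"
      by (auto elim!: line_of_cases simp: pmap_pclass)
    then show "X \<in> line_of (transpose B *v l)"
      using nzA[OF v(1)] by (simp add: dot AB del: mv3 transpose_matrix_vector)
  next
    fix X assume "X \<in> line_of (transpose B *v l)"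
    then obtain v where v: "X = pclass v" "v \<noteq> 0" "dot (transpose B *v l) v = 0"
      by (rule line_of_cases)
    have nz: "B *v v \<noteq> 0" using AB(1)[of v] v(2) by (metis matrix_vector_mult_0_right)
    have "X = pmap A (pclass (B *v v))" using nz v by (simp add: pmap_pclass AB del: mv3)
    moreover have "pclass (B *v v) \<in> line_of l" using nz v(3) by (simp add: dot del: mv3 transpose_matrix_vector)
    ultimately show "X \<in> pmap A ` line_of l" by blast
  qed
qed

section \<open>Klein quartic automorphisms and orders of forms\<close>

text \<open>The inverse matrix is carried along explicitly. Matrices are not normalised, so the form
  is preserved only up to a nonzero factor.\<close>

definition klein_pair :: "complex^3^3 \<Rightarrow> complex^3^3 \<Rightarrow> bool" where
  "klein_pair A B \<longleftrightarrow> (\<forall>v. A *v (B *v v) = v) \<and> (\<forall>v. B *v (A *v v) = v) \<and>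
     (\<exists>c. c \<noteq> 0 \<and> (\<forall>v. kf (A *v v) = c * kf v))"

lemma klein_pairD:
  assumes "klein_pair A B"
  shows "A *v (B *v v) = v" "B *v (A *v v) = v"
  using assms unfolding klein_pair_def by auto

lemma klein_pair_kf:
  assumes "klein_pair A B"
  shows "kf (A *v v) = 0 \<longleftrightarrow> kf v = 0"
  using assms unfolding klein_pair_def by auto

lemma klein_pair_nz:
  assumes "klein_pair A B"
  shows "A *v v = 0 \<longleftrightarrow> v = 0"
  using klein_pairD(2)[OF assms, of v] by (metis matrix_vector_mult_0_right)

lemma klein_pair_sym:
  assumes "klein_pair A B"
  shows "klein_pair B A"
proof -
  obtain c where c: "c \<noteq> 0" "\<And>v. kf (A *v v) = c * kf v" using assms unfolding klein_pair_def by auto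
  have "kf (B *v v) = inverse c * kf v" for v
    using c(2)[of "B *v v"] c(1) by (simp add: klein_pairD[OF assms] field_simps del: mv3)
  then show ?thesis using assms c(1) unfolding klein_pair_def
    by (metis inverse_nonzero_iff_nonzero)
qed

lemma klein_pair_comp:
  assumes "klein_pair A B" "klein_pair A' B'"
  shows "klein_pair (A ** A') (B' ** B)"
proof -
  obtain c where c: "c \<noteq> 0" "\<And>v. kf (A *v v) = c * kf v" using assms(1) unfolding klein_pair_def by auto
  obtain c' where c': "c' \<noteq> 0" "\<And>v. kf (A' *v v) = c' * kf v" using assms(2) unfolding klein_pair_def by auto
  have "kf ((A ** A') *v v) = (c * c') * kf v" for v
    using c c' by (simp add: matrix_vector_mul_assoc[symmetric] del: mv3)
  moreover have "c * c' \<noteq> 0" using c c' by simp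
  ultimately show ?thesis unfolding klein_pair_def
    by (metis matrix_vector_mul_assoc klein_pairD[OF assms(1)] klein_pairD[OF assms(2)])
qed

lemma klein_pair_id: "klein_pair (mat 1) (mat 1)"
  unfolding klein_pair_def by (simp add: matrix_vector_mul_lid del: mv3) (rule exI[of _ 1], simp)

text \<open>\<open>mult_at\<close> picks the order along some local parametrisation; it has a known value only once the
  order is shown to be the same along every parametrisation.\<close>

definition ord_at :: "(vec3 \<Rightarrow> complex) \<Rightarrow> ppoint \<Rightarrow> nat \<Rightarrow> bool" where
  "ord_at f P n \<longleftrightarrow> (\<forall>\<gamma> r. local_param \<gamma> r P \<longrightarrow>
     (\<exists>s g. 0 < s \<and> s \<le> r \<and> g holomorphic_on ball 0 s \<and> g 0 \<noteq> 0 \<and> (\<forall>t\<in>ball 0 s. f (\<gamma> t) = t ^ n * g t)))"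

lemma ord_atE:
  assumes "ord_at f P n" "local_param \<gamma> r P"
  obtains s g where "0 < s" "s \<le> r" "g holomorphic_on ball 0 s" "g 0 \<noteq> 0"
    "\<And>t. t \<in> ball 0 s \<Longrightarrow> f (\<gamma> t) = t ^ n * g t"
  using assms unfolding ord_at_def by blast

lemma ord_atI:
  assumes "\<And>\<gamma> r. local_param \<gamma> r P \<Longrightarrow>
     \<exists>s g. 0 < s \<and> s \<le> r \<and> g holomorphic_on ball 0 s \<and> g 0 \<noteq> 0 \<and> (\<forall>t\<in>ball 0 s. f (\<gamma> t) = t ^ n * g t)"
  shows "ord_at f P n"
  using assms unfolding ord_at_def by blast

lemma is_form_holomorphic:
  assumes "is_form d f" "\<And>i. (\<lambda>t. \<gamma> t $ i) holomorphic_on S"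
  shows "(\<lambda>t. f (\<gamma> t)) holomorphic_on S"
proof -
  obtain F where F: "\<And>v. feval d F v = f v" using assms(1) by (rule is_formE) blast
  show ?thesis unfolding F[symmetric] feval_def case_prod_beta
    by (intro holomorphic_intros assms)
qed

lemma ord_at_mult:
  assumes "ord_at f P n" "ord_at g P m"
  shows "ord_at (\<lambda>v. f v * g v) P (n + m)"
proof (rule ord_atI)
  fix \<gamma> r assume lp: "local_param \<gamma> r P"
  obtain s h where 1: "0 < s" "s \<le> r" "h holomorphic_on ball 0 s" "h 0 \<noteq> 0"
    "\<And>t. t \<in> ball 0 s \<Longrightarrow> f (\<gamma> t) = t ^ n * h t" using ord_atE[OF assms(1) lp] by metis
  obtain s' h' where 2: "0 < s'" "s' \<le> r" "h' holomorphic_on ball 0 s'" "h' 0 \<noteq> 0"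
    "\<And>t. t \<in> ball 0 s' \<Longrightarrow> g (\<gamma> t) = t ^ m * h' t" using ord_atE[OF assms(2) lp] by metis
  have "(\<lambda>t. h t * h' t) holomorphic_on ball 0 (min s s')"
    by (intro holomorphic_intros holomorphic_on_subset[OF 1(3)] holomorphic_on_subset[OF 2(3)]) auto
  then show "\<exists>s g'. 0 < s \<and> s \<le> r \<and> g' holomorphic_on ball 0 s \<and> g' 0 \<noteq> 0 \<and>
      (\<forall>t\<in>ball 0 s. f (\<gamma> t) * g (\<gamma> t) = t ^ (n + m) * g' t)"
    using 1 2 by (intro exI[of _ "min s s'"] exI[of _ "\<lambda>t. h t * h' t"]) (auto simp: power_add)
qed

lemma ord_at_power: "ord_at f P n \<Longrightarrow> ord_at (\<lambda>v. f v ^ k) P (k * n)"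
proof (induction k)
  case 0
  show ?case by (auto simp: ord_at_def local_param_def intro!: exI[of _ "\<lambda>_. 1"])
next
  case (Suc k)
  then show ?case using ord_at_mult[of f P n "\<lambda>v. f v ^ k" "k * n"] by simp
qed

lemma local_param_at:
  assumes "local_param \<gamma> r (pclass v)"
  obtains c where "c \<noteq> 0" "\<gamma> 0 = c *s v"
  using assms unfolding local_param_def pclass_def by auto

lemma local_param_holomorphic:
  assumes "local_param \<gamma> r P" "s \<le> r"
  shows "(\<lambda>t. \<gamma> t $ i) holomorphic_on ball 0 s"
  using assms unfolding local_param_def by (meson holomorphic_on_subset subset_ball)

lemma ord_at_unit:
  assumes "is_form d f" "f v \<noteq> 0"
  shows "ord_at f (pclass v) 0"
proof (rule ord_atI)
  fix \<gamma> r assume lp: "local_param \<gamma> r (pclass v)"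
  obtain c where c: "c \<noteq> 0" "\<gamma> 0 = c *s v" using local_param_at[OF lp] .
  have "(\<lambda>t. f (\<gamma> t)) holomorphic_on ball 0 r" using lp unfolding local_param_def
    by (intro is_form_holomorphic[OF assms(1)]) auto
  moreover have "f (\<gamma> 0) \<noteq> 0" using c assms by (simp add: is_form_homogeneous[OF assms(1)])
  ultimately show "\<exists>s g. 0 < s \<and> s \<le> r \<and> g holomorphic_on ball 0 s \<and> g 0 \<noteq> 0 \<and> (\<forall>t\<in>ball 0 s. f (\<gamma> t) = t ^ 0 * g t)"
    using lp unfolding local_param_def by (intro exI[of _ r] exI[of _ "\<lambda>t. f (\<gamma> t)"]) auto
qed

text \<open>A local parametrisation stays on the cone over the quartic, so orders may be computed
  modulo the equation of the curve.\<close>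

lemma ord_at_cong:
  assumes "\<And>v. kf v = 0 \<Longrightarrow> f v = g v" "ord_at f P n"
  shows "ord_at g P n"
proof (rule ord_atI)
  fix \<gamma> r assume lp: "local_param \<gamma> r P"
  obtain s h where 1: "0 < s" "s \<le> r" "h holomorphic_on ball 0 s" "h 0 \<noteq> 0"
    "\<And>t. t \<in> ball 0 s \<Longrightarrow> f (\<gamma> t) = t ^ n * h t" using ord_atE[OF assms(2) lp] by metis
  have "f (\<gamma> t) = g (\<gamma> t)" if "t \<in> ball 0 s" for t
    using assms(1) lp that 1(2) unfolding local_param_def feval_klein by auto
  then show "\<exists>s h. 0 < s \<and> s \<le> r \<and> h holomorphic_on ball 0 s \<and> h 0 \<noteq> 0 \<and> (\<forall>t\<in>ball 0 s. g (\<gamma> t) = t ^ n * h t)"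
    using 1 by (intro exI[of _ s] exI[of _ h]) auto
qed

lemma ord_at_cmult:
  assumes "ord_at f P n" "c \<noteq> 0"
  shows "ord_at (\<lambda>v. c * f v) P n"
proof -
  have "ord_at (\<lambda>v. c) P 0" using assms(2)
    by (auto simp: ord_at_def local_param_def intro!: exI[of _ "\<lambda>_. c"])
  from ord_at_mult[OF this assms(1)] show ?thesis by simp
qed

text \<open>Away from 0 the desired factor is the quotient of the two given ones; at 0 the identity
  follows by continuity of both sides.\<close>

lemma ord_at_cancel:
  assumes "is_form d f" "ord_at (\<lambda>v. f v * g v) P (n + m)" "ord_at g P m"
  shows "ord_at f P n"
proof (rule ord_atI)
  fix \<gamma> r assume lp: "local_param \<gamma> r P"
  obtain s h where 1: "0 < s" "s \<le> r" "h holomorphic_on ball 0 s" "h 0 \<noteq> 0"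
    "\<And>t. t \<in> ball 0 s \<Longrightarrow> f (\<gamma> t) * g (\<gamma> t) = t ^ (n + m) * h t" using ord_atE[OF assms(2) lp] by metis
  obtain s' h' where 2: "0 < s'" "s' \<le> r" "h' holomorphic_on ball 0 s'" "h' 0 \<noteq> 0"
    "\<And>t. t \<in> ball 0 s' \<Longrightarrow> g (\<gamma> t) = t ^ m * h' t" using ord_atE[OF assms(3) lp] by metis
  have "isCont h' 0" using 2 by (metis centre_in_ball continuous_on_interior holomorphic_on_imp_continuous_on interior_open open_ball)
  then obtain e where e: "e > 0" "\<And>t. dist 0 t < e \<Longrightarrow> h' t \<noteq> 0"
    using continuous_at_avoid[of 0 h' 0] 2(4) by (metis)
  define q where "q = min (min s s') e"
  have q: "0 < q" "q \<le> r" using 1 2 e unfolding q_def by auto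
  define k where "k = (\<lambda>t. h t / h' t)"
  have hk: "k holomorphic_on ball 0 q" unfolding k_def
    by (intro holomorphic_intros holomorphic_on_subset[OF 1(3)] holomorphic_on_subset[OF 2(3)])
      (use e(2) in \<open>auto simp: q_def\<close>)
  have hf: "(\<lambda>t. f (\<gamma> t)) holomorphic_on ball 0 q" 
    by (intro is_form_holomorphic[OF assms(1)] local_param_holomorphic[OF lp q(2)])
  have eq: "f (\<gamma> t) = t ^ n * k t" if "t \<in> ball 0 q" "t \<noteq> 0" for t
    using 1(5)[of t] 2(5)[of t] e(2)[of t] that unfolding k_def q_def
    by (auto simp: power_add field_simps)
  have l1: "((\<lambda>t. f (\<gamma> t)) \<longlongrightarrow> f (\<gamma> 0)) (at 0)"
    using holomorphic_on_imp_continuous_on[OF hf] q(1)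
    by (simp add: continuous_on_eq_continuous_at isCont_def)
  have l2: "((\<lambda>t. t ^ n * k t) \<longlongrightarrow> 0 ^ n * k 0) (at 0)"
    using holomorphic_on_imp_continuous_on[OF hk] q(1)
    by (intro tendsto_intros) (simp add: continuous_on_eq_continuous_at flip: isCont_def)
  have ev: "eventually (\<lambda>t. f (\<gamma> t) = t ^ n * k t) (at 0)"
    unfolding eventually_at by (rule exI[of _ q]) (use q eq in \<open>auto simp: dist_commute\<close>)
  have "f (\<gamma> 0) = 0 ^ n * k 0"
    by (rule tendsto_unique[OF _ Lim_transform_eventually[OF l1 ev] l2]) simp
  with eq have "\<forall>t\<in>ball 0 q. f (\<gamma> t) = t ^ n * k t" by (metis)
  moreover have "k 0 \<noteq> 0" using 1 2 by (simp add: k_def)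
  ultimately show "\<exists>s g. 0 < s \<and> s \<le> r \<and> g holomorphic_on ball 0 s \<and> g 0 \<noteq> 0 \<and> (\<forall>t\<in>ball 0 s. f (\<gamma> t) = t ^ n * g t)"
    using q hk by blast
qed

lemma zorder_factor:
  assumes "0 < s" "g holomorphic_on ball 0 s" "g 0 \<noteq> 0" "\<And>t. t \<in> ball 0 s \<Longrightarrow> h t = t ^ n * g t"
  shows "zorder h 0 = int n"
  by (rule zorder_eqI[of "ball 0 s" 0 g]) (use assms in \<open>auto simp: power_int_def\<close>)

text \<open>Along a parametrisation the form factors as a power \<open>t^k\<close> times a unit, and
  comparing \<open>zorder\<close> of the squares forces \<open>k = n\<close>. Its use is for the
  contact cubic, of which only the square is accessible.\<close>

lemma ord_at_sqrt:
  assumes "is_form d f" "ord_at (\<lambda>v. f v ^ 2) P (2 * n)"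
  shows "ord_at f P n"
proof (rule ord_atI)
  fix \<gamma> r assume lp: "local_param \<gamma> r P"
  obtain s h where 1: "0 < s" "s \<le> r" "h holomorphic_on ball 0 s" "h 0 \<noteq> 0"
    "\<And>t. t \<in> ball 0 s \<Longrightarrow> f (\<gamma> t) ^ 2 = t ^ (2 * n) * h t" using ord_atE[OF assms(2) lp] by metis
  define F where "F = (\<lambda>t. f (\<gamma> t))"
  have hf: "F holomorphic_on ball 0 s" unfolding F_def
    by (intro is_form_holomorphic[OF assms(1)] local_param_holomorphic[OF lp 1(2)])
  have zo: "zorder (\<lambda>t. F t ^ 2) 0 = int (2 * n)"
    by (rule zorder_factor[OF 1(1,3,4)]) (use 1(5) in \<open>auto simp: F_def\<close>)
  have "\<exists>k s' g. 0 < s' \<and> s' \<le> s \<and> g holomorphic_on ball 0 s' \<and> g 0 \<noteq> 0 \<and> (\<forall>t\<in>ball 0 s'. F t = t ^ k * g t)"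
  proof (cases "F 0 = 0")
    case False
    then show ?thesis using 1 hf by (intro exI[of _ 0] exI[of _ s] exI[of _ F]) auto
  next
    case True
    \<comment> \<open>Otherwise \<open>F\<close> would vanish identically, whereas its square is
      \<open>t^(2n)\<close> times a function that is nonzero near 0.\<close>
    have nc: "\<not> F constant_on ball 0 s"
    proof
      assume "F constant_on ball 0 s"
      then have z: "F t = 0" if "t \<in> ball 0 s" for t using True that 1(1) unfolding constant_on_def
        by (metis centre_in_ball)
      have "isCont h 0" using 1 by (metis centre_in_ball continuous_on_interior holomorphic_on_imp_continuous_on interior_open open_ball)
      then obtain e where e: "e > 0" "\<And>t. dist 0 t < e \<Longrightarrow> h t \<noteq> 0"
        using continuous_at_avoid[of 0 h 0] 1(4) by (metis)
      define t :: complex where "t = of_real (min s e / 2)"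
      have "t \<in> ball 0 s" "t \<noteq> 0" "dist 0 t < e" using e(1) 1(1) by (auto simp: t_def)
      then show False using 1(5)[of t] z[of t] e(2)[of t] by (auto simp: F_def)
    qed
    have "\<exists>g e k. 0 < e \<and> g holomorphic_on ball 0 e \<and> (\<forall>w\<in>ball 0 e. F w = w ^ k * g w \<and> g w \<noteq> 0)"
    proof (rule holomorphic_factor_zero_nonconstant[OF hf open_ball connected_ball _ True nc])
      show "(0::complex) \<in> ball 0 s" using 1(1) by simp
      fix g e k
      assume "0 < e" "g holomorphic_on ball 0 e" "\<And>w. w \<in> ball 0 e \<Longrightarrow> F w = (w - 0) ^ k * g w"
        "\<And>w. w \<in> ball 0 e \<Longrightarrow> g w \<noteq> 0"
      then show "\<exists>g e k. 0 < e \<and> g holomorphic_on ball 0 e \<and> (\<forall>w\<in>ball 0 e. F w = w ^ k * g w \<and> g w \<noteq> 0)"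
        by (intro exI[of _ g] exI[of _ e] exI[of _ k]) simp
    qed
    then obtain g e k where "0 < e" "g holomorphic_on ball 0 e"
      "\<And>w. w \<in> ball 0 e \<Longrightarrow> F w = w ^ k * g w \<and> g w \<noteq> 0" by blast
    then show ?thesis
      by (intro exI[of _ k] exI[of _ "min e s"] exI[of _ g])
        (use 1(1) in \<open>auto elim: holomorphic_on_subset\<close>)
  qed
  then obtain k s' g where 2: "0 < s'" "s' \<le> s" "g holomorphic_on ball 0 s'" "g 0 \<noteq> 0"
    "\<And>t. t \<in> ball 0 s' \<Longrightarrow> F t = t ^ k * g t" by blast
  have "zorder (\<lambda>t. F t ^ 2) 0 = int (2 * k)"
    by (rule zorder_factor[of s' "\<lambda>t. g t ^ 2"])
      (use 2 in \<open>auto intro!: holomorphic_intros simp: power_mult_distrib power_mult[symmetric] mult.commute\<close>)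
  with zo have "k = n" by simp
  then show "\<exists>s g. 0 < s \<and> s \<le> r \<and> g holomorphic_on ball 0 s \<and> g 0 \<noteq> 0 \<and> (\<forall>t\<in>ball 0 s. f (\<gamma> t) = t ^ n * g t)"
    using 1(2) 2 unfolding F_def by (intro exI[of _ s'] exI[of _ g]) auto
qed

text \<open>Differentiating the equation of the curve along the parametrisation gives the tangency
  relation; the last clause says that the velocity is not along the line of the cone through
  \<open>\<gamma> 0\<close>.\<close>

lemma local_param_deriv:
  assumes "local_param \<gamma> r P"
  obtains x y z where "((\<lambda>t. \<gamma> t $ 1) has_field_derivative x) (at 0)"
    "((\<lambda>t. \<gamma> t $ 2) has_field_derivative y) (at 0)" "((\<lambda>t. \<gamma> t $ 3) has_field_derivative z) (at 0)"
    "3 * (\<gamma> 0$1)^2 * \<gamma> 0$2 * x + (\<gamma> 0$1)^3 * y + 3 * (\<gamma> 0$2)^2 * \<gamma> 0$3 * y + (\<gamma> 0$2)^3 * z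
      + 3 * (\<gamma> 0$3)^2 * \<gamma> 0$1 * z + (\<gamma> 0$3)^3 * x = 0"
    "\<And>c. \<not> (x = c * \<gamma> 0$1 \<and> y = c * \<gamma> 0$2 \<and> z = c * \<gamma> 0$3)"
proof -
  have r: "0 < r" using assms by (simp add: local_param_def)
  have D: "((\<lambda>t. \<gamma> t $ i) has_field_derivative deriv (\<lambda>t. \<gamma> t $ i) 0) (at 0)" for i
    using assms unfolding local_param_def
    by (intro holomorphic_derivI[of _ "ball 0 r"]) auto
  have "((\<lambda>t. kf (\<gamma> t)) has_field_derivative
     3 * (\<gamma> 0$1)^2 * \<gamma> 0$2 * deriv (\<lambda>t. \<gamma> t $ 1) 0 + (\<gamma> 0$1)^3 * deriv (\<lambda>t. \<gamma> t $ 2) 0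
      + 3 * (\<gamma> 0$2)^2 * \<gamma> 0$3 * deriv (\<lambda>t. \<gamma> t $ 2) 0 + (\<gamma> 0$2)^3 * deriv (\<lambda>t. \<gamma> t $ 3) 0
      + 3 * (\<gamma> 0$3)^2 * \<gamma> 0$1 * deriv (\<lambda>t. \<gamma> t $ 3) 0 + (\<gamma> 0$3)^3 * deriv (\<lambda>t. \<gamma> t $ 1) 0) (at 0)"
    unfolding kf_def by (auto intro!: derivative_eq_intros D simp: algebra_simps)
  moreover have "((\<lambda>t. kf (\<gamma> t)) has_field_derivative 0) (at 0)"
  proof (rule has_field_derivative_transform_within_open[of "\<lambda>t. 0" _ _ "ball 0 r"])
    fix t :: complex assume "t \<in> ball 0 r"
    then show "0 = kf (\<gamma> t)" using assms unfolding local_param_def feval_klein by auto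
  qed (use r in auto)
  ultimately have "3 * (\<gamma> 0$1)^2 * \<gamma> 0$2 * deriv (\<lambda>t. \<gamma> t $ 1) 0 + (\<gamma> 0$1)^3 * deriv (\<lambda>t. \<gamma> t $ 2) 0
      + 3 * (\<gamma> 0$2)^2 * \<gamma> 0$3 * deriv (\<lambda>t. \<gamma> t $ 2) 0 + (\<gamma> 0$2)^3 * deriv (\<lambda>t. \<gamma> t $ 3) 0
      + 3 * (\<gamma> 0$3)^2 * \<gamma> 0$1 * deriv (\<lambda>t. \<gamma> t $ 3) 0 + (\<gamma> 0$3)^3 * deriv (\<lambda>t. \<gamma> t $ 1) 0 = 0"
    by (rule DERIV_unique)
  moreover have "\<not> (deriv (\<lambda>t. \<gamma> t $ 1) 0 = c * \<gamma> 0$1 \<and> deriv (\<lambda>t. \<gamma> t $ 2) 0 = c * \<gamma> 0$2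
      \<and> deriv (\<lambda>t. \<gamma> t $ 3) 0 = c * \<gamma> 0$3)" for c
    using assms unfolding local_param_def forall_3 by blast
  ultimately show ?thesis using that[OF D D D] by blast
qed

lemma ord_at_simple:
  assumes "is_form d f" "f v = 0"
    and "\<And>\<gamma> r. local_param \<gamma> r (pclass v) \<Longrightarrow> \<exists>D. D \<noteq> 0 \<and> ((\<lambda>t. f (\<gamma> t)) has_field_derivative D) (at 0)"
  shows "ord_at f (pclass v) 1"
proof (rule ord_atI)
  fix \<gamma> r assume lp: "local_param \<gamma> r (pclass v)"
  obtain c where c: "c \<noteq> 0" "\<gamma> 0 = c *s v" using local_param_at[OF lp] .
  have z: "f (\<gamma> 0) = 0" using c assms by (simp add: is_form_homogeneous[OF assms(1)])
  have r: "0 < r" using lp by (simp add: local_param_def)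
  have h: "(\<lambda>t. f (\<gamma> t)) holomorphic_on ball 0 r" using lp unfolding local_param_def
    by (intro is_form_holomorphic[OF assms(1)]) auto
  have d: "deriv (\<lambda>t. f (\<gamma> t)) 0 \<noteq> 0" using assms(3)[OF lp] by (auto dest: DERIV_imp_deriv)
  have "\<exists>g e. 0 < e \<and> g holomorphic_on ball 0 e \<and> (\<forall>w\<in>ball 0 e. f (\<gamma> w) = w * g w \<and> g w \<noteq> 0)"
  proof (rule holomorphic_factor_order_of_zero[OF h open_ball, of 0 1])
    show "(0::complex) \<in> ball 0 r" using r by simp
    show "(deriv ^^ 1) (\<lambda>t. f (\<gamma> t)) 0 \<noteq> 0" using d by simp
    fix g e
    assume "0 < e" "g holomorphic_on ball 0 e" "\<And>w. w \<in> ball 0 e \<Longrightarrow> f (\<gamma> w) - f (\<gamma> 0) = (w - 0) ^ 1 * g w"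
      "\<And>w. w \<in> ball 0 e \<Longrightarrow> g w \<noteq> 0"
    then show "\<exists>g e. 0 < e \<and> g holomorphic_on ball 0 e \<and> (\<forall>w\<in>ball 0 e. f (\<gamma> w) = w * g w \<and> g w \<noteq> 0)"
      using z by (intro exI[of _ g] exI[of _ e]) simp
  qed simp_all
  then obtain g e where "0 < e" "g holomorphic_on ball 0 e"
    "\<And>w. w \<in> ball 0 e \<Longrightarrow> f (\<gamma> w) = w * g w \<and> g w \<noteq> 0" by blast
  then show "\<exists>s g. 0 < s \<and> s \<le> r \<and> g holomorphic_on ball 0 s \<and> g 0 \<noteq> 0 \<and> (\<forall>t\<in>ball 0 s. f (\<gamma> t) = t ^ 1 * g t)"
    using z r by (intro exI[of _ "min e r"] exI[of _ g]) (auto elim: holomorphic_on_subset)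
qed

lemma local_param_transport:
  assumes "klein_pair A B" "local_param \<gamma> r (pclass v)"
  shows "local_param (\<lambda>t. B *v \<gamma> t) r (pclass (B *v v))"
proof -
  obtain c where c: "c \<noteq> 0" "\<gamma> 0 = c *s v" using local_param_at[OF assms(2)] .
  have r: "0 < r" using assms(2) by (simp add: local_param_def)
  have h: "(\<lambda>t. \<gamma> t $ i) holomorphic_on ball 0 r" for i
    using assms(2) unfolding local_param_def by auto
  have D: "((\<lambda>t. \<gamma> t $ i) has_field_derivative deriv (\<lambda>t. \<gamma> t $ i) 0) (at 0)" for i
    using r by (intro holomorphic_derivI[OF h]) auto
  define d where "d = (\<chi> i. deriv (\<lambda>t. \<gamma> t $ i) 0)"
  have dB: "deriv (\<lambda>t. (B *v \<gamma> t) $ i) 0 = (B *v d) $ i" for i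
    unfolding mv3 d_def vec_lambda_beta
    by (intro DERIV_imp_deriv) (auto intro!: derivative_eq_intros D)
  show ?thesis unfolding local_param_def
  proof (intro conjI allI ballI)
    show "0 < r" by fact
    show "(\<lambda>t. (B *v \<gamma> t) $ i) holomorphic_on ball 0 r" for i
      unfolding mv3 by (intro holomorphic_intros h)
    show "B *v \<gamma> 0 \<in> pclass (B *v v)" unfolding c(2) pclass_def using c(1)
      by (auto simp: vector_scalar_commute simp del: mv3)
    show "feval 4 klein_form (B *v \<gamma> t) = 0" if "t \<in> ball 0 r" for t
      using assms(2) that unfolding local_param_def feval_klein klein_pair_kf[OF klein_pair_sym[OF assms(1)]] by auto
    show "\<not> (\<exists>c. \<forall>i. deriv (\<lambda>t. (B *v \<gamma> t) $ i) 0 = c * (B *v \<gamma> 0) $ i)"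
    proof
      assume "\<exists>c. \<forall>i. deriv (\<lambda>t. (B *v \<gamma> t) $ i) 0 = c * (B *v \<gamma> 0) $ i"
      then obtain k where "\<forall>i. (B *v d) $ i = (k *s (B *v \<gamma> 0)) $ i" unfolding dB by auto
      then have "B *v d = B *v (k *s \<gamma> 0)" by (simp add: vec_eq_iff vector_scalar_commute del: mv3)
      then have "d = k *s \<gamma> 0" by (metis klein_pairD(1)[OF assms(1)])
      then have "\<forall>i. deriv (\<lambda>t. \<gamma> t $ i) 0 = k * \<gamma> 0 $ i" by (simp add: d_def vec_eq_iff)
      then show False using assms(2) unfolding local_param_def by blast
    qed
  qed
qed

lemma ord_at_transport:
  assumes "klein_pair A B" "ord_at f (pclass (B *v v)) n"
  shows "ord_at (\<lambda>u. f (B *v u)) (pclass v) n"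
proof (rule ord_atI)
  fix \<gamma> r assume lp: "local_param \<gamma> r (pclass v)"
  show "\<exists>s g. 0 < s \<and> s \<le> r \<and> g holomorphic_on ball 0 s \<and> g 0 \<noteq> 0 \<and> (\<forall>t\<in>ball 0 s. f (B *v \<gamma> t) = t ^ n * g t)"
    using assms(2) local_param_transport[OF assms(1) lp] unfolding ord_at_def by blast
qed

lemma mult_at_eq:
  assumes "\<And>v. feval d F v = f v" "ord_at f P n" "\<exists>\<gamma> r. local_param \<gamma> r P"
  shows "mult_at d F P = int n"
proof -
  have *: "zorder (\<lambda>t. f (\<gamma> t)) 0 = int n" if lp: "local_param \<gamma> r P" for \<gamma> r
    using ord_atE[OF assms(2) lp] zorder_factor by metis
  show ?thesis unfolding mult_at_def assms(1)
  proof (rule some_equality)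
    show "\<exists>\<gamma> r. local_param \<gamma> r P \<and> int n = zorder (\<lambda>t. f (\<gamma> t)) 0" using assms(3) * by metis
  qed (use * in blast)
qed

text \<open>Fixing \<open>p\<close> and moving \<open>(q, r)\<close> to \<open>(q + t, r - t)\<close> stays on the line \<open>p + q + r = 0\<close>; the exponents below
  solve for the coordinates, up to a common factor, with the third one held constant.\<close>

lemma ex_local_param_torus:
  assumes nz: "v$1 \<noteq> 0" "v$2 \<noteq> 0" "v$3 \<noteq> 0" and C: "kf v = 0"
  shows "\<exists>\<gamma> r. local_param \<gamma> r (pclass v)"
proof -
  define q where "q = v$2^3 * v$3"
  define s where "s = v$3^3 * v$1"
  have qs: "q \<noteq> 0" "s \<noteq> 0" using nz by (auto simp: q_def s_def)
  define R where "R = min (cmod q) (cmod s)"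
  have R: "R > 0" using qs by (simp add: R_def)
  define A where "A = (\<lambda>t. Ln (1 + t / q))"
  define B where "B = (\<lambda>t. Ln (1 - t / s))"
  have small: "cmod (t / q) < 1" "cmod (t / s) < 1" if "t \<in> ball 0 R" for t
    using that qs by (auto simp: R_def norm_divide)
  have re: "1 + t / q \<notin> \<real>\<^sub>\<le>\<^sub>0" "1 - t / s \<notin> \<real>\<^sub>\<le>\<^sub>0" if "t \<in> ball 0 R" for t
  proof -
    have "\<bar>Re (t/q)\<bar> < 1" "\<bar>Re (t/s)\<bar> < 1"
      using small[OF that] abs_Re_le_cmod by (meson order_le_less_trans)+
    then show "1 + t / q \<notin> \<real>\<^sub>\<le>\<^sub>0" "1 - t / s \<notin> \<real>\<^sub>\<le>\<^sub>0" by (auto simp: complex_nonpos_Reals_iff)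
  qed
  have eA: "exp (A t) = (q + t) / q" and eB: "exp (B t) = (s - t) / s" if "t \<in> ball 0 R" for t
    using re[OF that] qs unfolding A_def B_def
    by (subst exp_Ln; force simp: field_simps)+
  have hA: "A holomorphic_on ball 0 R" unfolding A_def
    by (intro holomorphic_intros) (use qs re in auto)
  have hB: "B holomorphic_on ball 0 R" unfolding B_def
    by (intro holomorphic_intros) (use qs re in auto)
  have dA: "(A has_field_derivative 1 / q) (at 0)" unfolding A_def
    by (auto intro!: derivative_eq_intros simp: qs)
  have dB: "(B has_field_derivative - 1 / s) (at 0)" unfolding B_def
    by (auto intro!: derivative_eq_intros simp: qs)
  define \<gamma> :: "complex \<Rightarrow> vec3" where
    "\<gamma> = (\<lambda>t. vector [v$1 * exp ((- A t - 2 * B t) / 7), v$2 * exp ((2 * A t - 3 * B t) / 7), v$3])"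
  have "local_param \<gamma> R (pclass v)" unfolding local_param_def
  proof (intro conjI allI ballI)
    show "0 < R" by fact
    have "\<forall>i. (\<lambda>t. \<gamma> t $ i) holomorphic_on ball 0 R"
      unfolding forall_3 \<gamma>_def vector_3 by (auto intro!: holomorphic_intros hA hB)
    then show "(\<lambda>t. \<gamma> t $ i) holomorphic_on ball 0 R" for i by blast
    have "\<gamma> 0 = v" by (simp add: \<gamma>_def A_def B_def vec3_eq_iff)
    then show "\<gamma> 0 \<in> pclass v" by simp
    show "feval 4 klein_form (\<gamma> t) = 0" if "t \<in> ball 0 R" for t
    proof -
      \<comment> \<open>Along the path the monomials p, q, r are multiplied by \<open>l\<close>,
        \<open>exp (A t) * l\<close> and \<open>exp (B t) * l\<close>.\<close>
      define l where "l = exp ((- A t - 9 * B t) / 7)"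
      have "exp ((- A t - 2 * B t) / 7) ^ 3 * exp ((2 * A t - 3 * B t) / 7) = l"
        unfolding l_def exp_of_nat_mult[symmetric] exp_add[symmetric]
        by (rule arg_cong[where f = exp]) (simp add: field_simps)
      moreover have "exp ((2 * A t - 3 * B t) / 7) ^ 3 = exp (A t) * l"
        unfolding l_def exp_of_nat_mult[symmetric] exp_add[symmetric]
        by (rule arg_cong[where f = exp]) (simp add: field_simps)
      moreover have "exp ((- A t - 2 * B t) / 7) = exp (B t) * l"
        unfolding l_def exp_of_nat_mult[symmetric] exp_add[symmetric]
        by (rule arg_cong[where f = exp]) (simp add: field_simps)
      ultimately have "kf (\<gamma> t) = v$1^3 * v$2 * l + q * (exp (A t) * l) + s * (exp (B t) * l)"
        unfolding kf_def \<gamma>_def vector_3 q_def s_def by (simp add: power_mult_distrib algebra_simps)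
      also have "\<dots> = v$1^3 * v$2 * l + (q * exp (A t)) * l + (s * exp (B t)) * l" by simp
      also have "q * exp (A t) = q + t" using eA[OF that] qs by simp
      also have "s * exp (B t) = s - t" using eB[OF that] qs by simp
      also have "v$1^3 * v$2 * l + (q + t) * l + (s - t) * l = (v$1^3 * v$2 + q + s) * l"
        by (simp add: algebra_simps)
      also have "\<dots> = 0" using C by (simp add: kf_def q_def s_def)
      finally show ?thesis by (simp add: feval_klein)
    qed
    have 1: "deriv (\<lambda>t. \<gamma> t $ 1) 0 = v$1 * ((- (1/q) + 2 / s) / 7)"
      unfolding \<gamma>_def vector_3 by (rule DERIV_imp_deriv)
        (auto intro!: derivative_eq_intros dA dB simp: A_def B_def qs)
    have 2: "deriv (\<lambda>t. \<gamma> t $ 2) 0 = v$2 * ((2/q + 3 / s) / 7)"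
      unfolding \<gamma>_def vector_3 by (rule DERIV_imp_deriv)
        (auto intro!: derivative_eq_intros dA dB simp: A_def B_def qs)
    have 3: "deriv (\<lambda>t. \<gamma> t $ 3) 0 = 0"
      unfolding \<gamma>_def vector_3 by simp
    show "\<not> (\<exists>c. \<forall>i. deriv (\<lambda>t. \<gamma> t $ i) 0 = c * \<gamma> 0 $ i)"
    proof
      assume "\<exists>c. \<forall>i. deriv (\<lambda>t. \<gamma> t $ i) 0 = c * \<gamma> 0 $ i"
      then obtain c where c: "\<forall>i. deriv (\<lambda>t. \<gamma> t $ i) 0 = c * \<gamma> 0 $ i" by blast
      have "c = 0" using c[rule_format, of 3] 3 nz by (simp add: \<gamma>_def)
      then have "- (1/q) + 2 / s = 0" "2/q + 3 / s = 0"
        using c[rule_format, of 1] c[rule_format, of 2] 1 2 nz by auto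
      \<comment> \<open>This combination eliminates \<open>1/q\<close>; the factor \<open>c\<close>
        is already 0 because the third coordinate is constant and nonzero.\<close>
      moreover have "7 / s = 2 * (- (1/q) + 2 / s) + (2/q + 3 / s)" by (simp add: divide_inverse algebra_simps)
      ultimately have "7 / s = 0" by simp
      then show False using qs by simp
    qed
  qed
  then show ?thesis by blast
qed

section \<open>The automorphism group of order 168\<close>

definition cycm :: "complex^3^3" where
  "cycm = vector [vector [0,0,1], vector [1,0,0], vector [0,1,0]]"

definition cycm' :: "complex^3^3" where
  "cycm' = vector [vector [0,1,0], vector [0,0,1], vector [1,0,0]]"

lemma cycm_mv [simp]: "cycm *v v = vector [v$3, v$1, v$2]" "cycm' *v v = vector [v$2, v$3, v$1]"
  by (simp_all add: vec3_eq_iff cycm_def cycm'_def)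

lemma klein_pair_cycm: "klein_pair cycm cycm'"
  unfolding klein_pair_def by (simp add: vec3_eq_iff kf_def del: mv3) (rule exI[of _ 1], simp add: algebra_simps)

definition torus :: "vec3 \<Rightarrow> bool" where
  "torus v \<longleftrightarrow> v$1 \<noteq> 0 \<and> v$2 \<noteq> 0 \<and> v$3 \<noteq> 0"

text \<open>The three monomials of the quartic are invariant under the automorphism of order seven, and their
  ratio is a coordinate on the quotient of the quartic by it, the projective line \<open>p + q + r = 0\<close>.\<close>

definition pm :: "vec3 \<Rightarrow> complex" where "pm v = v$1^3 * v$2"
definition qm :: "vec3 \<Rightarrow> complex" where "qm v = v$2^3 * v$3"
definition rm :: "vec3 \<Rightarrow> complex" where "rm v = v$3^3 * v$1"

lemma kf_pqr: "kf v = pm v + qm v + rm v"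
  by (simp add: kf_def pm_def qm_def rm_def)

lemma torus_nz: "torus v \<Longrightarrow> v \<noteq> 0 \<and> pm v \<noteq> 0 \<and> qm v \<noteq> 0 \<and> rm v \<noteq> 0"
  by (auto simp: torus_def pm_def qm_def rm_def)

text \<open>If one coordinate vanishes, a single monomial of the equation survives and forces a
  second coordinate to vanish.\<close>

lemma kf_not_torus:
  assumes "kf v = 0" "v \<noteq> 0" "\<not> torus v"
  shows "pclass v \<in> {pclass e1, pclass e2, pclass e3}"
proof -
  have "\<exists>c e. e \<in> {e1, e2, e3} \<and> c \<noteq> 0 \<and> v = c *s e"
  proof -
    consider "v$1 = 0" "v$2 = 0" | "v$2 = 0" "v$3 = 0" | "v$1 = 0" "v$3 = 0"
      using assms unfolding kf_def torus_def by force
    then show ?thesis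
    proof cases
      case 1 then show ?thesis using assms(2)
        by (intro exI[of _ "v$3"] exI[of _ e3]) (auto simp: vec3_eq_iff e3_def axis_def)
    next
      case 2 then show ?thesis using assms(2)
        by (intro exI[of _ "v$1"] exI[of _ e1]) (auto simp: vec3_eq_iff e1_def axis_def)
    next
      case 3 then show ?thesis using assms(2)
        by (intro exI[of _ "v$2"] exI[of _ e2]) (auto simp: vec3_eq_iff e2_def axis_def)
    qed
  qed
  then show ?thesis by auto
qed

text \<open>Two vectors in the plane p + q + r = 0 have a cross product proportional to (1,1,1), so
  their three minors coincide.\<close>

lemma pm_cross:
  assumes "kf v = 0" "kf w = 0"
  shows "qm v * rm w - rm v * qm w = pm v * qm w - qm v * pm w"
    "rm v * pm w - pm v * rm w = pm v * qm w - qm v * pm w"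
proof -
  have r: "rm v = - pm v - qm v" "rm w = - pm w - qm w"
    using assms unfolding kf_pqr by (simp_all add: algebra_simps add_eq_0_iff)
  show "qm v * rm w - rm v * qm w = pm v * qm w - qm v * pm w"
    "rm v * pm w - pm v * rm w = pm v * qm w - qm v * pm w"
    unfolding r by (simp_all add: algebra_simps)
qed

locale klein_root =
  fixes z :: complex
  assumes z7: "z ^ 7 = 1" and z1: "z \<noteq> 1"
begin

lemma zsum: "1 + z + z^2 + z^3 + z^4 + z^5 + z^6 = 0"
proof -
  have "(z - 1) * (1 + z + z^2 + z^3 + z^4 + z^5 + z^6) = z^7 - 1" by algebra
  then show ?thesis using z7 z1 by simp
qed

lemma z_nz [simp]: "z \<noteq> 0"
  using z7 by auto

lemma z_pow_mod: "z ^ k = z ^ (k mod 7)"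
proof -
  have "z ^ k = z ^ (7 * (k div 7) + k mod 7)" by simp
  also have "\<dots> = z ^ (k mod 7)" unfolding power_add power_mult z7 by simp
  finally show ?thesis .
qed

text \<open>As 7 is prime, an exponent that is nonzero modulo 7 is invertible there, and
  \<open>z ^ k = 1\<close> would give \<open>z = 1\<close>.\<close>

lemma z_pow_eq_1: "z ^ k = 1 \<longleftrightarrow> k mod 7 = 0"
proof
  assume k: "z ^ k = 1"
  show "k mod 7 = 0"
  proof (rule ccontr)
    assume "k mod 7 \<noteq> 0"
    then have "coprime k 7"
      using prime_imp_coprime[of 7 k] by (simp add: coprime_commute dvd_eq_mod_eq_0)
    then obtain u w where "k * u = 7 * w + 1" using bezout_nat[of k 7] \<open>k mod 7 \<noteq> 0\<close>
      by (cases "k = 0") auto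
    then have "(z ^ k) ^ u = (z ^ 7) ^ w * z" by (simp add: power_mult[symmetric])
    then show False using k z7 z1 by simp
  qed
qed (use z_pow_mod[of k] in simp)

lemma z_pow_inj: "z ^ i = z ^ j \<longleftrightarrow> i mod 7 = j mod 7"
proof -
  have *: "z ^ i = z ^ j \<longleftrightarrow> i mod 7 = j mod 7" if "i \<le> j" for i j
  proof -
    have "z ^ i = z ^ j \<longleftrightarrow> z ^ (j - i) = 1"
      using that by (metis z_nz le_add_diff_inverse mult_cancel_left1 power_add power_not_zero)
    also have "\<dots> \<longleftrightarrow> i mod 7 = j mod 7"
      unfolding z_pow_eq_1 using mod_eq_dvd_iff_nat[OF that, of 7] by (auto simp: dvd_eq_mod_eq_0)
    finally show ?thesis .
  qed
  show ?thesis using *[of i j] *[of j i] by (metis nle_le)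
qed

lemma seventh_root:
  assumes "w ^ 7 = 1"
  obtains k where "k < 7" "w = z ^ k"
proof -
  have inj: "inj_on (\<lambda>k. z ^ k) {..<7}" by (auto simp: inj_on_def z_pow_inj)
  have sub: "(\<lambda>k. z ^ k) ` {..<7} \<subseteq> {w. w ^ 7 = 1}"
  proof clarsimp
    fix k have "(z ^ k) ^ 7 = (z ^ 7) ^ k" by (simp only: power_mult[symmetric] mult.commute)
    then show "(z ^ k) ^ 7 = 1" using z7 by simp
  qed
  have "card {w::complex. w ^ 7 = 1} = 7" by (rule card_roots_unity_eq) simp
  then have "(\<lambda>k. z ^ k) ` {..<7} = {w. w ^ 7 = 1}"
    using card_image[OF inj] by (intro card_subset_eq[OF _ sub]) (auto simp: finite_roots_unity)
  then show ?thesis using assms that by blast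
qed

definition Dm :: "nat \<Rightarrow> complex^3^3" where
  "Dm k = diag3 (z ^ (4 * k)) (z ^ (2 * k)) (z ^ k)"

lemma Dm_mv [simp]: "Dm k *v v = vector [z ^ (4 * k) * v$1, z ^ (2 * k) * v$2, z ^ k * v$3]"
  by (simp add: vec3_eq_iff Dm_def diag3_def)

lemma Dm_eqI: "k mod 7 = l mod 7 \<Longrightarrow> Dm k = Dm l"
proof -
  assume "k mod 7 = l mod 7"
  then have "(m * k) mod 7 = (m * l) mod 7" for m by (metis mod_mult_right_eq)
  then have "z ^ (m * k) = z ^ (m * l)" for m by (simp add: z_pow_inj)
  from this[of 4] this[of 2] this[of 1] show "Dm k = Dm l" unfolding Dm_def by simp
qed

lemma Dm_add: "Dm k *v (Dm l *v v) = Dm (k + l) *v v"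
  by (simp add: vec3_eq_iff power_add algebra_simps del: mv3)

lemma Dm_0: "k mod 7 = 0 \<Longrightarrow> Dm k *v v = v"
proof -
  assume "k mod 7 = 0"
  then have "Dm k = Dm 0" by (intro Dm_eqI) simp
  then show ?thesis by (simp only:) (simp add: vec3_eq_iff del: mv3)
qed

lemma pqr_Dm [simp]: "pm (Dm k *v v) = pm v" "qm (Dm k *v v) = qm v" "rm (Dm k *v v) = rm v"
proof -
  have *: "z ^ (7 * n) = 1" for n by (simp add: z_pow_eq_1)
  have "pm (Dm k *v v) = z ^ (7 * (2 * k)) * pm v" "qm (Dm k *v v) = z ^ (7 * k) * qm v" "rm (Dm k *v v) = z ^ (7 * k) * rm v"
    unfolding pm_def qm_def rm_def Dm_mv vector_3 power_mult_distrib power_mult[symmetric]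
    by (simp_all add: power_add[symmetric] algebra_simps del: mv3)
  then show "pm (Dm k *v v) = pm v" "qm (Dm k *v v) = qm v" "rm (Dm k *v v) = rm v"
    unfolding * by simp_all
qed

lemma kf_Dm [simp]: "kf (Dm k *v v) = kf v"
  unfolding kf_pqr by (simp del: Dm_mv mv3)

lemma torus_Dm [simp]: "torus (Dm k *v v) \<longleftrightarrow> torus v"
  by (simp add: torus_def del: mv3)

lemma klein_pair_Dm: "klein_pair (Dm k) (Dm (6 * k))"
proof -
  have "kf (Dm k *v v) = 1 * kf v" for v by (simp del: Dm_mv mv3)
  moreover have "(k + 6 * k) mod 7 = 0" "(6 * k + k) mod 7 = 0" by presburger+
  ultimately show ?thesis unfolding klein_pair_def by (metis Dm_add Dm_0 one_neq_zero)
qed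

text \<open>The coordinate quotients satisfy \<open>x^3 y = y^3 w = w^3 x\<close>. With
  \<open>b = y / w\<close> this gives \<open>x = b^3 w\<close> and \<open>b^7 = 1\<close>, so the
  quotients are \<open>w / b\<close> times \<open>(b^4, b^2, b)\<close>, a diagonal of the form
  \<open>Dm m\<close>.\<close>

lemma torus_ratio:
  assumes "torus u" "torus v" "kf u = 0" "kf v = 0" "pm u * qm v = qm u * pm v"
  obtains c m where "c \<noteq> 0" "m < 7" "u = c *s (Dm m *v v)"
proof -
  define x where "x = u$1 / v$1"
  define y where "y = u$2 / v$2"
  define w where "w = u$3 / v$3"
  have nz: "x \<noteq> 0" "y \<noteq> 0" "w \<noteq> 0" using assms by (auto simp: torus_def x_def y_def w_def)
  have u: "u$1 = x * v$1" "u$2 = y * v$2" "u$3 = w * v$3"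
    using assms by (auto simp: torus_def x_def y_def w_def)
  have pq: "pm u = x^3 * y * pm v" "qm u = y^3 * w * qm v" "rm u = w^3 * x * rm v"
    unfolding pm_def qm_def rm_def u by (simp_all add: power_mult_distrib algebra_simps)
  have e: "x^3 * y = y^3 * w"
    using assms(5) torus_nz[OF assms(2)] unfolding pq by (simp add: algebra_simps)
  have "qm u * rm v = rm u * qm v"
    using pm_cross[OF assms(3,4)] assms(5) by (simp add: algebra_simps)
  then have e': "y^3 * w = w^3 * x"
    using torus_nz[OF assms(2)] unfolding pq by (simp add: algebra_simps)
  define b where "b = y / w"
  have y: "y = b * w" using nz by (simp add: b_def)
  have x: "x = b^3 * w"
  proof -
    have "w^3 * x = w^3 * (b^3 * w)" using e' unfolding y by algebra
    then show ?thesis using nz by (metis mult_cancel_left power_not_zero)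
  qed
  have "b^10 * w^4 = b^3 * w^4" using e unfolding x y by algebra
  then have "b^3 * (b^7 - 1) * w^4 = 0" by algebra
  moreover have "b \<noteq> 0" using nz by (simp add: b_def)
  ultimately have "b ^ 7 = 1" using nz by simp
  then obtain m where m: "m < 7" "b = z ^ m" by (rule seventh_root)
  have z: "z ^ (4 * m) = b^4" "z ^ (2 * m) = b^2" by (simp_all add: m power_mult[symmetric] mult.commute)
  have "u = (w / b) *s (Dm m *v v)"
    unfolding vec3_eq_iff Dm_mv vector_smult_component vector_3 z m(2)[symmetric] u x y
    using \<open>b \<noteq> 0\<close> by (simp add: field_simps eval_nat_numeral)
  then show ?thesis using nz m \<open>b \<noteq> 0\<close> by (intro that[of "w / b" m]) auto
qed

text \<open>A polynomial of degree below seven with seven distinct roots is zero. This separates the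
  weight components of a form on an orbit of \<open>Dm 1\<close>.\<close>

lemma dft_zero:
  assumes "\<And>k. k < 7 \<Longrightarrow> (\<Sum>w<7. c w * (z ^ k) ^ w) = 0" "w < 7"
  shows "c w = (0::complex)"
proof -
  define p where "p = (\<Sum>w<7. monom (c w) w)"
  have deg: "degree p < 7" unfolding p_def
    by (rule degree_sum_less) (auto intro: le_less_trans[OF degree_monom_le])
  have "p = 0"
  proof (rule poly_eqI_degree[of "(\<lambda>k. z ^ k) ` {..<7}"])
    show "poly p x = poly 0 x" if "x \<in> (\<lambda>k. z ^ k) ` {..<7}" for x
      using that assms(1) by (auto simp: p_def poly_sum poly_monom)
    have "card ((\<lambda>k. z ^ k) ` {..<7::nat}) = 7"
      by (subst card_image) (auto simp: inj_on_def z_pow_inj)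
    then show "degree p < card ((\<lambda>k. z ^ k) ` {..<7::nat})" "degree (0::complex poly) < card ((\<lambda>k. z ^ k) ` {..<7::nat})"
      using deg by auto
  qed
  then have "coeff p w = 0" by simp
  then show ?thesis using assms(2) by (simp add: p_def coeff_sum)
qed

end

section \<open>Uniqueness of the quartic through two orbits\<close>

lemma monoms_4: "monoms 4 = {(4,0,0),(0,4,0),(0,0,4),(3,1,0),(3,0,1),(1,3,0),(0,3,1),(1,0,3),(0,1,3),
   (2,2,0),(2,0,2),(0,2,2),(2,1,1),(1,2,1),(1,1,2)}"
  (is "_ = ?R")
proof
  show "?R \<subseteq> monoms 4" by (simp add: monoms_def)
  show "monoms 4 \<subseteq> ?R"
  proof
    fix m assume "m \<in> monoms 4"
    then obtain i j k where m: "m = (i,j,k)" "i + j + k = 4" unfolding monoms_def by blast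
    then have k: "k = 4 - i - j" and ij: "i + j \<le> 4" by auto
    have "i = 0 \<or> i = 1 \<or> i = 2 \<or> i = 3 \<or> i = 4" using ij by linarith
    moreover have "j = 0 \<or> j = 1 \<or> j = 2 \<or> j = 3 \<or> j = 4" using ij by linarith
    ultimately show "m \<in> ?R" unfolding m(1) k using ij by (elim disjE) simp_all
  qed
qed

lemma two_by_two:
  fixes a b :: complex
  assumes "a * x + b * y = 0" "a * x' + b * y' = 0" "x * y' - y * x' \<noteq> 0"
  shows "a = 0" "b = 0"
proof -
  have "a * (x * y' - y * x') = (a * x + b * y) * y' - (a * x' + b * y') * y" by algebra
  then show "a = 0" using assms by simp
  have "b * (x * y' - y * x') = (a * x' + b * y') * x - (a * x + b * y) * x'" by algebra
  then show "b = 0" using assms by simp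
qed

context klein_root
begin

text \<open>A quartic vanishing on both orbits of \<open>Dm 1\<close> has all its weight components vanishing at \<open>v\<close> and \<open>w\<close>.
  Each nonzero weight contains only two monomials, and their quotient is \<open>q/r\<close>, \<open>p/q\<close> or \<open>r/p\<close>, which
  takes different values at \<open>v\<close> and \<open>w\<close>; only multiples of \<open>p + q + r\<close> remain.\<close>

lemma quartic_unique:
  assumes tv: "torus v" "kf v = 0" and tw: "torus w" "kf w = 0"
    and ne: "pm v * qm w \<noteq> qm v * pm w"
    and vv: "\<And>k. k < 7 \<Longrightarrow> feval 4 G (Dm k *v v) = 0"
    and vw: "\<And>k. k < 7 \<Longrightarrow> feval 4 G (Dm k *v w) = 0"
  shows "\<exists>a. \<forall>m\<in>monoms 4. G m = a * klein_form m"
proof -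
  \<comment> \<open>\<open>S u i\<close> collects the monomials \<open>x^a y^b z^c\<close> with
    \<open>4a + 2b + c\<close> congruent to \<open>i\<close> modulo 7, evaluated at
    \<open>u\<close>.\<close>
  define S where "S = (\<lambda>u::vec3. \<lambda>i::nat.
    (if i = 0 then G (3,1,0) * pm u + G (0,3,1) * qm u + G (1,0,3) * rm u
     else if i = 1 then G (0,4,0) * u$2^4 + G (1,1,2) * (u$1 * u$2 * u$3^2)
     else if i = 2 then G (4,0,0) * u$1^4 + G (1,2,1) * (u$1 * u$2^2 * u$3)
     else if i = 3 then G (1,3,0) * (u$1 * u$2^3) + G (2,0,2) * (u$1^2 * u$3^2)
     else if i = 4 then G (0,0,4) * u$3^4 + G (2,1,1) * (u$1^2 * u$2 * u$3)
     else if i = 5 then G (0,1,3) * (u$2 * u$3^3) + G (2,2,0) * (u$1^2 * u$2^2)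
     else G (3,0,1) * (u$1^3 * u$3) + G (0,2,2) * (u$2^2 * u$3^2)))"
  have ev: "feval 4 G (Dm k *v u) = (\<Sum>i<7. S u i * (z ^ k) ^ i)" for k u
  proof -
    define t where "t = z ^ k"
    have t7: "t ^ 7 = 1" using z7 unfolding t_def by (metis power_mult mult.commute power_one)
    have t: "z ^ (4 * k) = t ^ 4" "z ^ (2 * k) = t ^ 2" by (simp_all add: t_def power_mult[symmetric] mult.commute)
    have red: "t^8 = t" "t^9 = t^2" "t^10 = t^3" "t^11 = t^4" "t^12 = t^5" "t^13 = t^6" "t^14 = 1" "t^16 = t^2"
      using t7 by algebra+
    have "feval 4 G (Dm k *v u) =
       G (4,0,0) * (t^4 * u$1)^4 + G (0,4,0) * (t^2 * u$2)^4 + G (0,0,4) * (t * u$3)^4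
     + G (3,1,0) * (t^4 * u$1)^3 * (t^2 * u$2) + G (3,0,1) * (t^4 * u$1)^3 * (t * u$3)
     + G (1,3,0) * (t^4 * u$1) * (t^2 * u$2)^3 + G (0,3,1) * (t^2 * u$2)^3 * (t * u$3)
     + G (1,0,3) * (t^4 * u$1) * (t * u$3)^3 + G (0,1,3) * (t^2 * u$2) * (t * u$3)^3
     + G (2,2,0) * (t^4 * u$1)^2 * (t^2 * u$2)^2 + G (2,0,2) * (t^4 * u$1)^2 * (t * u$3)^2
     + G (0,2,2) * (t^2 * u$2)^2 * (t * u$3)^2 + G (2,1,1) * (t^4 * u$1)^2 * (t^2 * u$2) * (t * u$3)
     + G (1,2,1) * (t^4 * u$1) * (t^2 * u$2)^2 * (t * u$3) + G (1,1,2) * (t^4 * u$1) * (t^2 * u$2) * (t * u$3)^2"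
      unfolding feval_def monoms_4 Dm_mv vector_3 t t_def[symmetric] by simp
    also have "\<dots> =
       G (4,0,0) * t^16 * u$1^4 + G (0,4,0) * t^8 * u$2^4 + G (0,0,4) * t^4 * u$3^4
     + G (3,1,0) * t^14 * (u$1^3 * u$2) + G (3,0,1) * t^13 * (u$1^3 * u$3)
     + G (1,3,0) * t^10 * (u$1 * u$2^3) + G (0,3,1) * t^7 * (u$2^3 * u$3)
     + G (1,0,3) * t^7 * (u$3^3 * u$1) + G (0,1,3) * t^5 * (u$2 * u$3^3)
     + G (2,2,0) * t^12 * (u$1^2 * u$2^2) + G (2,0,2) * t^10 * (u$1^2 * u$3^2)
     + G (0,2,2) * t^6 * (u$2^2 * u$3^2) + G (2,1,1) * t^11 * (u$1^2 * u$2 * u$3)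
     + G (1,2,1) * t^9 * (u$1 * u$2^2 * u$3) + G (1,1,2) * t^8 * (u$1 * u$2 * u$3^2)"
      by algebra
    also have "\<dots> = (\<Sum>i<7. S u i * t ^ i)"
      unfolding red t7 by (simp add: S_def eval_nat_numeral pm_def qm_def rm_def) (simp add: algebra_simps)
    finally show ?thesis unfolding t_def .
  qed
  have Sv: "S v i = 0" and Sw: "S w i = 0" if "i < 7" for i
    using dft_zero[of "S v", OF _ that] dft_zero[of "S w", OF _ that] vv vw unfolding ev by auto
  have D: "qm v * rm w - rm v * qm w \<noteq> 0" "rm v * pm w - pm v * rm w \<noteq> 0" "pm v * qm w - qm v * pm w \<noteq> 0"
    using ne pm_cross[OF tv(2) tw(2)] by auto
  have nz: "v$1 \<noteq> 0" "v$2 \<noteq> 0" "v$3 \<noteq> 0" "w$1 \<noteq> 0" "w$2 \<noteq> 0" "w$3 \<noteq> 0"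
    using tv tw by (auto simp: torus_def)
  \<comment> \<open>For each nonzero weight the determinant of its two monomials at \<open>v\<close>
    and \<open>w\<close> is, up to nonzero monomial factors, one of the minors in
    \<open>D\<close>.\<close>
  have i1: "v$2^4 * (w$1 * w$2 * w$3^2) - v$1 * v$2 * v$3^2 * w$2^4 \<noteq> 0"
  proof -
    have "v$3 * w$3 * (v$2^4 * (w$1 * w$2 * w$3^2) - v$1 * v$2 * v$3^2 * w$2^4) = v$2 * w$2 * (qm v * rm w - rm v * qm w)"
      unfolding pm_def qm_def rm_def by algebra
    then show ?thesis using D nz by (metis mult_eq_0_iff)
  qed
  have i2: "v$1^4 * (w$1 * w$2^2 * w$3) - v$1 * v$2^2 * v$3 * w$1^4 \<noteq> 0"
  proof -
    have "v$2 * w$2 * (v$1^4 * (w$1 * w$2^2 * w$3) - v$1 * v$2^2 * v$3 * w$1^4) = v$1 * w$1 * (pm v * qm w - qm v * pm w)"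
      unfolding pm_def qm_def rm_def by algebra
    then show ?thesis using D nz by (metis mult_eq_0_iff)
  qed
  have i3: "v$1 * v$2^3 * (w$1^2 * w$3^2) - v$1^2 * v$3^2 * (w$1 * w$2^3) \<noteq> 0"
  proof -
    have "v$3 * w$3 * (v$1 * v$2^3 * (w$1^2 * w$3^2) - v$1^2 * v$3^2 * (w$1 * w$2^3)) = v$1 * w$1 * (qm v * rm w - rm v * qm w)"
      unfolding pm_def qm_def rm_def by algebra
    then show ?thesis using D nz by (metis mult_eq_0_iff)
  qed
  have i4: "v$3^4 * (w$1^2 * w$2 * w$3) - v$1^2 * v$2 * v$3 * w$3^4 \<noteq> 0"
  proof -
    have "v$1 * w$1 * (v$3^4 * (w$1^2 * w$2 * w$3) - v$1^2 * v$2 * v$3 * w$3^4) = v$3 * w$3 * (rm v * pm w - pm v * rm w)"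
      unfolding pm_def qm_def rm_def by algebra
    then show ?thesis using D nz by (metis mult_eq_0_iff)
  qed
  have i5: "v$2 * v$3^3 * (w$1^2 * w$2^2) - v$1^2 * v$2^2 * (w$2 * w$3^3) \<noteq> 0"
  proof -
    have "v$1 * w$1 * (v$2 * v$3^3 * (w$1^2 * w$2^2) - v$1^2 * v$2^2 * (w$2 * w$3^3)) = v$2 * w$2 * (rm v * pm w - pm v * rm w)"
      unfolding pm_def qm_def rm_def by algebra
    then show ?thesis using D nz by (metis mult_eq_0_iff)
  qed
  have i6: "v$1^3 * v$3 * (w$2^2 * w$3^2) - v$2^2 * v$3^2 * (w$1^3 * w$3) \<noteq> 0"
  proof -
    have "v$2 * w$2 * (v$1^3 * v$3 * (w$2^2 * w$3^2) - v$2^2 * v$3^2 * (w$1^3 * w$3)) = v$3 * w$3 * (pm v * qm w - qm v * pm w)"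
      unfolding pm_def qm_def rm_def by algebra
    then show ?thesis using D nz by (metis mult_eq_0_iff)
  qed
  have r: "rm v = - pm v - qm v" "rm w = - pm w - qm w"
    using tv tw unfolding kf_pqr by (simp_all add: algebra_simps add_eq_0_iff)
  \<comment> \<open>In weight 0, replacing r by -p-q subtracts the coefficient of r from the other
    two.\<close>
  have "(G (3,1,0) - G (1,0,3)) * pm v + (G (0,3,1) - G (1,0,3)) * qm v = 0"
    "(G (3,1,0) - G (1,0,3)) * pm w + (G (0,3,1) - G (1,0,3)) * qm w = 0"
    using Sv[of 0] Sw[of 0] unfolding S_def r by (simp_all add: algebra_simps)
  from two_by_two[OF this D(3)] have z0: "G (3,1,0) = G (1,0,3)" "G (0,3,1) = G (1,0,3)" by simp_all
  have "G (0,4,0) * v$2^4 + G (1,1,2) * (v$1 * v$2 * v$3^2) = 0"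
    "G (0,4,0) * w$2^4 + G (1,1,2) * (w$1 * w$2 * w$3^2) = 0"
    using Sv[of 1] Sw[of 1] unfolding S_def by simp_all
  note s1 = two_by_two[OF this i1]
  have "G (4,0,0) * v$1^4 + G (1,2,1) * (v$1 * v$2^2 * v$3) = 0"
    "G (4,0,0) * w$1^4 + G (1,2,1) * (w$1 * w$2^2 * w$3) = 0"
    using Sv[of 2] Sw[of 2] unfolding S_def by simp_all
  note s2 = two_by_two[OF this i2]
  have "G (1,3,0) * (v$1 * v$2^3) + G (2,0,2) * (v$1^2 * v$3^2) = 0"
    "G (1,3,0) * (w$1 * w$2^3) + G (2,0,2) * (w$1^2 * w$3^2) = 0"
    using Sv[of 3] Sw[of 3] unfolding S_def by simp_all
  note s3 = two_by_two[OF this i3]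
  have "G (0,0,4) * v$3^4 + G (2,1,1) * (v$1^2 * v$2 * v$3) = 0"
    "G (0,0,4) * w$3^4 + G (2,1,1) * (w$1^2 * w$2 * w$3) = 0"
    using Sv[of 4] Sw[of 4] unfolding S_def by simp_all
  note s4 = two_by_two[OF this i4]
  have "G (0,1,3) * (v$2 * v$3^3) + G (2,2,0) * (v$1^2 * v$2^2) = 0"
    "G (0,1,3) * (w$2 * w$3^3) + G (2,2,0) * (w$1^2 * w$2^2) = 0"
    using Sv[of 5] Sw[of 5] unfolding S_def by simp_all
  note s5 = two_by_two[OF this i5]
  have "G (3,0,1) * (v$1^3 * v$3) + G (0,2,2) * (v$2^2 * v$3^2) = 0"
    "G (3,0,1) * (w$1^3 * w$3) + G (0,2,2) * (w$2^2 * w$3^2) = 0"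
    using Sv[of 6] Sw[of 6] unfolding S_def by simp_all
  note s6 = two_by_two[OF this i6]
  show ?thesis
    by (rule exI[of _ "G (1,0,3)"]) (simp add: monoms_4 klein_form_def z0 s1 s2 s3 s4 s5 s6 del: One_nat_def)
qed

end

lemma quartic_zero_fun:
  fixes a0 a1 a2 a3 a4 :: complex
  assumes "\<And>t. a0 + a1 * t + a2 * t^2 + a3 * t^3 + a4 * t^4 = 0"
  shows "a0 = 0 \<and> a1 = 0 \<and> a2 = 0 \<and> a3 = 0 \<and> a4 = 0"
proof -
  have p: "a0 = 0" "a0 + a1 + a2 + a3 + a4 = 0" "a0 - a1 + a2 - a3 + a4 = 0"
    "a0 + 2 * a1 + 4 * a2 + 8 * a3 + 16 * a4 = 0" "a0 - 2 * a1 + 4 * a2 - 8 * a3 + 16 * a4 = 0"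
    using assms[of 0] assms[of 1] assms[of "-1"] assms[of 2] assms[of "-2"] by (simp_all add: algebra_simps)
  have "12 * a1 = 0" "24 * a2 = 0" "12 * a3 = 0" "24 * a4 = 0" using p by algebra+
  then show ?thesis using p(1) by simp
qed

lemma det3_kernel:
  fixes a :: complex
  assumes "a * x + b * y + c * z = 0" "d * x + e * y + f * z = 0" "g * x + h * y + i * z = 0"
    "x \<noteq> 0 \<or> y \<noteq> 0 \<or> z \<noteq> 0"
  shows "a * (e * i - f * h) - b * (d * i - f * g) + c * (d * h - e * g) = 0"
proof -
  let ?d = "a * (e * i - f * h) - b * (d * i - f * g) + c * (d * h - e * g)"
  have "?d * x = 0" "?d * y = 0" "?d * z = 0" using assms(1-3) by algebra+
  then show ?thesis using assms(4) by auto
qed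

text \<open>If the line through \<open>u\<close> and \<open>w\<close> meets the quartic three times at \<open>u\<close>, then the Hessian form at \<open>u\<close>
  vanishes identically on the plane spanned by \<open>u\<close> and \<open>w\<close>, so it is degenerate.\<close>

lemma flex_hessian:
  assumes "crs u w \<noteq> 0" and cub: "\<And>t. kf (u + t *s w) = c * t^3"
  shows "u$1 * u$2^5 + u$2 * u$3^5 + u$3 * u$1^5 = 5 * u$1^2 * u$2^2 * u$3^2"
proof -
  define x y z where "x = u$1" and "y = u$2" and "z = u$3"
  define X Y Z where "X = w$1" and "Y = w$2" and "Z = w$3"
  \<comment> \<open>\<open>G\<close> is the gradient of \<open>kf\<close> at \<open>u\<close>, and
    \<open>H\<close> is a third of the Hessian matrix at \<open>u\<close> applied to
    \<open>w\<close>.\<close>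
  define G where "G = (vector [3*x^2*y + z^3, x^3 + 3*y^2*z, y^3 + 3*z^2*x] :: vec3)"
  define H where "H = (vector [2*x*y*X + x^2*Y + z^2*Z, x^2*X + 2*y*z*Y + y^2*Z, z^2*X + y^2*Y + 2*z*x*Z] :: vec3)"
  have "kf u + dot G w * t + (3 / 2 * dot H w) * t^2 + ((3*x*X^2*Y + X^3*y + 3*y*Y^2*Z + Y^3*z + 3*z*Z^2*X + Z^3*x) - c) * t^3 + kf w * t^4 = 0" for t
  proof -
    have "kf (u + t *s w) = kf u + dot G w * t + (3 / 2 * dot H w) * t^2 +
      (3*x*X^2*Y + X^3*y + 3*y*Y^2*Z + Y^3*z + 3*z*Z^2*X + Z^3*x) * t^3 + kf w * t^4"
      unfolding kf_def G_def H_def dot_def vector_3 X_def[symmetric] Y_def[symmetric] Z_def[symmetric]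
        x_def[symmetric] y_def[symmetric] z_def[symmetric] vector_add_component vector_smult_component
      by (simp add: power2_eq_square power3_eq_cube power4_eq_xxxx algebra_simps)
    then show ?thesis using cub[of t] by (simp add: algebra_simps)
  qed
  from quartic_zero_fun[OF this] have k: "kf u = 0" and g1: "dot G w = 0" and g2: "dot H w = 0" by auto
  have g0: "dot G u = 0" using k unfolding kf_def G_def dot_def x_def y_def z_def vector_3 by algebra
  have g3: "dot H u = 0" using g1 unfolding G_def H_def dot_def x_def y_def z_def X_def Y_def Z_def vector_3 by algebra
  \<comment> \<open>Both vectors are orthogonal to \<open>u\<close> and \<open>w\<close>, hence
    multiples of \<open>crs u w\<close> and linearly dependent.\<close>
  obtain \<kappa> where \<kappa>: "G = \<kappa> *s crs u w" using perp_both[OF g0 g1 assms(1)] .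
  obtain \<mu> where \<mu>: "H = \<mu> *s crs u w" using perp_both[OF g3 g2 assms(1)] .
  have "\<exists>a b. (a \<noteq> 0 \<or> b \<noteq> 0) \<and> a *s G + b *s H = 0"
  proof (cases "\<kappa> = 0")
    case True then show ?thesis unfolding \<kappa> \<mu> by (intro exI[of _ 1] exI[of _ 0]) (simp add: vec3_eq_iff)
  next
    case False then show ?thesis unfolding \<kappa> \<mu>
      by (intro exI[of _ "\<mu>"] exI[of _ "-\<kappa>"]) (simp add: vec3_eq_iff)
  qed
  then obtain a b where ab: "a \<noteq> 0 \<or> b \<noteq> 0" "a *s G + b *s H = 0" by blast
  \<comment> \<open>By Euler's relation \<open>G\<close> is a third of the Hessian matrix applied to
    \<open>u\<close>, so the dependence puts \<open>v\<close> in its kernel.\<close>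
  define v where "v = a *s u + b *s w"
  have "v \<noteq> 0"
  proof
    assume v0: "v = 0"
    have "a *s crs u w = crs v w" "b *s crs u w = crs u v"
      by (simp_all add: v_def vec3_eq_iff crs_def algebra_simps)
    then have "a *s crs u w = 0" "b *s crs u w = 0" unfolding v0 by (simp_all add: vec3_eq_iff crs_def)
    then show False using ab(1) assms(1) by simp
  qed
  moreover have "(2*x*y) * v$1 + x^2 * v$2 + z^2 * v$3 = 0" "x^2 * v$1 + (2*y*z) * v$2 + y^2 * v$3 = 0"
    "z^2 * v$1 + y^2 * v$2 + (2*z*x) * v$3 = 0"
    using ab(2) unfolding v_def vec3_eq_iff G_def H_def vector_3 X_def Y_def Z_def x_def y_def z_def
    by (simp_all add: power2_eq_square power3_eq_cube algebra_simps)
  ultimately have "(2*x*y) * ((2*y*z) * (2*z*x) - y^2 * y^2) - x^2 * (x^2 * (2*z*x) - y^2 * z^2)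
      + z^2 * (x^2 * y^2 - (2*y*z) * z^2) = 0"
    by (intro det3_kernel) (auto simp: vec3_eq_iff)
  then have "2 * (x * y^5 + y * z^5 + z * x^5 - 5 * x^2 * y^2 * z^2) = 0" by algebra
  then have "x * y^5 + y * z^5 + z * x^5 = 5 * x^2 * y^2 * z^2"
    by (subst (asm) mult_eq_0_iff) simp
  then show ?thesis unfolding x_def y_def z_def .
qed

section \<open>The circulant involution, the flexes and the classification of automorphisms\<close>

context klein_root
begin

text \<open>The numbers \<open>z^k - z^(-k)\<close> for k = 1, 2, 4; their sum \<open>zs\<close> is
  the quadratic Gauss sum, a square root of -7.\<close>

definition za :: complex where "za = z - z^6"
definition zb :: complex where "zb = z^2 - z^5"
definition zc :: complex where "zc = z^4 - z^3"
definition zs :: complex where "zs = za + zb + zc"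

lemmas zabc_defs = za_def zb_def zc_def zs_def

lemma zabc_rels: "zs^2 = -7" "za*zb + zb*zc + zc*za = 0" "za*zb*zc = zs" "za^2*zb + zb^2*zc + zc^2*za = -zs"
proof -
  show "zs^2 = -7" unfolding zabc_defs using zsum by algebra
  show "za*zb + zb*zc + zc*za = 0" unfolding zabc_defs using zsum by algebra
  show "za*zb*zc = zs" unfolding zabc_defs using zsum by algebra
  show "za^2*zb + zb^2*zc + zc^2*za = -zs" unfolding zabc_defs using zsum by algebra
qed

lemma zs_nz: "zs \<noteq> 0"
  using zabc_rels(1) by auto

lemma zabc_nz: "za \<noteq> 0" "zb \<noteq> 0" "zc \<noteq> 0"
  using zabc_rels(3) zs_nz by auto

lemma zabc_sq: "za^2 + zb^2 + zc^2 = -7"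
  using zabc_rels(1,2) unfolding zs_def by algebra

text \<open>Left unscaled: the square of this matrix is -7, so it is an involution of the
  plane.\<close>

definition Jm :: "complex^3^3" where
  "Jm = vector [vector [za,zb,zc], vector [zb,zc,za], vector [zc,za,zb]]"

definition Jm' :: "complex^3^3" where
  "Jm' = vector [vector [-za/7,-zb/7,-zc/7], vector [-zb/7,-zc/7,-za/7], vector [-zc/7,-za/7,-zb/7]]"

lemma Jm_mv [simp]: "Jm *v v = vector [za * v$1 + zb * v$2 + zc * v$3, zb * v$1 + zc * v$2 + za * v$3, zc * v$1 + za * v$2 + zb * v$3]"
  by (simp add: vec3_eq_iff Jm_def)

lemma Jm'_mv: "Jm' *v v = (-1/7) *s (Jm *v v)"
  by (simp add: vec3_eq_iff Jm'_def Jm_def field_simps)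

lemma Jm_Jm: "Jm *v (Jm *v v) = (-7) *s v"
proof -
  define x y w where "x = v$1" and "y = v$2" and "w = v$3"
  have "za * (za*x + zb*y + zc*w) + zb * (zb*x + zc*y + za*w) + zc * (zc*x + za*y + zb*w) = -7 * x"
    "zb * (za*x + zb*y + zc*w) + zc * (zb*x + zc*y + za*w) + za * (zc*x + za*y + zb*w) = -7 * y"
    "zc * (za*x + zb*y + zc*w) + za * (zb*x + zc*y + za*w) + zb * (zc*x + za*y + zb*w) = -7 * w"
    using zabc_sq zabc_rels(2) by algebra+
  then show ?thesis unfolding Jm_mv vec3_eq_iff vector_3 vector_smult_component x_def y_def w_def by blast
qed

lemma kf_Jm: "kf (Jm *v v) = 49 * kf v"
proof -
  define x y w where "x = v$1" and "y = v$2" and "w = v$3"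
  \<comment> \<open>The expansion is grouped by cyclic orbits of monomials. Of the coefficient
    expressions only the one for \<open>x^3 y\<close>, \<open>y^3 w\<close>, \<open>w^3 x\<close> is
    nonzero.\<close>
  have C40: "za^3*zb + zb^3*zc + zc^3*za = 0"
    unfolding zabc_defs using zsum by algebra
  have C31: "za^3*zc + zb^3*za + zc^3*zb + 3*(za^2*zb^2 + zb^2*zc^2 + zc^2*za^2) = 49"
    unfolding zabc_defs using zsum by algebra
  have C13: "za^4 + zb^4 + zc^4 + 3*za*zb*zc*(za+zb+zc) = 0"
    unfolding zabc_defs using zsum by algebra
  have C22: "3*(za*zb*zc*(za+zb+zc) + za*zb^3 + zb*zc^3 + zc*za^3) = 0"
    unfolding zabc_defs using zsum by algebra
  have C211: "3*(za^2*zb^2 + zb^2*zc^2 + zc^2*za^2) + 6*za*zb*zc*(za+zb+zc) = 0"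
    unfolding zabc_defs using zsum by algebra
  have "kf (Jm *v v) = (za*x + zb*y + zc*w)^3 * (zb*x + zc*y + za*w)
     + (zb*x + zc*y + za*w)^3 * (zc*x + za*y + zb*w) + (zc*x + za*y + zb*w)^3 * (za*x + zb*y + zc*w)"
    unfolding kf_def Jm_mv vector_3 x_def y_def w_def ..
  also have "\<dots> = (za^3*zb + zb^3*zc + zc^3*za) * (x^4 + y^4 + w^4)
     + (za^3*zc + zb^3*za + zc^3*zb + 3*(za^2*zb^2 + zb^2*zc^2 + zc^2*za^2)) * (x^3*y + y^3*w + w^3*x)
     + (za^4 + zb^4 + zc^4 + 3*za*zb*zc*(za+zb+zc)) * (x^3*w + y^3*x + w^3*y)
     + (3*(za*zb*zc*(za+zb+zc) + za*zb^3 + zb*zc^3 + zc*za^3)) * (x^2*y^2 + y^2*w^2 + w^2*x^2)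
     + (za^3*zb + zb^3*zc + zc^3*za) * (3 * x*y*w*(x+y+w))
     + (3*(za^2*zb^2 + zb^2*zc^2 + zc^2*za^2) + 6*za*zb*zc*(za+zb+zc)) * (x*y*w*(x+y+w))"
    by algebra
  also have "\<dots> = 49 * kf v" unfolding C40 C31 C13 C22 C211 kf_def x_def y_def w_def by simp
  finally show ?thesis .
qed

lemma klein_pair_Jm: "klein_pair Jm Jm'"
proof -
  have "Jm *v (Jm' *v v) = v" "Jm' *v (Jm *v v) = v" for v
    unfolding Jm'_mv vector_scalar_commute Jm_Jm by (simp_all add: vec3_eq_iff)
  moreover have "\<exists>c. c \<noteq> 0 \<and> (\<forall>v. kf (Jm *v v) = c * kf v)"
    by (rule exI[of _ 49]) (simp add: kf_Jm del: Jm_mv mv3)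
  ultimately show ?thesis unfolding klein_pair_def by blast
qed

text \<open>The flexes are the coordinate points and the \<open>Dm\<close>-orbits of \<open>f1\<close>, \<open>f2\<close>, \<open>f3\<close>, at which \<open>q/p\<close> is
  \<open>t1\<close>, \<open>t2\<close>, \<open>t3\<close>.\<close>

definition t1 :: complex where "t1 = -3 + (z + z^6) - 2*(z^2 + z^5)"
definition t2 :: complex where "t2 = -1 + 2*(z + z^6) + 3*(z^2 + z^5)"
definition t3 :: complex where "t3 = -4 - 3*(z + z^6) - (z^2 + z^5)"
definition f1 :: vec3 where "f1 = vector [za, zb, zc]"
definition f2 :: vec3 where "f2 = vector [zb, zc, za]"
definition f3 :: vec3 where "f3 = vector [zc, za, zb]"

lemma f_pq: "qm f1 = t1 * pm f1" "qm f2 = t2 * pm f2" "qm f3 = t3 * pm f3"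
proof -
  note d = pm_def qm_def f1_def f2_def f3_def vector_3 zabc_defs t1_def t2_def t3_def
  show "qm f1 = t1 * pm f1" unfolding d using zsum by algebra
  show "qm f2 = t2 * pm f2" unfolding d using zsum by algebra
  show "qm f3 = t3 * pm f3" unfolding d using zsum by algebra
qed

text \<open>The cubic is the Hessian equation on the line p + q + r = 0 in the coordinate
  \<open>t = q / p\<close>.\<close>

lemma t_cubic: "(t - t1) * (t - t2) * (t - t3) = t^3 + 8*t^2 + 5*t - 1"
proof -
  have 1: "t1 + t2 + t3 = -8" unfolding t1_def t2_def t3_def by (simp add: algebra_simps)
  have 2: "t1*t2 + t2*t3 + t3*t1 = 5" unfolding t1_def t2_def t3_def using zsum by algebra
  have 3: "t1*t2*t3 = 1" unfolding t1_def t2_def t3_def using zsum by algebra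
  show ?thesis using 1 2 3 by algebra
qed

lemma t_distinct: "t1 \<noteq> t2" "t2 \<noteq> t3" "t1 \<noteq> t3"
proof -
  \<comment> \<open>This is the discriminant of the cubic.\<close>
  have "((t1 - t2) * (t2 - t3) * (t3 - t1))^2 = 49^2"
    unfolding t1_def t2_def t3_def using zsum by algebra
  then show "t1 \<noteq> t2" "t2 \<noteq> t3" "t1 \<noteq> t3" by auto
qed

lemma torus_f: "torus f1" "torus f2" "torus f3"
  using zabc_nz by (simp_all add: torus_def f1_def f2_def f3_def)

lemma Jm_e: "Jm *v e1 = f1" "Jm *v e2 = f2" "Jm *v e3 = f3"
  by (simp_all add: vec3_eq_iff e1_def e2_def e3_def f1_def f2_def f3_def axis_def del: mv3)

lemma e_nz: "e1 \<noteq> 0" "e2 \<noteq> 0" "e3 \<noteq> 0"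
  by (simp_all add: e1_def e2_def e3_def axis_def vec3_eq_iff)

lemma kf_e: "kf e1 = 0" "kf e2 = 0" "kf e3 = 0"
  by (simp_all add: e1_def e2_def e3_def axis_def kf_def)

lemma kf_f: "kf f1 = 0" "kf f2 = 0" "kf f3 = 0"
  using kf_Jm[of e1] kf_Jm[of e2] kf_Jm[of e3] unfolding Jm_e kf_e by simp_all

lemma f_pq_ne:
  "pm f1 * qm f2 \<noteq> qm f1 * pm f2" "pm f2 * qm f3 \<noteq> qm f2 * pm f3" "pm f1 * qm f3 \<noteq> qm f1 * pm f3"
  using t_distinct torus_f[THEN torus_nz] unfolding f_pq by auto

text \<open>Multiplied by \<open>(xyz)^2\<close>, the Hessian equation becomes a cubic form in p, q,
  r; after eliminating r its roots in \<open>q / p\<close> are \<open>t1\<close>, \<open>t2\<close>,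
  \<open>t3\<close>, and \<open>torus_ratio\<close> identifies the fibres over them.\<close>

lemma hessian_zeros:
  assumes "kf u = 0" "torus u"
    and hess: "u$1 * u$2^5 + u$2 * u$3^5 + u$3 * u$1^5 = 5 * u$1^2 * u$2^2 * u$3^2"
  obtains c m f where "c \<noteq> 0" "m < 7" "f \<in> {f1, f2, f3}" "u = c *s (Dm m *v f)"
proof -
  define p q where "p = pm u" and "q = qm u"
  have p: "p \<noteq> 0" using torus_nz[OF assms(2)] by (simp add: p_def)
  have r: "rm u = - p - q" using assms(1) unfolding kf_pqr p_def q_def by (simp add: algebra_simps add_eq_0_iff)
  have "qm u^2 * pm u + rm u^2 * qm u + pm u^2 * rm u - 5 * pm u * qm u * rm u
     = (u$1 * u$2 * u$3)^2 * (u$1 * u$2^5 + u$2 * u$3^5 + u$3 * u$1^5 - 5 * u$1^2 * u$2^2 * u$3^2)"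
    unfolding pm_def qm_def rm_def by algebra
  then have "q^2 * p + (- p - q)^2 * q + p^2 * (- p - q) - 5 * p * q * (- p - q) = 0"
    unfolding r p_def[symmetric] q_def[symmetric] hess by simp
  moreover define t where "t = q / p"
  then have q: "q = t * p" using p by simp
  ultimately have "p^3 * (t^3 + 8 * t^2 + 5 * t - 1) = 0" unfolding q by algebra
  then have "(t - t1) * (t - t2) * (t - t3) = 0" unfolding t_cubic using p by simp
  then have "q = t1 * p \<or> q = t2 * p \<or> q = t3 * p" unfolding q by auto
  then have "\<exists>f\<in>{f1, f2, f3}. p * qm f = q * pm f" using f_pq by auto
  then obtain f where f: "f \<in> {f1, f2, f3}" "p * qm f = q * pm f" by blast
  have "torus f" "kf f = 0" using f torus_f kf_f by auto
  from torus_ratio[OF assms(2) this(1) assms(1) this(2) f(2)[unfolded p_def q_def]]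
  show ?thesis using f that by metis
qed

text \<open>The pullback of \<open>kf\<close> by \<open>A\<close> is a quartic vanishing on the
  curve, in particular on the orbits of \<open>f1\<close> and \<open>f2\<close>, hence a multiple of
  \<open>kf\<close>.\<close>

lemma kf_invariant_imp_klein_pair:
  assumes "invertible A" "\<And>v. kf v = 0 \<Longrightarrow> kf (A *v v) = 0"
  obtains B where "klein_pair A B"
proof -
  obtain B where AB: "\<And>v. A *v (B *v v) = v" "\<And>v. B *v (A *v v) = v" using assms(1) by (rule invertibleE) blast
  obtain G where G: "\<And>v. feval 4 G v = kf (A *v v)"
    using is_form_compose[OF is_form_kf, of A] by (rule is_formE) blast
  have G0: "feval 4 G v = 0" if "kf v = 0" for v using that assms(2) G by simp
  obtain a where a: "\<forall>m\<in>monoms 4. G m = a * klein_form m"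
    using quartic_unique[OF torus_f(1) kf_f(1) torus_f(2) kf_f(2) f_pq_ne(1), of G] G0 kf_f kf_Dm by metis
  have "feval 4 G v = a * feval 4 klein_form v" for v
    unfolding feval_def sum_distrib_left by (rule sum.cong) (use a in \<open>auto simp: algebra_simps\<close>)
  then have kfA: "kf (A *v v) = a * kf v" for v using G feval_klein by metis
  have "a \<noteq> 0"
  proof
    assume "a = 0"
    \<comment> \<open>The point (1,1,0) lies off the curve.\<close>
    then have "kf (A *v (B *v vector [1,1,0])) = 0" unfolding kfA by simp
    then show False unfolding AB by (simp add: kf_def)
  qed
  with kfA AB have "klein_pair A B" unfolding klein_pair_def by blast
  then show ?thesis by (rule that)
qed

lemma AutC_eq: "AutC = {pmap A | A. \<exists>B. klein_pair A B}"
proof (intro set_eqI iffI)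
  fix s assume "s \<in> AutC"
  then obtain A where A: "s = pmap A" "invertible A" "pmap A ` kleinC = kleinC" unfolding AutC_def by auto
  have "kf (A *v v) = 0" if "kf v = 0" for v
  proof (cases "v = 0")
    case True then show ?thesis by (simp add: kf_def)
  next
    case False
    then have "pmap A (pclass v) \<in> kleinC" using A(3) that by (metis imageI pclass_in_kleinC)
    then show ?thesis using False by (simp add: pmap_pclass del: mv3)
  qed
  then show "s \<in> {pmap A | A. \<exists>B. klein_pair A B}"
    using kf_invariant_imp_klein_pair[OF A(2)] A(1) by blast
next
  fix s assume "s \<in> {pmap A | A. \<exists>B. klein_pair A B}"
  then obtain A B where AB: "s = pmap A" "klein_pair A B" by auto
  have sub: "pmap A ` kleinC \<subseteq> kleinC" if "klein_pair A B" for A B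
    using klein_pair_nz[OF that] klein_pair_kf[OF that] by (auto elim!: kleinC_cases simp: pmap_pclass simp del: mv3)
  have "X \<in> pmap A ` kleinC" if X: "X \<in> kleinC" for X
  proof -
    obtain v where v: "X = pclass v" "v \<noteq> 0" "kf v = 0" by (rule kleinC_cases[OF X])
    have "B *v v \<noteq> 0" using klein_pair_nz[OF klein_pair_sym[OF AB(2)]] v by blast
    then have "X = pmap A (pmap B X)" using v by (simp add: pmap_pclass klein_pairD[OF AB(2)] del: mv3)
    then show ?thesis using sub[OF klein_pair_sym[OF AB(2)]] X by blast
  qed
  with sub[OF AB(2)] have "pmap A ` kleinC = kleinC" by blast
  moreover have "invertible A" unfolding invertible_def
    using klein_pairD[OF AB(2)] by (intro exI[of _ B]) (auto intro!: matrix_eq_mv simp: matrix_vector_mul_assoc[symmetric] matrix_vector_mul_lid simp del: mv3)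
  ultimately show "s \<in> AutC" unfolding AutC_def AB(1) by blast
qed

text \<open>Comparing coefficients of \<open>kf (B *v v)\<close> and \<open>c * kf v\<close> makes
  \<open>B\<close> diagonal, with entries satisfying \<open>b^3 b22 = b22^3 b33 = b33^3 b\<close>;
  as in \<open>torus_ratio\<close>, these are a multiple of the diagonal of some
  \<open>Dm n\<close>.\<close>

lemma klein_pair_fix_e1:
  assumes "klein_pair B B'" "B *v e1 = k *s e1"
  obtains c n where "c \<noteq> 0" "n < 7" "\<And>v. B *v v = c *s (Dm n *v v)"
proof -
  obtain c where c: "c \<noteq> 0" "\<And>v. kf (B *v v) = c * kf v" using assms(1) unfolding klein_pair_def by auto
  define b where "b = B$1$1"
  define b12 b22 b32 where "b12 = B$1$2" and "b22 = B$2$2" and "b32 = B$3$2"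
  define b13 b23 b33 where "b13 = B$1$3" and "b23 = B$2$3" and "b33 = B$3$3"
  have B0: "B$2$1 = 0" "B$3$1 = 0" using assms(2) by (simp_all add: vec3_eq_iff e1_def axis_def)
  have "B *v e1 \<noteq> 0" using klein_pair_nz[OF assms(1)] e_nz(1) by blast
  then have b: "b \<noteq> 0" using B0 by (auto simp: vec3_eq_iff e1_def axis_def b_def)
  have kB: "kf (B *v vector [x, y, w]) = (b*x + b12*y + b13*w)^3 * (b22*y + b23*w)
      + (b22*y + b23*w)^3 * (b32*y + b33*w) + (b32*y + b33*w)^3 * (b*x + b12*y + b13*w)" for x y w
    unfolding kf_def by (simp add: B0 b_def b12_def b22_def b32_def b13_def b23_def b33_def)
  have kv: "kf (vector [x, y, w]) = x^3*y + y^3*w + w^3*x" for x y w by (simp add: kf_def)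
  have eq: "(b*x + b12*y + b13*w)^3 * (b22*y + b23*w) + (b22*y + b23*w)^3 * (b32*y + b33*w)
      + (b32*y + b33*w)^3 * (b*x + b12*y + b13*w) = c * (x^3*y + y^3*w + w^3*x)" for x y w
    using c(2)[of "vector [x,y,w]"] unfolding kB kv .
  \<comment> \<open>Restriction to the vectors (1,0,t); the next restriction is to (0,1,t).\<close>
  have "0 + (b^3*b23) * t + (3*b^2*b13*b23) * t^2 + (3*b*b13^2*b23 + b33^3*b - c) * t^3
      + (b13^3*b23 + b23^3*b33 + b33^3*b13) * t^4 = 0" for t
    using eq[of 1 0 t, simplified] by algebra
  from quartic_zero_fun[OF this] b have 1: "b23 = 0" "b33^3*b = c" "b33^3*b13 = 0" by auto
  then have b33: "b33 \<noteq> 0" "b13 = 0" using c(1) by auto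
  have "(b12^3*b22 + b22^3*b32 + b32^3*b12) + (b22^3*b33 + 3*b32^2*b33*b12 - c) * t
      + (3*b32*b33^2*b12) * t^2 + (b33^3*b12) * t^3 + 0 * t^4 = 0" for t
    using eq[of 0 1 t, simplified] unfolding 1(1) b33(2) by algebra
  from quartic_zero_fun[OF this] b33(1) have 2: "b12 = 0" "b22^3*b33 = c" "b22^3*b32 = 0" by auto
  then have b22: "b22 \<noteq> 0" "b32 = 0" using c(1) by auto
  have 3: "b^3*b22 = c" using eq[of 1 1 0] by (simp add: 1 2 b33 b22)
  show ?thesis
  proof -
    define y w where "y = b22 / b33" and "w = b / b33"
    have bw: "b = w * b33" "b22 = y * b33" using b33(1) by (simp_all add: y_def w_def)
    have "b33^3 * b = b22^3 * b33" using 1 2 by simp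
    then have "(w - y^3) * b33^4 = 0" unfolding bw by algebra
    then have w: "w = y^3" using b33 by simp
    have "b^3 * b22 = b22^3 * b33" using 2 3 by simp
    then have "y^3 * (y^7 - 1) * b33^4 = 0" unfolding bw w by algebra
    moreover have y: "y \<noteq> 0" using b22 bw by auto
    ultimately have "y^7 = 1" using b33 by simp
    then obtain n where n: "n < 7" "y = z ^ n" by (rule seventh_root)
    have zn: "z ^ (4 * n) = y^4" "z ^ (2 * n) = y^2" by (simp_all add: n power_mult[symmetric] mult.commute)
    have "B *v v = (b33 / y) *s (Dm n *v v)" for v
      unfolding vec3_eq_iff Dm_mv vector_smult_component vector_3 zn n(2)[symmetric] mv3 B0
        b_def[symmetric] b12_def[symmetric] b22_def[symmetric] b32_def[symmetric] b13_def[symmetric]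
        b23_def[symmetric] b33_def[symmetric] 1(1) 2(1) b33(2) b22(2) bw w
      using y by (simp add: field_simps eval_nat_numeral)
    then show ?thesis using n y b33 by (intro that[of "b33 / y" n]) auto
  qed
qed

text \<open>\<open>gm 0, \<dots>, gm 7\<close> (with \<open>gm 7\<close> the identity) represent the cosets of the stabiliser of the coordinate
  triangle, which has the \<open>3 * 7\<close> elements \<open>cm j ** Dm n\<close>.\<close>

definition gm :: "nat \<Rightarrow> complex^3^3" where
  "gm k = (if k < 7 then Dm k ** Jm else mat 1)"

definition gm' :: "nat \<Rightarrow> complex^3^3" where
  "gm' k = (if k < 7 then Jm' ** Dm (6 * k) else mat 1)"

definition cm :: "nat \<Rightarrow> complex^3^3" where
  "cm j = (if j = 0 then mat 1 else if j = 1 then cycm else cycm')"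

definition cm' :: "nat \<Rightarrow> complex^3^3" where
  "cm' j = (if j = 0 then mat 1 else if j = 1 then cycm' else cycm)"

lemma klein_pair_gm: "klein_pair (gm k) (gm' k)"
  unfolding gm_def gm'_def using klein_pair_comp[OF klein_pair_Dm klein_pair_Jm] klein_pair_id by auto

lemma klein_pair_cm: "klein_pair (cm j) (cm' j)"
  unfolding cm_def cm'_def using klein_pair_cycm klein_pair_sym[OF klein_pair_cycm] klein_pair_id by auto

lemma cm_e1: "cm 0 *v e1 = e1" "cm 1 *v e1 = e2" "cm 2 *v e1 = e3"
  by (simp_all add: cm_def vec3_eq_iff e1_def e2_def e3_def axis_def matrix_vector_mul_lid del: mv3)

text \<open>A normal form for automorphisms: the ranges \<open>k < 8\<close>, \<open>j < 3\<close>,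
  \<open>n < 7\<close> give the 168 elements. The first two factors carry \<open>e1\<close> to any
  of the 24 flexes, the last one fixes it.\<close>

definition am :: "nat \<Rightarrow> nat \<Rightarrow> nat \<Rightarrow> complex^3^3" where
  "am k j n = gm k ** (cm j ** Dm n)"

lemma am_mv: "am k j n *v v = gm k *v (cm j *v (Dm n *v v))"
  by (simp add: am_def matrix_vector_mul_assoc[symmetric] del: mv3 Dm_mv)

lemma klein_pair_am: "\<exists>B. klein_pair (am k j n) B"
  unfolding am_def using klein_pair_comp[OF klein_pair_gm klein_pair_comp[OF klein_pair_cm klein_pair_Dm]] by blast

text \<open>The image of \<open>e1\<close> is again a flex, hence
  \<open>gm k *v (cm j *v e1)\<close> up to scale. Undoing \<open>gm k\<close> and
  \<open>cm j\<close> leaves an automorphism fixing \<open>e1\<close>, which is some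
  \<open>Dm n\<close> up to scale.\<close>

lemma klein_pair_classification:
  assumes "klein_pair A A'"
  obtains k j n where "k < 8" "j < 3" "n < 7" "pmap A = pmap (am k j n)"
proof -
  obtain c where c: "c \<noteq> 0" "\<And>v. kf (A *v v) = c * kf v" using assms unfolding klein_pair_def by auto
  define u where "u = A *v e1"
  define w where "w = A *v e3"
  have u0: "u \<noteq> 0" using klein_pair_nz[OF assms] e_nz(1) by (simp add: u_def del: mv3)
  have ku: "kf u = 0" unfolding u_def c(2) kf_e by simp
  have "crs u w \<noteq> 0"
  proof
    assume "crs u w = 0"
    moreover have "w \<noteq> 0" using klein_pair_nz[OF assms] e_nz(3) by (simp add: w_def del: mv3)
    ultimately obtain a where "u = a *s w" by (rule crs_eq_0D)
    then have "A' *v u = a *s (A' *v w)" by (simp add: vector_scalar_commute del: mv3)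
    then have "e1 = a *s e3" unfolding u_def w_def klein_pairD[OF assms] .
    then show False by (simp add: vec3_eq_iff e1_def e3_def axis_def)
  qed
  moreover have "kf (u + t *s w) = c * t^3" for t
  proof -
    have "u + t *s w = A *v (e1 + t *s e3)"
      by (simp add: u_def w_def matrix_vector_right_distrib vector_scalar_commute del: mv3)
    then show ?thesis using c(2)[of "e1 + t *s e3"] by (simp add: kf_def e1_def e3_def axis_def del: mv3)
  qed
  ultimately have hess: "u$1 * u$2^5 + u$2 * u$3^5 + u$3 * u$1^5 = 5 * u$1^2 * u$2^2 * u$3^2"
    by (rule flex_hessian)
  have "\<exists>k e a. k < 8 \<and> e \<in> {e1, e2, e3} \<and> u = a *s (gm k *v e)"
  proof (cases "torus u")
    case True
    obtain a m f where "m < 7" "f \<in> {f1, f2, f3}" "u = a *s (Dm m *v f)"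
      using hessian_zeros[OF ku True hess] by metis
    moreover from this(2) obtain e where "e \<in> {e1, e2, e3}" "f = Jm *v e" using Jm_e
      by (metis empty_iff insert_iff)
    moreover have "gm m *v e = Dm m *v (Jm *v e)"
      using \<open>m < 7\<close> by (simp add: gm_def matrix_vector_mul_assoc[symmetric] del: mv3 Dm_mv Jm_mv)
    ultimately show ?thesis by (intro exI[of _ m] exI[of _ e] exI[of _ a]) simp
  next
    case False
    then obtain e a where "e \<in> {e1, e2, e3}" "u = a *s e"
      using kf_not_torus[OF ku u0] pclass_eq_iff by auto
    then show ?thesis by (intro exI[of _ 7] exI[of _ e] exI[of _ a]) (simp add: gm_def matrix_vector_mul_lid del: mv3)
  qed
  then obtain k e a where k: "k < 8" "e \<in> {e1, e2, e3}" "u = a *s (gm k *v e)" by blast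
  obtain j where j: "j < 3" "e = cm j *v e1" using k(2) cm_e1
    by (metis empty_iff insert_iff numeral_less_iff one_less_numeral_iff semiring_norm(77,80) zero_less_numeral lessI numeral_3_eq_3 numeral_2_eq_2)
  define C where "C = cm' j ** (gm' k ** A)"
  have C: "C *v v = cm' j *v (gm' k *v (A *v v))" for v
    by (simp add: C_def matrix_vector_mul_assoc[symmetric] del: mv3)
  have "klein_pair C ((A' ** gm k) ** cm j)" unfolding C_def
    by (intro klein_pair_comp assms klein_pair_sym[OF klein_pair_gm] klein_pair_sym[OF klein_pair_cm])
  moreover have "C *v e1 = a *s e1"
    unfolding C u_def[symmetric] k(3) j(2) vector_scalar_commute klein_pairD[OF klein_pair_gm] klein_pairD[OF klein_pair_cm] ..
  ultimately obtain d n where d: "d \<noteq> 0" "n < 7" "\<And>v. C *v v = d *s (Dm n *v v)" by (rule klein_pair_fix_e1) blast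
  have Av: "A *v v = d *s (am k j n *v v)" for v
  proof -
    have "A *v v = gm k *v (cm j *v (C *v v))"
      unfolding C klein_pairD[OF klein_pair_gm] klein_pairD[OF klein_pair_cm] ..
    then show ?thesis unfolding d(3) am_mv vector_scalar_commute .
  qed
  have "pmap A = pmap (am k j n)"
  proof
    fix X show "pmap A X = pmap (am k j n) X"
    proof (cases "X \<in> P2")
      case True
      then obtain v where v: "X = pclass v" "v \<noteq> 0" unfolding P2_def by auto
      then show ?thesis unfolding v(1) pmap_pclass[OF v(2)] Av using d(1) by simp
    qed (simp add: pmap_def)
  qed
  then show ?thesis using k j d by (intro that)
qed

end

lemma torus_smult [simp]: "c \<noteq> 0 \<Longrightarrow> torus (c *s v) \<longleftrightarrow> torus v"
  by (simp add: torus_def)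

lemma torus_cyc [simp]: "torus (cycm *v v) \<longleftrightarrow> torus v" "torus (cycm' *v v) \<longleftrightarrow> torus v"
  by (auto simp: torus_def simp del: mv3)

lemma not_torus_e [simp]: "\<not> torus e1" "\<not> torus e2" "\<not> torus e3"
  by (simp_all add: torus_def e1_def e2_def e3_def axis_def)

lemma pclass_coordinate_point_iff:
  assumes "v \<noteq> 0" "kf v = 0"
  shows "pclass v \<in> {pclass e1, pclass e2, pclass e3} \<longleftrightarrow> \<not> torus v"
  using kf_not_torus[OF assms(2,1)] by (auto simp: pclass_eq_iff)

context klein_root
begin

lemma Dm_smult_eqD:
  assumes "torus v" "Dm m *v v = c *s (Dm n *v v)"
  shows "m mod 7 = n mod 7"
proof -
  have e: "z ^ (2 * m) = c * z ^ (2 * n)" "z ^ m = c * z ^ n"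
    using assms by (auto simp: vec3_eq_iff torus_def simp del: mv3)
  have "z ^ m * (z ^ m * z ^ n) = z ^ (2 * m) * z ^ n" by (simp add: mult_2 power_add)
  also have "\<dots> = z ^ (2 * n) * z ^ m" using e by simp
  also have "\<dots> = z ^ n * (z ^ m * z ^ n)" by (simp add: mult_2 power_add)
  finally have "z ^ m = z ^ n" by simp
  then show ?thesis by (simp add: z_pow_inj)
qed

lemma torus_cm [simp]: "torus (cm j *v v) \<longleftrightarrow> torus v"
  by (simp add: cm_def matrix_vector_mul_lid del: mv3 cycm_mv)

lemma gm_torus: "k < 7 \<Longrightarrow> j < 3 \<Longrightarrow> torus (gm k *v (cm j *v e1))"
proof -
  assume k: "k < 7" and "j < 3"
  then have "j = 0 \<or> j = 1 \<or> j = 2" by auto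
  then have "torus (Jm *v (cm j *v e1))"
    by (elim disjE) (simp_all only: cm_e1 Jm_e torus_f)
  then show ?thesis using k by (simp add: gm_def matrix_vector_mul_assoc[symmetric] del: mv3 Dm_mv Jm_mv)
qed

text \<open>The 24 flexes are distinct: \<open>k = 7\<close> gives the coordinate points, which lie
  off the torus; the others are separated by p : q and, within one orbit, by the exponent of
  \<open>Dm\<close>.\<close>

lemma gm_cm_e1_inj:
  assumes "k < 8" "k' < 8" "j < 3" "j' < 3" "gm k *v (cm j *v e1) = c *s (gm k' *v (cm j' *v e1))"
  shows "k = k' \<and> j = j'"
proof -
  have c: "c \<noteq> 0"
  proof
    assume "c = 0"
    then have "gm k *v (cm j *v e1) = 0" using assms by (simp add: vec3_eq_iff del: mv3)
    then show False using klein_pair_nz[OF klein_pair_gm] klein_pair_nz[OF klein_pair_cm] e_nz by blast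
  qed
  have g7: "gm 7 *v v = v" for v by (simp add: gm_def matrix_vector_mul_lid del: mv3)
  have nt: "\<not> torus (gm 7 *v (cm i *v e1))" for i unfolding g7 by (simp del: mv3)
  have j: "j = 0 \<or> j = 1 \<or> j = 2" "j' = 0 \<or> j' = 1 \<or> j' = 2" using assms by auto
  consider "k = 7" "k' = 7" | "k = 7" "k' < 7" | "k < 7" "k' = 7" | "k < 7" "k' < 7" using assms by linarith
  then show ?thesis
  proof cases
    case 1
    then show ?thesis using j assms(5) c unfolding 1 g7
      by (elim disjE) (simp_all only: cm_e1, simp_all add: vec3_eq_iff e1_def e2_def e3_def axis_def)
  next
    case 2 then show ?thesis using assms(5) c gm_torus[of k' j'] nt[of j] assms(4) by simp
  next
    case 3 then show ?thesis using assms(5) c gm_torus[of k j] nt[of j'] assms(3) by (metis torus_smult)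
  next
    case 4
    have g: "gm i *v v = Dm i *v (Jm *v v)" if "i < 7" for i v
      using that by (simp add: gm_def matrix_vector_mul_assoc[symmetric] del: mv3 Dm_mv Jm_mv)
    define h where "h = (\<lambda>i. Jm *v (cm i *v e1))"
    have eq: "Dm k *v h j = c *s (Dm k' *v h j')" using assms(5) unfolding g[OF 4(1)] g[OF 4(2)] h_def .
    have h: "h 0 = f1" "h 1 = f2" "h 2 = f3" unfolding h_def by (simp_all only: cm_e1 Jm_e)
    have sm: "pm (c *s v) = c^4 * pm v" "qm (c *s v) = c^4 * qm v" for v
      by (simp_all add: pm_def qm_def power_mult_distrib eval_nat_numeral)
    have "pm (h j) = c^4 * pm (h j')" "qm (h j) = c^4 * qm (h j')"
      using arg_cong[OF eq, of pm] arg_cong[OF eq, of qm] unfolding sm by (simp_all del: Dm_mv mv3)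
    then have "pm (h j) * qm (h j') = qm (h j) * pm (h j')" by simp
    then have jj: "j = j'" using j f_pq_ne
      by (elim disjE) (simp_all only: h, simp_all add: mult.commute)
    have "torus (h j)" using j h torus_f by auto
    then have "k mod 7 = k' mod 7" using Dm_smult_eqD eq unfolding jj by blast
    then show ?thesis using jj 4 by simp
  qed
qed

text \<open>The indices are recovered from the automorphism: \<open>k\<close> and \<open>j\<close>
  from the image of \<open>e1\<close>, then \<open>n\<close> from the image of
  \<open>f1\<close>.\<close>

lemma card_AutC: "card AutC = 168"
proof -
  define I where "I = {..<8::nat} \<times> {..<3::nat} \<times> {..<7::nat}"
  define h where "h = (\<lambda>(k,j,n). pmap (am k j n))"
  have "AutC = h ` I"
  proof (intro set_eqI iffI)
    fix s assume "s \<in> AutC"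
    then obtain A B where "s = pmap A" "klein_pair A B" unfolding AutC_eq by auto
    then obtain k j n where "k < 8" "j < 3" "n < 7" "s = pmap (am k j n)"
      using klein_pair_classification by metis
    then show "s \<in> h ` I" unfolding h_def I_def by force
  next
    fix s assume "s \<in> h ` I"
    then show "s \<in> AutC" unfolding AutC_eq h_def using klein_pair_am by auto
  qed
  moreover have "inj_on h I"
  proof (rule inj_onI)
    fix a b assume ab: "a \<in> I" "b \<in> I" "h a = h b"
    obtain k j n where a: "a = (k,j,n)" by (cases a)
    obtain k' j' n' where b: "b = (k',j',n')" by (cases b)
    have lt: "k < 8" "j < 3" "n < 7" "k' < 8" "j' < 3" "n' < 7" using ab unfolding I_def a b by auto
    have pr: "\<exists>c. am k j n *v v = c *s (am k' j' n' *v v)" if "v \<noteq> 0" for v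
    proof -
      have "pmap (am k j n) (pclass v) = pmap (am k' j' n') (pclass v)" using ab(3) unfolding h_def a b by simp
      then show ?thesis unfolding pmap_pclass[OF that] pclass_eq_iff by blast
    qed
    have De1: "Dm i *v e1 = z ^ (4 * i) *s e1" for i
      by (simp add: vec3_eq_iff e1_def axis_def del: mv3)
    obtain c where "am k j n *v e1 = c *s (am k' j' n' *v e1)" using pr[OF e_nz(1)] by blast
    then have "z ^ (4 * n) *s (gm k *v (cm j *v e1)) = (c * z ^ (4 * n')) *s (gm k' *v (cm j' *v e1))"
      unfolding am_mv De1 vector_scalar_commute vector_smult_assoc .
    then have "gm k *v (cm j *v e1) = (c * z ^ (4 * n') / z ^ (4 * n)) *s (gm k' *v (cm j' *v e1))"
      by (simp add: vec_eq_iff field_simps del: mv3)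
    then have kj: "k = k'" "j = j'" using gm_cm_e1_inj lt by blast+
    obtain d where "am k j n *v f1 = d *s (am k' j' n' *v f1)" using pr torus_nz[OF torus_f(1)] by blast
    then have "cm' j *v (gm' k *v (am k j n *v f1)) = d *s (cm' j *v (gm' k *v (am k j n' *v f1)))"
      unfolding kj by (simp add: vector_scalar_commute del: mv3)
    then have "Dm n *v f1 = d *s (Dm n' *v f1)"
      unfolding am_mv klein_pairD[OF klein_pair_gm] klein_pairD[OF klein_pair_cm] .
    then have "n mod 7 = n' mod 7" using Dm_smult_eqD torus_f(1) by blast
    then show "a = b" using kj lt unfolding a b by simp
  qed
  ultimately have "card AutC = card I" by (metis card_image)
  then show ?thesis by (simp add: I_def)
qed

end

section \<open>Divisors of coordinates, contact cubics and a quintic\<close>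

text \<open>The tangent at \<open>e1\<close> is \<open>y = 0\<close>, so z is a local coordinate
  there; the equation \<open>y (x^3 + y^2 z) = - z^3 x\<close> then gives order three for y.\<close>

lemma ord_coords_e1:
  "ord_at (\<lambda>v. v$1) (pclass e1) 0" "ord_at (\<lambda>v. v$2) (pclass e1) 3" "ord_at (\<lambda>v. v$3) (pclass e1) 1"
proof -
  show x: "ord_at (\<lambda>v. v$1) (pclass e1) 0"
    by (rule ord_at_unit[OF is_form_coord]) (simp add: e1_def axis_def)
  show w: "ord_at (\<lambda>v. v$3) (pclass e1) 1"
  proof (rule ord_at_simple[OF is_form_coord])
    show "e1 $ 3 = 0" by (simp add: e1_def axis_def)
    fix \<gamma> r assume lp: "local_param \<gamma> r (pclass e1)"
    obtain c where c: "c \<noteq> 0" "\<gamma> 0 = c *s e1" using local_param_at[OF lp] .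
    have g: "\<gamma> 0 $ 1 = c" "\<gamma> 0 $ 2 = 0" "\<gamma> 0 $ 3 = 0" unfolding c(2) by (simp_all add: e1_def axis_def)
    obtain x y w where d: "((\<lambda>t. \<gamma> t $ 3) has_field_derivative w) (at 0)" "c^3 * y = 0"
      "\<And>k. \<not> (x = k * c \<and> y = 0 \<and> w = 0)"
      by (rule local_param_deriv[OF lp, unfolded g]) (simp, blast)
    have "w \<noteq> 0" using d(2) d(3)[of "x / c"] c(1) by auto
    then show "\<exists>D. D \<noteq> 0 \<and> ((\<lambda>t. \<gamma> t $ 3) has_field_derivative D) (at 0)" using d(1) by blast
  qed
  have fU: "is_form 3 (\<lambda>v. v$1^3 + v$2^2 * v$3)"
  proof -
    have "is_form 3 (\<lambda>v. 1 * v$1^3 * v$2^0 * v$3^0 + 1 * v$1^0 * v$2^2 * v$3^1)"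
      by (intro is_form_add is_form_monom) simp_all
    then show ?thesis by simp
  qed
  have U: "ord_at (\<lambda>v. v$1^3 + v$2^2 * v$3) (pclass e1) 0"
    by (rule ord_at_unit[OF fU]) (simp add: e1_def axis_def)
  have o: "ord_at (\<lambda>v. (-1) * (v$3^3 * v$1)) (pclass e1) (3 * 1 + 0)"
    by (intro ord_at_cmult ord_at_mult ord_at_power x w) simp
  have "ord_at (\<lambda>v. v$2 * (v$1^3 + v$2^2 * v$3)) (pclass e1) (3 * 1 + 0)"
  proof (rule ord_at_cong[OF _ o])
    fix v assume "kf v = 0"
    then show "(-1) * (v$3^3 * v$1) = v$2 * (v$1^3 + v$2^2 * v$3)" unfolding kf_def by algebra
  qed
  then have "ord_at (\<lambda>v. v$2 * (v$1^3 + v$2^2 * v$3)) (pclass e1) (3 + 0)" by simp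
  from ord_at_cancel[OF is_form_coord this U] show "ord_at (\<lambda>v. v$2) (pclass e1) 3" .
qed

lemma cycm_e: "cycm' *v e2 = e1" "cycm *v e3 = e1"
  by (simp_all add: vec3_eq_iff e1_def e2_def e3_def axis_def del: mv3)

lemma ord_at_e2_e3:
  assumes "ord_at f (pclass e1) n"
  shows "ord_at (\<lambda>u. f (vector [u$2, u$3, u$1])) (pclass e2) n"
    and "ord_at (\<lambda>u. f (vector [u$3, u$1, u$2])) (pclass e3) n"
  using ord_at_transport[OF klein_pair_cycm, of f e2 n]
    ord_at_transport[OF klein_pair_sym[OF klein_pair_cycm], of f e3 n] assms cycm_e by (simp_all del: mv3)

lemmas ord_coords_e2 = ord_coords_e1[THEN ord_at_e2_e3(1), unfolded vector_3]
lemmas ord_coords_e3 = ord_coords_e1[THEN ord_at_e2_e3(2), unfolded vector_3]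

definition xyz :: "vec3 \<Rightarrow> complex" where "xyz v = v$1 * v$2 * v$3"

lemma is_form_xyz: "is_form 3 xyz"
proof -
  have "is_form 3 (\<lambda>v. 1 * v$1^1 * v$2^1 * v$3^1)" by (intro is_form_monom) simp
  then show ?thesis by (simp add: xyz_def[abs_def])
qed

text \<open>The triangle cuts out four times the sum of the coordinate points, so it is the contact
  cubic for automorphisms preserving these points.\<close>

lemma ord_xyz:
  assumes "v \<noteq> 0" "kf v = 0"
  shows "ord_at xyz (pclass v) (if torus v then 0 else 4)"
proof (cases "torus v")
  case True
  then show ?thesis using ord_at_unit[OF is_form_xyz, of v] by (simp add: xyz_def torus_def)
next
  case False
  have "ord_at xyz (pclass e1) (0 + 3 + 1)" "ord_at xyz (pclass e2) (1 + 0 + 3)" "ord_at xyz (pclass e3) (3 + 1 + 0)"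
    unfolding xyz_def by (intro ord_at_mult ord_coords_e1 ord_coords_e2 ord_coords_e3)+
  then show ?thesis using False kf_not_torus[OF assms(2,1)] by auto
qed

context klein_root
begin

text \<open>The explicit parametrisation needs nonzero coordinates; \<open>Jm\<close> moves the
  coordinate points to such points, and the parametrisation is carried back.\<close>

lemma ex_local_param:
  assumes "v \<noteq> 0" "kf v = 0"
  shows "\<exists>\<gamma> r. local_param \<gamma> r (pclass v)"
proof (cases "torus v")
  case True
  then show ?thesis using ex_local_param_torus assms(2) unfolding torus_def by blast
next
  case False
  have *: "\<exists>\<gamma> r. local_param \<gamma> r (pclass e)" if e: "torus (Jm *v e)" "kf (Jm *v e) = 0" for e
  proof -
    obtain \<gamma> r where "local_param \<gamma> r (pclass (Jm *v e))"
      using ex_local_param_torus[OF _ _ _ e(2)] e(1) unfolding torus_def by blast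
    from local_param_transport[OF klein_pair_Jm this] show ?thesis
      unfolding klein_pairD[OF klein_pair_Jm] by blast
  qed
  have "\<exists>\<gamma> r. local_param \<gamma> r (pclass e1)" "\<exists>\<gamma> r. local_param \<gamma> r (pclass e2)"
    "\<exists>\<gamma> r. local_param \<gamma> r (pclass e3)"
    by (rule *; simp only: Jm_e torus_f kf_f)+
  then show ?thesis
    using kf_not_torus[OF assms(2,1) False] by (metis empty_iff insert_iff)
qed

definition K0 :: "vec3 \<Rightarrow> complex" where
  "K0 v = v$1^2 * v$2 + v$2^2 * v$3 + v$3^2 * v$1 + v$1 * v$2 * v$3"

lemma is_form_K0: "is_form 3 K0"
proof -
  have "is_form 3 (\<lambda>v. 1 * v$1^2 * v$2^1 * v$3^0 + 1 * v$1^0 * v$2^2 * v$3^1 + 1 * v$1^1 * v$2^0 * v$3^2 + 1 * v$1^1 * v$2^1 * v$3^1)"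
    by (intro is_form_add is_form_monom) simp_all
  then show ?thesis by (simp add: K0_def[abs_def] mult.commute)
qed

text \<open>Modulo the quartic, the square of \<open>K0\<close> is the product of the equations of the coordinate triangle
  and of its image under \<open>Jm\<close>, each of which cuts out twice an even divisor.\<close>

lemma K0_square:
  "zs * K0 v ^ 2 = zs * kf v * (v$1 * v$2 + v$2 * v$3 + v$3 * v$1) - xyz v * xyz (Jm *v v)"
proof -
  define x y w where "x = v$1" and "y = v$2" and "w = v$3"
  have 1: "za*zb*zc = zs" and 2: "za^2*zb + zb^2*zc + zc^2*za = -zs" by (rule zabc_rels)+
  have 3: "za*zb^2 + zb*zc^2 + zc*za^2 = -2 * zs"
    using 1 2 zabc_rels(2) unfolding zs_def by algebra
  have 4: "za^3 + zb^3 + zc^3 + 3*za*zb*zc = -zs"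
  proof -
    have "za^3 + zb^3 + zc^3 + 3*za*zb*zc = zs^3 - 3 * (za*zb + zb*zc + zc*za) * zs + 6 * (za*zb*zc)"
      unfolding zs_def by algebra
    also have "\<dots> = zs^2 * zs + 6 * zs" unfolding 1 zabc_rels(2) by (simp add: power2_eq_square power3_eq_cube)
    finally show ?thesis unfolding zabc_rels(1) by simp
  qed
  have "xyz (Jm *v v) = (za*x + zb*y + zc*w) * (zb*x + zc*y + za*w) * (zc*x + za*y + zb*w)"
    unfolding xyz_def Jm_mv vector_3 x_def y_def w_def ..
  also have "\<dots> = (za*zb*zc) * (x^3 + y^3 + w^3) + (za^2*zb + zb^2*zc + zc^2*za) * (x^2*y + y^2*w + w^2*x)
      + (za*zb^2 + zb*zc^2 + zc*za^2) * (x^2*w + y^2*x + w^2*y) + (za^3 + zb^3 + zc^3 + 3*za*zb*zc) * (x*y*w)"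
    by algebra
  also have "\<dots> = zs * ((x^3 + y^3 + w^3) - (x^2*y + y^2*w + w^2*x) - 2 * (x^2*w + y^2*x + w^2*y) - x*y*w)"
    unfolding 1 2 3 4 by (simp add: algebra_simps)
  finally have J: "xyz (Jm *v v) = \<dots>" .
  show ?thesis unfolding J unfolding K0_def kf_def xyz_def x_def y_def w_def by algebra
qed

lemma ord_K0:
  assumes "v \<noteq> 0" "kf v = 0"
  shows "ord_at K0 (pclass v) ((if torus v then 0 else 2) + (if torus (Jm *v v) then 0 else 2))"
proof (rule ord_at_sqrt[OF is_form_K0])
  have J: "Jm *v v \<noteq> 0" "kf (Jm *v v) = 0"
    using klein_pair_nz[OF klein_pair_Jm] klein_pair_kf[OF klein_pair_Jm] assms by auto
  have "ord_at (\<lambda>u. xyz (Jm *v u)) (pclass v) (if torus (Jm *v v) then 0 else 4)"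
    using ord_at_transport[OF klein_pair_sym[OF klein_pair_Jm] ord_xyz[OF J]] .
  then have "ord_at (\<lambda>u. (-1 / zs) * (xyz u * xyz (Jm *v u))) (pclass v)
      ((if torus v then 0 else 4) + (if torus (Jm *v v) then 0 else 4))"
    using zs_nz by (intro ord_at_cmult ord_at_mult ord_xyz assms) auto
  moreover have "(-1 / zs) * (xyz u * xyz (Jm *v u)) = K0 u ^ 2" if "kf u = 0" for u
    using K0_square[of u] that zs_nz by (simp add: field_simps del: Jm_mv)
  ultimately have "ord_at (\<lambda>u. K0 u ^ 2) (pclass v) ((if torus v then 0 else 4) + (if torus (Jm *v v) then 0 else 4))"
    by (rule ord_at_cong[rotated])
  moreover have "(if torus v then 0 else 4) + (if torus (Jm *v v) then 0 else 4)
     = 2 * ((if torus v then 0 else 2) + (if torus (Jm *v v) then 0 else 2 :: nat))" by simp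
  ultimately show "ord_at (\<lambda>u. K0 u ^ 2) (pclass v) (2 * ((if torus v then 0 else 2) + (if torus (Jm *v v) then 0 else 2)))"
    by (simp only:)
qed

text \<open>Whether \<open>B\<close> sends a point to a coordinate point depends only on
  \<open>k\<close>, since \<open>cm j\<close> and \<open>Dm n\<close> permute the coordinate points.
  For \<open>k < 7\<close> the cubic \<open>K0\<close> is moved by the inverse of
  \<open>Dm k\<close>.\<close>

lemma ex_contact_cubic:
  assumes AB: "klein_pair A B"
  shows "\<exists>K. is_form 3 K \<and> (\<forall>v. v \<noteq> 0 \<longrightarrow> kf v = 0 \<longrightarrow>
     ord_at K (pclass v) ((if torus v then 0 else 2) + (if torus (B *v v) then 0 else 2)))"
proof -
  obtain k j n where k: "k < 8" "pmap A = pmap (am k j n)"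
    using klein_pair_classification[OF AB] by metis
  have tB: "torus (B *v v) \<longleftrightarrow> torus (gm' k *v v)" if v: "v \<noteq> 0" for v
  proof -
    define u where "u = B *v v"
    have u: "u \<noteq> 0" "v = A *v u"
      using v klein_pair_nz[OF klein_pair_sym[OF AB]] klein_pairD[OF AB] by (auto simp: u_def simp del: mv3)
    have "pmap A (pclass u) = pmap (am k j n) (pclass u)" using k by simp
    then obtain d where d: "d \<noteq> 0" "v = d *s (am k j n *v u)"
      unfolding pmap_pclass[OF u(1)] pclass_eq_iff u(2)[symmetric] by blast
    have "gm' k *v v = d *s (cm j *v (Dm n *v u))"
      unfolding d(2) vector_scalar_commute am_mv klein_pairD[OF klein_pair_gm] ..
    then show ?thesis using d(1) unfolding u_def by (simp del: mv3 Dm_mv)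
  qed
  show ?thesis
  proof (cases "k < 7")
    case False
    then have g: "gm' k *v v = v" for v by (simp add: gm'_def matrix_vector_mul_lid del: mv3)
    have "ord_at xyz (pclass v) ((if torus v then 0 else 2) + (if torus (B *v v) then 0 else 2))"
      if "v \<noteq> 0" "kf v = 0" for v
      using ord_xyz[OF that] unfolding tB[OF that(1)] g by (cases "torus v") simp_all
    then show ?thesis using is_form_xyz by blast
  next
    case True
    define K where "K = (\<lambda>v. K0 (Dm (6 * k) *v v))"
    have t7: "torus (gm' k *v v) \<longleftrightarrow> torus (Jm *v (Dm (6 * k) *v v))" for v
    proof -
      have g: "gm' k *v v = (-1/7) *s (Jm *v (Dm (6 * k) *v v))"
        using True by (simp add: gm'_def matrix_vector_mul_assoc[symmetric] Jm'_mv del: mv3 Dm_mv Jm_mv)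
      show ?thesis unfolding g by (rule torus_smult) simp
    qed
    have "ord_at K (pclass v) ((if torus v then 0 else 2) + (if torus (B *v v) then 0 else 2))"
      if v: "v \<noteq> 0" "kf v = 0" for v
    proof -
      let ?u = "Dm (6 * k) *v v"
      have "?u \<noteq> 0" using klein_pair_nz[OF klein_pair_Dm] v by blast
      moreover have "kf ?u = 0" using v by (simp del: Dm_mv mv3)
      ultimately have "ord_at K0 (pclass ?u) ((if torus ?u then 0 else 2) + (if torus (Jm *v ?u) then 0 else 2))"
        by (rule ord_K0)
      then have "ord_at K (pclass v) ((if torus ?u then 0 else 2) + (if torus (Jm *v ?u) then 0 else 2))"
        unfolding K_def by (rule ord_at_transport[OF klein_pair_sym[OF klein_pair_Dm]])
      then show ?thesis unfolding tB[OF v(1)] t7 torus_Dm .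
    qed
    moreover have "is_form 3 K" unfolding K_def by (rule is_form_compose[OF is_form_K0])
    ultimately show ?thesis by blast
  qed
qed

end

text \<open>The quotient map (p : q : r) is unramified where no coordinate vanishes, so each zero is
  simple.\<close>

lemma ord_pencil:
  assumes u: "torus u" "kf u = 0" and v: "torus v"
  shows "ord_at (\<lambda>x. qm v * pm x - pm v * qm x) (pclass u) (if pm u * qm v = qm u * pm v then 1 else 0)"
proof -
  have form: "is_form 4 (\<lambda>x. qm v * pm x - pm v * qm x)"
  proof -
    have "is_form 4 (\<lambda>x. qm v * x$1^3 * x$2^1 * x$3^0 + (- pm v) * x$1^0 * x$2^3 * x$3^1)"
      by (intro is_form_add is_form_monom) simp_all
    then show ?thesis unfolding pm_def qm_def by (simp add: algebra_simps)
  qed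
  show ?thesis
  proof (cases "pm u * qm v = qm u * pm v")
    case False
    then show ?thesis using ord_at_unit[OF form, of u] by (simp add: algebra_simps)
  next
    case True
    have "ord_at (\<lambda>x. qm v * pm x - pm v * qm x) (pclass u) 1"
    proof (rule ord_at_simple[OF form])
      show "qm v * pm u - pm v * qm u = 0" using True by (simp add: algebra_simps)
      fix \<gamma> r assume lp: "local_param \<gamma> r (pclass u)"
      obtain c where c: "c \<noteq> 0" "\<gamma> 0 = c *s u" using local_param_at[OF lp] .
      define a b d where "a = \<gamma> 0 $ 1" and "b = \<gamma> 0 $ 2" and "d = \<gamma> 0 $ 3"
      have nz: "a \<noteq> 0" "b \<noteq> 0" "d \<noteq> 0" using u(1) c unfolding a_def b_def d_def torus_def by auto
      have kf0: "a^3 * b + b^3 * d + d^3 * a = 0"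
        using is_form_homogeneous[OF is_form_kf, of c u] u(2) unfolding c(2)[symmetric] kf_def a_def b_def d_def by simp
      have pr: "qm v * (a^3 * b) = pm v * (b^3 * d)"
      proof -
        have "a^3 * b = c^4 * pm u" "b^3 * d = c^4 * qm u"
          unfolding a_def b_def d_def c(2) pm_def qm_def by (simp_all add: power_mult_distrib eval_nat_numeral)
        then show ?thesis using True by (simp add: algebra_simps)
      qed
      obtain x y w where d1: "((\<lambda>t. \<gamma> t $ 1) has_field_derivative x) (at 0)"
        and d2: "((\<lambda>t. \<gamma> t $ 2) has_field_derivative y) (at 0)"
        and d3: "((\<lambda>t. \<gamma> t $ 3) has_field_derivative w) (at 0)"
        and rel: "3 * a^2 * b * x + a^3 * y + 3 * b^2 * d * y + b^3 * w + 3 * d^2 * a * w + d^3 * x = 0"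
        and ind: "\<And>k. \<not> (x = k * a \<and> y = k * b \<and> w = k * d)"
        unfolding a_def b_def d_def by (rule local_param_deriv[OF lp]) blast
      let ?D = "qm v * (3 * a^2 * x * b + a^3 * y) - pm v * (3 * b^2 * y * d + b^3 * w)"
      have D: "((\<lambda>t. qm v * pm (\<gamma> t) - pm v * qm (\<gamma> t)) has_field_derivative ?D) (at 0)"
        unfolding pm_def qm_def a_def b_def d_def
        by (auto intro!: derivative_eq_intros d1 d2 d3 simp: algebra_simps)
      have "?D \<noteq> 0"
      proof
        assume D0: "?D = 0"
        \<comment> \<open>These are the logarithmic derivatives of the coordinates. Vanishing of
          \<open>?D\<close> means that p and q have equal logarithmic derivatives; the curve
          relation adds r, and \<open>X = Y = W\<close> follows, which makes the velocity
          proportional to the point.\<close>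
        define X Y W where "X = x / a" and "Y = y / b" and "W = w / d"
        have xyw: "x = X * a" "y = Y * b" "w = W * d" using nz by (simp_all add: X_def Y_def W_def)
        have pq: "pm v \<noteq> 0" "qm v \<noteq> 0" using torus_nz[OF v] by auto
        have "?D = (qm v * (a^3 * b)) * (3 * X + Y) - (pm v * (b^3 * d)) * (3 * Y + W)" unfolding xyw by algebra
        then have "(pm v * (b^3 * d)) * ((3 * X + Y) - (3 * Y + W)) = 0" using D0 unfolding pr by algebra
        moreover have "pm v * (b^3 * d) \<noteq> 0" using pq nz by simp
        ultimately have "(3 * X + Y) - (3 * Y + W) = 0" by (metis mult_eq_0_iff)
        then have W: "W = 3 * X - 2 * Y" by algebra
        have "(a^3*b) * (3 * X + Y) + (b^3*d) * (3 * Y + W) + (d^3*a) * (3 * W + X) = 0"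
          using rel unfolding xyw by algebra
        moreover have "(a^3*b) * (3 * X + Y) + (b^3*d) * (3 * Y + W) + (d^3*a) * (3 * W + X)
          = (a^3 * b + b^3 * d + d^3 * a) * (3 * X + Y) + (d^3 * a) * (7 * (X - Y))"
          unfolding W by algebra
        ultimately have "(d^3 * a) * (7 * (X - Y)) = 0" unfolding kf0 by simp
        then have "X = Y" using nz by simp
        then show False using ind[of X] unfolding xyw W by simp
      qed
      then show "\<exists>D. D \<noteq> 0 \<and> ((\<lambda>t. qm v * pm (\<gamma> t) - pm v * qm (\<gamma> t)) has_field_derivative D) (at 0)"
        using D by blast
    qed
    then show ?thesis using True by simp
  qed
qed

text \<open>Times xyz the three monomials become rp, pq and qr.\<close>

definition quintic :: "complex \<Rightarrow> complex \<Rightarrow> complex \<Rightarrow> vec3 \<Rightarrow> complex" where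
  "quintic a b c u = a * u$1^3 * u$3^2 + b * u$1^2 * u$2^3 + c * u$2^2 * u$3^3"

lemma is_form_quintic: "is_form 5 (quintic a b c)"
proof -
  have "is_form 5 (\<lambda>u. a * u$1^3 * u$2^0 * u$3^2 + b * u$1^2 * u$2^3 * u$3^0 + c * u$1^0 * u$2^2 * u$3^3)"
    by (intro is_form_add is_form_monom) simp_all
  then show ?thesis by (simp add: quintic_def[abs_def])
qed

text \<open>Here z has order 1 and y order 3, so the term with \<open>z^2\<close> dominates.
  Multiplication by the unit \<open>U^3\<close> replaces \<open>y^3\<close> by a multiple of
  \<open>z^9\<close> and lets \<open>z^2\<close> be factored out.\<close>

lemma ord_quintic_e1:
  assumes "a \<noteq> 0"
  shows "ord_at (quintic a b c) (pclass e1) 2"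
proof -
  define U where "U = (\<lambda>v::vec3. v$1^3 + v$2^2 * v$3)"
  define V where "V = (\<lambda>v::vec3. (a * v$1^3 + c * v$2^2 * v$3) * U v ^ 3 - b * v$1^5 * v$3^7)"
  have fU: "is_form 3 U"
  proof -
    have "is_form 3 (\<lambda>v. 1 * v$1^3 * v$2^0 * v$3^0 + 1 * v$1^0 * v$2^2 * v$3^1)"
      by (intro is_form_add is_form_monom) simp_all
    then show ?thesis by (simp add: U_def)
  qed
  have fV: "is_form 12 V"
  proof -
    have "is_form 3 (\<lambda>v. a * v$1^3 * v$2^0 * v$3^0 + c * v$1^0 * v$2^2 * v$3^1)"
      by (intro is_form_add is_form_monom) simp_all
    from is_form_mult[OF this is_form_power[OF fU, of 3]]
    have "is_form 12 (\<lambda>v. (a * v$1^3 * v$2^0 * v$3^0 + c * v$1^0 * v$2^2 * v$3^1) * U v ^ 3 + (-b) * v$1^5 * v$2^0 * v$3^7)"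
      by (intro is_form_add is_form_monom) simp_all
    then show ?thesis by (simp add: V_def)
  qed
  have U: "ord_at (\<lambda>v. U v ^ 3) (pclass e1) (3 * 0)"
    by (intro ord_at_power ord_at_unit[OF fU]) (simp add: U_def e1_def axis_def)
  have V: "ord_at V (pclass e1) 0"
    by (intro ord_at_unit[OF fV]) (simp add: V_def U_def e1_def axis_def assms)
  have o: "ord_at (\<lambda>v. v$3^2 * V v) (pclass e1) (2 * 1 + 0)"
    by (intro ord_at_mult ord_at_power ord_coords_e1 V)
  have VQ: "v$3^2 * V v = quintic a b c v * U v ^ 3" if "kf v = 0" for v
  proof -
    have y: "v$2 * U v = - (v$3^3 * v$1)" using that unfolding kf_def U_def by algebra
    have "quintic a b c v * U v ^ 3 = v$3^2 * ((a * v$1^3 + c * v$2^2 * v$3) * U v ^ 3) + b * v$1^2 * (v$2 * U v)^3"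
      unfolding quintic_def by algebra
    also have "\<dots> = v$3^2 * V v" unfolding y V_def by algebra
    finally show ?thesis by simp
  qed
  have "2 * 1 + 0 = 2 + 3 * (0::nat)" by simp
  then have "ord_at (\<lambda>v. quintic a b c v * U v ^ 3) (pclass e1) (2 + 3 * 0)"
    using ord_at_cong[OF VQ o] by (simp only:)
  from ord_at_cancel[OF is_form_quintic this U] show ?thesis .
qed

text \<open>On the quartic, \<open>xyz\<close> times this quintic is \<open>-(q\<^sub>0 p - p\<^sub>0 q)(q\<^sub>1 p - p\<^sub>1 q)\<close>, which vanishes exactly on the
  orbits of \<open>v\<close> and \<open>w\<close> away from the coordinate points.\<close>

lemma ord_quintic:
  assumes tv: "torus v" "kf v = 0" and tw: "torus w" "kf w = 0"
    and u: "u \<noteq> 0" "kf u = 0"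
  shows "ord_at (quintic (qm v * qm w) (rm v * rm w) (pm v * pm w)) (pclass u)
    (if torus u then (if pm u * qm v = qm u * pm v then 1 else 0) + (if pm u * qm w = qm u * pm w then 1 else 0) else 2)"
proof (cases "torus u")
  case True
  let ?Q = "quintic (qm v * qm w) (rm v * rm w) (pm v * pm w)"
  let ?n = "(if pm u * qm v = qm u * pm v then 1 else 0) + (if pm u * qm w = qm u * pm w then 1 else 0 :: nat)"
  have o: "ord_at (\<lambda>x. (-1) * ((qm v * pm x - pm v * qm x) * (qm w * pm x - pm w * qm x))) (pclass u) ?n"
    by (intro ord_at_cmult ord_at_mult ord_pencil True u tv tw) simp
  have eq: "(-1) * ((qm v * pm x - pm v * qm x) * (qm w * pm x - pm w * qm x)) = ?Q x * xyz x" if "kf x = 0" for x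
  proof -
    have r: "rm x = - pm x - qm x" "rm v = - pm v - qm v" "rm w = - pm w - qm w"
      using that tv tw unfolding kf_pqr by (simp_all add: algebra_simps add_eq_0_iff)
    have "?Q x * xyz x = qm v * qm w * (pm x * rm x) + rm v * rm w * (pm x * qm x) + pm v * pm w * (qm x * rm x)"
      unfolding quintic_def xyz_def by (simp add: pm_def[of x] qm_def[of x] rm_def[of x] eval_nat_numeral algebra_simps)
    also have "\<dots> = (-1) * ((qm v * pm x - pm v * qm x) * (qm w * pm x - pm w * qm x))"
      unfolding r by algebra
    finally show ?thesis by simp
  qed
  have "ord_at (\<lambda>x. ?Q x * xyz x) (pclass u) (?n + 0)"
    unfolding add_0_right by (rule ord_at_cong[OF eq o])
  moreover have "ord_at xyz (pclass u) 0" using ord_xyz[OF u] True by simp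
  ultimately have "ord_at ?Q (pclass u) ?n" by (rule ord_at_cancel[OF is_form_quintic])
  then show ?thesis using True by simp
next
  case False
  have nz: "qm v * qm w \<noteq> 0" "rm v * rm w \<noteq> 0" "pm v * pm w \<noteq> 0" using torus_nz[OF tv(1)] torus_nz[OF tw(1)] by auto
  have cyc: "quintic a b c (vector [u$2, u$3, u$1]) = quintic c a b u"
    "quintic a b c (vector [u$3, u$1, u$2]) = quintic b c a u" for a b c u
    by (simp_all add: quintic_def algebra_simps)
  have "ord_at (quintic a b c) (pclass e2) 2" if "b \<noteq> 0" for a b c
    using ord_at_e2_e3(1)[OF ord_quintic_e1[OF that, of c a]] unfolding cyc .
  moreover have "ord_at (quintic a b c) (pclass e3) 2" if "c \<noteq> 0" for a b c
    using ord_at_e2_e3(2)[OF ord_quintic_e1[OF that, of a b]] unfolding cyc .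
  ultimately show ?thesis using False kf_not_torus[OF u(2,1)] ord_quintic_e1 nz by auto
qed

section \<open>The action on lists of lines\<close>

lemma pmap_image_iff:
  assumes "klein_pair A B" "l \<subseteq> P2"
  shows "X \<in> pmap A ` l \<longleftrightarrow> X \<in> P2 \<and> pmap B X \<in> l"
proof -
  have BA: "pmap B (pmap A Y) = Y" "pmap A Y \<in> P2" if "Y \<in> P2" "klein_pair A B" for Y A B
  proof -
    obtain v where "Y = pclass v" "v \<noteq> 0" using \<open>Y \<in> P2\<close> unfolding P2_def by auto
    then show "pmap B (pmap A Y) = Y" "pmap A Y \<in> P2"
      using klein_pair_nz[OF that(2)] klein_pairD(2)[OF that(2)] by (simp_all add: pmap_pclass del: mv3)
  qed
  show ?thesis
  proof
    assume "X \<in> pmap A ` l"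
    then show "X \<in> P2 \<and> pmap B X \<in> l" using BA[OF _ assms(1)] assms(2) by auto
  next
    assume X: "X \<in> P2 \<and> pmap B X \<in> l"
    then have "X = pmap A (pmap B X)" using BA[OF _ klein_pair_sym[OF assms(1)]] by simp
    then show "X \<in> pmap A ` l" using X by blast
  qed
qed

lemma pmap_mult:
  assumes "klein_pair A' B'" "X \<in> P2"
  shows "pmap A (pmap A' X) = pmap (A ** A') X"
proof -
  obtain v where v: "X = pclass v" "v \<noteq> 0" using assms(2) unfolding P2_def by auto
  have "A' *v v \<noteq> 0" using klein_pair_nz[OF assms(1)] v by blast
  then show ?thesis using v by (simp add: pmap_pclass matrix_vector_mul_assoc del: mv3)
qed

lemma act_act:
  assumes "klein_pair A' B'" "\<forall>l\<in>set L. l \<subseteq> P2"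
  shows "act (pmap A) (act (pmap A') L) = act (pmap (A ** A')) L"
  unfolding act_def map_map
proof (rule map_cong[OF refl])
  fix l assume "l \<in> set L"
  then have "l \<subseteq> P2" using assms by auto
  then show "((`) (pmap A) \<circ> (`) (pmap A')) l = pmap (A ** A') ` l"
    unfolding comp_def image_image by (intro image_cong[OF refl] pmap_mult[OF assms(1)]) auto
qed

lemma pmap_scalar:
  assumes "c \<noteq> 0" "\<And>v. A *v v = c *s (B *v v)"
  shows "pmap A = pmap B"
proof
  fix X show "pmap A X = pmap B X"
  proof (cases "X \<in> P2")
    case True
    then obtain v where v: "X = pclass v" "v \<noteq> 0" unfolding P2_def by auto
    then show ?thesis unfolding v(1) pmap_pclass[OF v(2)] assms(2) using assms(1) by simp
  qed (simp add: pmap_def)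
qed

lemma plines_subset_P2: "l \<in> plines \<Longrightarrow> l \<subseteq> P2"
  unfolding plines_def using line_of_subset_P2 by auto

lemma pmap_plines:
  assumes "klein_pair A B" "l \<in> plines"
  shows "pmap A ` l \<in> plines"
proof -
  obtain m where m: "l = line_of m" "m \<noteq> 0" using assms(2) unfolding plines_def by auto
  have "transpose B *v m \<noteq> 0"
  proof
    assume 0: "transpose B *v m = 0"
    have "dot (transpose B *v m) u = dot m (B *v u)" for u
      by (simp add: dot_def transpose_def algebra_simps)
    then have "dot m (B *v (A *v u)) = 0" for u unfolding 0 by (metis dot_def mult_zero_left add_0 zero_index)
    then have "dot m u = 0" for u unfolding klein_pairD[OF assms(1)] .
    from this[of "axis 1 1"] this[of "axis 2 1"] this[of "axis 3 1"] show False using m(2)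
      by (simp add: dot_def axis_def vec3_eq_iff)
  qed
  then show ?thesis unfolding m(1) pmap_line_of[OF klein_pairD[OF assms(1)]] by (rule line_of_in_plines)
qed

lemma length_act [simp]: "length (act s L) = length L"
  by (simp add: act_def)

lemma nth_act: "i < length L \<Longrightarrow> act s L ! i = s ` (L ! i)"
  by (simp add: act_def)

lemma nonconsec_less: "nonconsec i j \<Longrightarrow> i < 7 \<and> j < 7"
  by (simp add: nonconsec_def)

lemma heptagon_act:
  assumes AB: "klein_pair A B" and L: "heptagon L"
  shows "heptagon (act (pmap A) L)"
  unfolding heptagon_def
proof (intro conjI allI impI)
  have len: "length L = 7" and pl: "set L \<subseteq> plines" using L unfolding heptagon_def by auto
  have P2: "L ! i \<subseteq> P2" if "i < 7" for i using pl len that plines_subset_P2 nth_mem by (metis subsetD)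
  show "length (act (pmap A) L) = 7" using len by simp
  show "set (act (pmap A) L) \<subseteq> plines" unfolding act_def using pl pmap_plines[OF AB] by auto
  show "distinct (act (pmap A) L)" unfolding act_def distinct_map
  proof
    show "distinct L" using L unfolding heptagon_def by auto
    show "inj_on ((`) (pmap A)) (set L)"
    proof (rule inj_onI)
      fix l m assume lm: "l \<in> set L" "m \<in> set L" "pmap A ` l = pmap A ` m"
      have sub: "l \<subseteq> P2" "m \<subseteq> P2" using lm pl plines_subset_P2 by blast+
      have "pmap B ` (pmap A ` k) = k" if "k \<subseteq> P2" for k
      proof -
        have "pmap B (pmap A X) = X" if "X \<in> P2" for X
        proof -
          obtain v where "X = pclass v" "v \<noteq> 0" using \<open>X \<in> P2\<close> unfolding P2_def by auto
          then show ?thesis using klein_pair_nz[OF AB] klein_pairD(2)[OF AB]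
            by (simp add: pmap_pclass del: mv3)
        qed
        then show ?thesis using that by (force simp: image_image)
      qed
      then show "l = m" using lm sub by metis
    qed
  qed
  fix i j k :: nat assume ijk: "i < 7" "j < 7" "k < 7" "i \<noteq> j \<and> j \<noteq> k \<and> i \<noteq> k"
  then have "L ! i \<inter> L ! j \<inter> L ! k = {}" using L unfolding heptagon_def by blast
  then show "act (pmap A) L ! i \<inter> act (pmap A) L ! j \<inter> act (pmap A) L ! k = {}"
    using ijk len pmap_image_iff[OF AB P2] by (auto simp: nth_act)
qed

lemma residual_act:
  assumes AB: "klein_pair A B" and L: "length L = 7" "set L \<subseteq> plines"
  shows "X \<in> residual (act (pmap A) L) \<longleftrightarrow> X \<in> P2 \<and> pmap B X \<in> residual L"
proof -
  have P2: "L ! i \<subseteq> P2" if "i < 7" for i using L that plines_subset_P2 nth_mem by (metis subsetD)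
  have "nonconsec i j \<and> X \<in> act (pmap A) L ! i \<and> X \<in> act (pmap A) L ! j \<longleftrightarrow>
      X \<in> P2 \<and> nonconsec i j \<and> pmap B X \<in> L ! i \<and> pmap B X \<in> L ! j" for i j
    using nonconsec_less[of i j] L(1) pmap_image_iff[OF AB P2] by (auto simp: nth_act)
  then show ?thesis unfolding residual_def by blast
qed

lemma nonconsec_rev: "i < 7 \<Longrightarrow> j < 7 \<Longrightarrow> nonconsec (6 - i) (6 - j) \<longleftrightarrow> nonconsec i j"
proof -
  assume "i < 7" "j < 7"
  then have "i \<in> {0,1,2,3,4,5,6}" "j \<in> {0,1,2,3,4,5,6}" by auto
  then show ?thesis unfolding nonconsec_def by (elim insertE emptyE) simp_all
qed

lemma residual_rev:
  assumes "length L = 7"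
  shows "residual (rev L) = residual L"
proof -
  have sub: "residual (rev L) \<subseteq> residual L" if "length L = 7" for L
  proof
    fix X assume "X \<in> residual (rev L)"
    then obtain i j where ij: "nonconsec i j" "X \<in> rev L ! i" "X \<in> rev L ! j" unfolding residual_def by auto
    have "i < 7" "j < 7" using nonconsec_less[OF ij(1)] by auto
    then have "nonconsec (6 - i) (6 - j) \<and> X \<in> L ! (6 - i) \<and> X \<in> L ! (6 - j)"
      using ij that nonconsec_rev by (simp add: rev_nth)
    then show "X \<in> residual L" unfolding residual_def by blast
  qed
  show ?thesis using sub[OF assms] sub[of "rev L"] assms by auto
qed

lemma heptagon_rev:
  assumes "heptagon L"
  shows "heptagon (rev L)"
proof -
  have len: "length L = 7" using assms unfolding heptagon_def by auto
  have "rev L ! i \<inter> rev L ! j \<inter> rev L ! k = {}" if "i < 7" "j < 7" "k < 7" "i \<noteq> j \<and> j \<noteq> k \<and> i \<noteq> k" for i j k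
  proof -
    have "6 - i < 7" "6 - j < 7" "6 - k < 7" "6 - i \<noteq> 6 - j" "6 - j \<noteq> 6 - k" "6 - i \<noteq> 6 - k" using that by auto
    then have "L ! (6 - i) \<inter> L ! (6 - j) \<inter> L ! (6 - k) = {}" using assms unfolding heptagon_def by blast
    then show ?thesis using that len by (simp add: rev_nth)
  qed
  then show ?thesis using assms unfolding heptagon_def by simp
qed

lemma good_heptagon_rev:
  assumes "good_heptagon L"
  shows "good_heptagon (rev L)"
proof -
  have "length L = 7" using assms unfolding good_heptagon_def heptagon_def by auto
  then show ?thesis using assms heptagon_rev residual_rev
    unfolding good_heptagon_def adjoint_is_def theta_of_def residual_div_def by auto
qed

lemma act_rev: "act s (rev L) = rev (act s L)"
  by (simp add: act_def rev_map)

lemma act_rotate1: "act s (rotate1 L) = rotate1 (act s L)"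
  by (simp add: act_def rotate1_map)

text \<open>Since entries are distinct, the \<open>n\<close> rotations of a list differ, and the
  classes partition \<open>S\<close> into blocks of size \<open>n\<close>.\<close>

lemma card_cyc_classes:
  assumes fin: "finite S" and L: "\<And>L. L \<in> S \<Longrightarrow> distinct L \<and> length L = n" and "n > 0"
    and rot: "\<And>L. L \<in> S \<Longrightarrow> rotate1 L \<in> S"
  shows "n * card (cyc_classes S) = card S"
proof -
  have rotk: "rotate k L \<in> S" if "L \<in> S" for k L
    by (induction k) (use that rot in \<open>auto simp: rotate_Suc\<close>)
  define c where "c = (\<lambda>L::pline list. {rotate k L | k. True})"
  have cS: "cyc_classes S = c ` S" unfolding cyc_classes_def c_def ..
  have cimg: "c L = (\<lambda>k. rotate k L) ` {..<n}" if "L \<in> S" for L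
  proof -
    have "rotate k L = rotate (k mod n) L" for k using L[OF that] rotate_conv_mod by metis
    then show ?thesis unfolding c_def using \<open>n > 0\<close> by (auto simp: image_iff) (metis lessThan_iff mod_less_divisor)
  qed
  have inj: "inj_on (\<lambda>k. rotate k L) {..<n}" if "L \<in> S" for L
  proof (rule inj_onI)
    fix k k' assume k: "k \<in> {..<n}" "k' \<in> {..<n}" "rotate k L = rotate k' L"
    have "rotate k L ! 0 = L ! k" "rotate k' L ! 0 = L ! k'" using k(1,2) L[OF that] \<open>n > 0\<close>
      by (simp_all add: nth_rotate)
    then have "L ! k = L ! k'" using k(3) by metis
    then show "k = k'" using k(1,2) L[OF that] by (simp add: nth_eq_iff_index_eq)
  qed
  have mem: "L \<in> c L" for L unfolding c_def by (auto intro: exI[of _ 0])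
  have eqc: "c L = c M" if M: "M \<in> c L" "L \<in> S" for L M
  proof -
    obtain k where k: "M = rotate k L" using M(1) unfolding c_def by auto
    have len: "length L = n" using L M by auto
    \<comment> \<open>Rotating by a further \<open>n * k - k\<close> completes \<open>n * k\<close>
      steps, which is the identity.\<close>
    have "rotate (n * k - k) M = rotate (n * k) L" unfolding k rotate_rotate using \<open>n > 0\<close> by simp
    also have "\<dots> = L" using len by (metis mod_mult_self1_is_0 rotate0 rotate_conv_mod id_apply)
    finally have bk: "L = rotate (n * k - k) M" by simp
    show ?thesis
    proof (intro set_eqI iffI)
      fix X assume "X \<in> c L" then show "X \<in> c M" unfolding c_def by (subst (asm) bk) (auto simp: rotate_rotate)
    next
      fix X assume "X \<in> c M" then show "X \<in> c L" unfolding c_def k by (auto simp: rotate_rotate)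
    qed
  qed
  have "\<Union> (c ` S) = S" using mem rotk unfolding c_def by auto
  moreover have "n * card (c ` S) = card (\<Union> (c ` S))"
  proof (rule card_partition)
    show "finite (c ` S)" using fin by simp
    show "finite (\<Union> (c ` S))" unfolding \<open>\<Union> (c ` S) = S\<close> by (rule fin)
    show "card x = n" if "x \<in> c ` S" for x
      using that cimg card_image[OF inj] by auto
    show "x \<inter> y = {}" if xy: "x \<in> c ` S" "y \<in> c ` S" "x \<noteq> y" for x y
    proof (rule ccontr)
      assume "x \<inter> y \<noteq> {}"
      then obtain M where M: "M \<in> x" "M \<in> y" by blast
      obtain L L' where "L \<in> S" "x = c L" "L' \<in> S" "y = c L'" using xy by auto
      then have "x = c M" "y = c M" using eqc M by metis+
      then show False using xy by simp
    qed
  qed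
  ultimately show ?thesis unfolding cS by simp
qed

lemma quadratic_three_roots:
  fixes a b c :: complex
  assumes "a + b * r + c * r^2 = 0" "a + b * s + c * s^2 = 0" "a + b * t + c * t^2 = 0"
    "r \<noteq> s" "s \<noteq> t" "r \<noteq> t"
  shows "a = 0 \<and> b = 0 \<and> c = 0"
proof -
  have "(r - s) * (b + c * (r + s)) = 0" "(r - t) * (b + c * (r + t)) = 0" using assms(1-3) by algebra+
  then have e: "b + c * (r + s) = 0" "b + c * (r + t) = 0" using assms by auto
  then have "c * (s - t) = 0" by algebra
  then show ?thesis using assms e by auto
qed

text \<open>Conjugation inverts roots of unity, so a vanishing sum makes the second symmetric
  function vanish as well. Then \<open>s^3 = t^3\<close>, and together with \<open>s^7 = t^7\<close>
  this gives \<open>s = t\<close>.\<close>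

lemma unit_roots_sum_nonzero:
  fixes s t u :: complex
  assumes "s ^ 7 = 1" "t ^ 7 = 1" "u ^ 7 = 1" "s \<noteq> t"
  shows "s + t + u \<noteq> 0"
proof
  assume sum: "s + t + u = 0"
  have cn: "cnj w = 1 / w" if "w ^ 7 = 1" for w :: complex
  proof -
    have "cmod w ^ 7 = 1" using that by (metis norm_one norm_power)
    then have "cmod w = 1" using power_eq_imp_eq_base[of "cmod w" 7 1] by simp
    then have "w * cnj w = 1" by (simp add: complex_norm_square[symmetric])
    moreover have "w \<noteq> 0" using that by auto
    ultimately show ?thesis by (simp add: field_simps)
  qed
  have nz: "s \<noteq> 0" "t \<noteq> 0" "u \<noteq> 0" using assms by auto
  have "1 / s + 1 / t + 1 / u = 0"
    using arg_cong[OF sum, of cnj] cn assms by simp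
  then have "s * t + t * u + u * s = 0" using nz by (simp add: field_simps)
  then have "s^3 = t^3" using sum by algebra
  then have "s^7 * t = t^7 * s" by algebra
  then show False using assms by simp
qed

lemma mod_7_mult_6D:
  fixes a b :: nat
  assumes "(6 * a) mod 7 = (6 * b) mod 7"
  shows "a mod 7 = b mod 7"
proof -
  have *: "(6 * (6 * c)) mod 7 = c mod 7" for c :: nat
  proof -
    have "6 * (6 * c) = c + 7 * (5 * c)" by simp
    then show ?thesis by (simp only: mod_mult_self2)
  qed
  show ?thesis using *[of a] *[of b] assms by (metis mod_mult_right_eq)
qed

context klein_root
begin

section \<open>The heptagon\<close>

text \<open>\<open>hl v i\<close> is the line \<open>L\<^bsub>i+1\<^esub>\<close>: it joins \<open>Dm i\<close> and \<open>Dm (i + 5)\<close> applied to \<open>v\<close>. On dual coordinates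
  \<open>Dm i\<close> acts as its inverse \<open>Dm (6 * i)\<close>.\<close>

definition hn :: "vec3 \<Rightarrow> vec3" where
  "hn v = crs (Dm 5 *v v) v"

definition hl :: "vec3 \<Rightarrow> nat \<Rightarrow> pline" where
  "hl v i = line_of (Dm (6 * i) *v hn v)"

definition hept :: "vec3 \<Rightarrow> pline list" where
  "hept v = map (hl v) [0..<7]"

lemma hn_eq: "hn v = vector [v$2 * v$3 * (z^3 - z^5), v$1 * v$3 * (z^5 - z^6), v$1 * v$2 * (z^6 - z^3)]"
proof -
  have p: "z ^ 20 = z ^ 6" "z ^ 10 = z ^ 3" by (simp_all add: z_pow_inj)
  show ?thesis unfolding hn_def crs_def by (simp add: vec3_eq_iff p algebra_simps del: mv3)
qed

lemma torus_hn: "torus v \<Longrightarrow> torus (hn v)"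
proof -
  have "z^3 \<noteq> z^5" "z^5 \<noteq> z^6" "z^6 \<noteq> z^3" by (simp_all add: z_pow_inj)
  then show "torus v \<Longrightarrow> torus (hn v)" unfolding hn_eq by (auto simp: torus_def)
qed

text \<open>Cross products transform by the cofactor matrix, which is the inverse of
  \<open>Dm k\<close> because its determinant is \<open>z^(7k) = 1\<close>.\<close>

lemma crs_Dm: "crs (Dm k *v u) (Dm k *v w) = Dm (6 * k) *v crs u w"
proof -
  have "4 * (6 * k) = 2 * k + k + 7 * (3 * k)" "2 * (6 * k) = 4 * k + k + 7 * k" "6 * k = 4 * k + 2 * k" by simp_all
  moreover have "z ^ (m + 7 * l) = z ^ m" for m l by (simp add: power_add power_mult z7)
  ultimately have "z ^ (4 * (6 * k)) = z ^ (2 * k) * z ^ k" "z ^ (2 * (6 * k)) = z ^ (4 * k) * z ^ k"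
    "z ^ (6 * k) = z ^ (4 * k) * z ^ (2 * k)" by (simp_all only: power_add[symmetric])
  then show ?thesis unfolding crs_def by (simp add: vec3_eq_iff algebra_simps del: mv3)
qed

lemma join_hl:
  assumes "torus v" "k mod 7 = (i + 5) mod 7" "l mod 7 = i mod 7"
  shows "join (pclass (Dm k *v v)) (pclass (Dm l *v v)) = hl v i"
    and "join (pclass (Dm l *v v)) (pclass (Dm k *v v)) = hl v i"
proof -
  have e: "Dm k = Dm (i + 5)" "Dm l = Dm i" using assms by (auto intro: Dm_eqI)
  have c: "crs (Dm k *v v) (Dm l *v v) = Dm (6 * i) *v hn v"
    unfolding e hn_def Dm_add[symmetric] crs_Dm ..
  have c': "crs (Dm l *v v) (Dm k *v v) = (-1) *s (Dm (6 * i) *v hn v)"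
    unfolding c[symmetric] by (simp add: crs_def vec3_eq_iff del: mv3)
  have "torus (Dm (6 * i) *v hn v)" using torus_hn[OF assms(1)] by (simp del: Dm_mv mv3)
  then have nz: "Dm (6 * i) *v hn v \<noteq> 0" by (metis torus_nz)
  then show "join (pclass (Dm k *v v)) (pclass (Dm l *v v)) = hl v i"
    unfolding hl_def using join_pclass[of "Dm k *v v" "Dm l *v v"] unfolding c by blast
  have "(-1) *s (Dm (6 * i) *v hn v) \<noteq> 0" using nz by (simp add: vec_eq_iff del: mv3 Dm_mv)
  then show "join (pclass (Dm l *v v)) (pclass (Dm k *v v)) = hl v i"
    using join_pclass[of "Dm l *v v" "Dm k *v v"] line_of_smult[of "-1"] unfolding c' hl_def by simp
qed

lemma hl_mod: "i mod 7 = j mod 7 \<Longrightarrow> hl v i = hl v j"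
  unfolding hl_def using Dm_eqI[of "6 * i" "6 * j"] by (metis mod_mult_right_eq)

lemma length_hept [simp]: "length (hept v) = 7"
  by (simp add: hept_def)

lemma nth_hept: "i < 7 \<Longrightarrow> hept v ! i = hl v i"
  by (simp add: hept_def)

lemma dot_Dm: "dot (Dm k *v u) w = dot u (Dm k *v w)"
  by (simp add: dot_def algebra_simps del: mv3)

text \<open>Incidence with a line is the equation \<open>y3 + y2 q + y1 q^3 = 0\<close> in a seventh
  root of unity \<open>q\<close>. Without a quadratic term, three distinct roots would sum to zero
  if \<open>y1\<close> were nonzero.\<close>

lemma hl_not_concurrent:
  assumes v: "torus v" and "dot (Dm (6 * i) *v hn v) u = 0" "dot (Dm (6 * j) *v hn v) u = 0"
    "dot (Dm (6 * k) *v hn v) u = 0" and ne: "i mod 7 \<noteq> j mod 7" "j mod 7 \<noteq> k mod 7" "i mod 7 \<noteq> k mod 7"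
  shows "u = 0"
proof -
  define y1 y2 y3 where "y1 = hn v $ 1 * u $ 1" and "y2 = hn v $ 2 * u $ 2" and "y3 = hn v $ 3 * u $ 3"
  define r s t where "r = z ^ (6 * i)" and "s = z ^ (6 * j)" and "t = z ^ (6 * k)"
  have seven: "(z ^ n) ^ 7 = 1" for n by (metis z7 power_mult mult.commute power_one)
  note d6 = mod_7_mult_6D
  have rst: "r ^ 7 = 1" "s ^ 7 = 1" "t ^ 7 = 1" "r \<noteq> s" "s \<noteq> t" "r \<noteq> t"
    unfolding r_def s_def t_def seven z_pow_inj using ne d6 by blast+
  have eq: "y3 + y2 * z ^ (6 * n) + y1 * (z ^ (6 * n)) ^ 3 = 0" if "dot (Dm (6 * n) *v hn v) u = 0" for n
  proof -
    define q where "q = z ^ (6 * n)"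
    have q: "z ^ (4 * (6 * n)) = q ^ 4" "z ^ (2 * (6 * n)) = q ^ 2"
      unfolding q_def by (simp_all add: power_mult[symmetric] mult.commute)
    have "q ^ 4 * hn v $ 1 * u $ 1 + q ^ 2 * hn v $ 2 * u $ 2 + q * hn v $ 3 * u $ 3 = 0"
      using that unfolding dot_def Dm_mv vector_3 q q_def[symmetric] .
    then have "q * (y3 + y2 * q + y1 * q ^ 3) = 0" unfolding y1_def y2_def y3_def by algebra
    then show ?thesis by (simp add: q_def)
  qed
  have e: "y3 + y2 * r + y1 * r^3 = 0" "y3 + y2 * s + y1 * s^3 = 0" "y3 + y2 * t + y1 * t^3 = 0"
    using eq assms unfolding r_def s_def t_def by auto
  \<comment> \<open>The determinant with exponents 0, 1, 3 is the Vandermonde determinant times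
    \<open>r + s + t\<close>.\<close>
  have "(r - s) * (s - t) * (r - t) * (r + s + t) * y1 = 0" using e by algebra
  then have "y1 = 0" using rst unit_roots_sum_nonzero[of r s t] by simp
  then have "y3 = 0 \<and> y2 = 0 \<and> 0 = (0::complex)"
    using e by (intro quadratic_three_roots[OF _ _ _ rst(4,5,6)]) simp_all
  then show ?thesis using \<open>y1 = 0\<close> torus_hn[OF v] unfolding y1_def y2_def y3_def torus_def vec3_eq_iff by auto
qed

lemma hl_inj:
  assumes "torus v" "i mod 7 \<noteq> j mod 7"
  shows "crs (Dm (6 * i) *v hn v) (Dm (6 * j) *v hn v) \<noteq> 0"
proof
  note d6 = mod_7_mult_6D
  have t: "torus (hn v)" by (rule torus_hn[OF assms(1)])
  assume "crs (Dm (6 * i) *v hn v) (Dm (6 * j) *v hn v) = 0"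
  moreover have "Dm (6 * j) *v hn v \<noteq> 0" using t torus_Dm torus_nz by blast
  ultimately obtain c where "Dm (6 * i) *v hn v = c *s (Dm (6 * j) *v hn v)" by (rule crs_eq_0D)
  then show False using Dm_smult_eqD[OF t] d6 assms(2) by blast
qed

lemma heptagon_hept:
  assumes v: "torus v"
  shows "heptagon (hept v)"
  unfolding heptagon_def
proof (intro conjI allI impI)
  show "length (hept v) = 7" by simp
  have nz: "Dm (6 * i) *v hn v \<noteq> 0" for i using torus_hn[OF v] torus_Dm torus_nz by blast
  show "set (hept v) \<subseteq> plines" unfolding hept_def hl_def using nz by auto
  show "distinct (hept v)" unfolding hept_def distinct_map
  proof
    show "inj_on (hl v) (set [0..<7])"
    proof (rule inj_onI)
      fix i j assume ij: "i \<in> set [0..<7]" "j \<in> set [0..<7]" "hl v i = hl v j"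
      then obtain c where "Dm (6 * i) *v hn v = c *s (Dm (6 * j) *v hn v)"
        unfolding hl_def using line_of_eqD[OF _ nz] by metis
      then have "crs (Dm (6 * i) *v hn v) (Dm (6 * j) *v hn v) = 0"
        by (simp only:) (simp add: crs_def vec3_eq_iff)
      then have "i mod 7 = j mod 7" using hl_inj[OF v] by blast
      then show "i = j" using ij by simp
    qed
  qed simp
  fix i j k :: nat assume ijk: "i < 7" "j < 7" "k < 7" "i \<noteq> j \<and> j \<noteq> k \<and> i \<noteq> k"
  show "hept v ! i \<inter> hept v ! j \<inter> hept v ! k = {}"
  proof (rule ccontr)
    assume "hept v ! i \<inter> hept v ! j \<inter> hept v ! k \<noteq> {}"
    then obtain X where X: "X \<in> hl v i" "X \<in> hl v j" "X \<in> hl v k" using ijk by (auto simp: nth_hept)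
    obtain u where u: "X = pclass u" "u \<noteq> 0" by (rule line_of_cases[OF X(1)[unfolded hl_def]])
    have "u = 0" using X u ijk unfolding hl_def by (intro hl_not_concurrent[OF v, of i u j k]) auto
    then show False using u by simp
  qed
qed

section \<open>The residual points\<close>

definition Pm :: "vec3 \<Rightarrow> vec3" where
  "Pm v = psi_mat z *v v"

lemma Pm_eq: "Pm v = vector [(z^4 + 2*z^2 - 2*z - z^6) * v$1, (z^2 + 2*z - 2*z^4 - z^3) * v$2, (z + 2*z^4 - 2*z^2 - z^5) * v$3]"
  unfolding Pm_def psi_mat_def by (simp add: vec3_eq_iff diag3_def)

lemma torus_Pm: "torus v \<Longrightarrow> torus (Pm v)"
proof -
  have "((z^4 + 2*z^2 - 2*z - z^6) * (z^2 + 2*z - 2*z^4 - z^3) * (z + 2*z^4 - 2*z^2 - z^5))^2 = -343"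
    using zsum by algebra
  then have "z^4 + 2*z^2 - 2*z - z^6 \<noteq> 0" "z^2 + 2*z - 2*z^4 - z^3 \<noteq> 0" "z + 2*z^4 - 2*z^2 - z^5 \<noteq> 0"
    by auto
  then show "torus v \<Longrightarrow> torus (Pm v)" unfolding Pm_eq by (simp add: torus_def)
qed

text \<open>The map scales p by \<open>c1\<close> and q by \<open>c2\<close>, so the claim is that
  these two constants differ.\<close>

lemma Pm_pq:
  assumes "torus v" "kf v = 0" "kf (Pm v) = 0"
  shows "pm v * qm (Pm v) \<noteq> qm v * pm (Pm v)"
proof
  define c1 where "c1 = 49 * (1 + 2 * (z^2 + z^3 + z^4 + z^5))"
  define c2 where "c2 = -49 * (1 + 2 * (z^3 + z^4))"
  define c3 where "c3 = -49 * (1 + 2 * (z^2 + z^5))"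
  have 1: "(z^4 + 2*z^2 - 2*z - z^6)^3 * (z^2 + 2*z - 2*z^4 - z^3) = c1" unfolding c1_def using zsum by algebra
  have 2: "(z^2 + 2*z - 2*z^4 - z^3)^3 * (z + 2*z^4 - 2*z^2 - z^5) = c2" unfolding c2_def using zsum by algebra
  \<comment> \<open>The constants are Galois conjugate, of the form
    \<open>-49 (1 + 2 (z^k + z^(-k)))\<close> for k = 1, 3, 2; the product of their differences is
    the integer \<open>-7 * 98^3\<close>.\<close>
  have "(c1 - c2) * (c2 - c3) * (c3 - c1) = -6588344"
    unfolding c1_def c2_def c3_def using zsum by algebra
  then have "c1 \<noteq> c2" by auto
  moreover have "pm (Pm v) = c1 * pm v" "qm (Pm v) = c2 * qm v"
    unfolding pm_def qm_def Pm_eq vector_3 1[symmetric] 2[symmetric] by (simp_all add: power_mult_distrib)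
  moreover assume "pm v * qm (Pm v) = qm v * pm (Pm v)"
  ultimately show False using torus_nz[OF assms(1)] by simp
qed

lemma dot_hn_Dm: "m mod 7 \<in> {0, 5} \<Longrightarrow> dot (hn v) (Dm m *v v) = 0"
proof -
  assume "m mod 7 \<in> {0, 5}"
  then have "Dm m = Dm 0 \<or> Dm m = Dm 5" by (auto intro: Dm_eqI)
  moreover have "Dm 0 *v v = v" by (rule Dm_0) simp
  ultimately show ?thesis unfolding hn_def using crs_dot by metis
qed

text \<open>Together with \<open>dot_hn_Dm\<close> this places the four residual points on the first
  line: exponents 0 and 5 in the orbit of \<open>v\<close>, 1 and 5 in that of
  \<open>Pm v\<close>.\<close>

lemma dot_hn_Pm: "m mod 7 \<in> {1, 5} \<Longrightarrow> dot (hn v) (Dm m *v Pm v) = 0"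
proof -
  assume "m mod 7 \<in> {1, 5}"
  then have m: "Dm m = Dm 1 \<or> Dm m = Dm 5" by (auto intro: Dm_eqI)
  have e1: "(z^3 - z^5) * (z^4 + 2*z^2 - 2*z - z^6) * z^4 + (z^5 - z^6) * (z^2 + 2*z - 2*z^4 - z^3) * z^2
      + (z^6 - z^3) * (z + 2*z^4 - 2*z^2 - z^5) * z = 0" using zsum by algebra
  have e5: "(z^3 - z^5) * (z^4 + 2*z^2 - 2*z - z^6) * z^20 + (z^5 - z^6) * (z^2 + 2*z - 2*z^4 - z^3) * z^10
      + (z^6 - z^3) * (z + 2*z^4 - 2*z^2 - z^5) * z^5 = 0" using zsum by algebra
  have *: "dot (hn v) (Dm k *v Pm v) = v$1 * v$2 * v$3 * ((z^3 - z^5) * (z^4 + 2*z^2 - 2*z - z^6) * z^(4*k)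
      + (z^5 - z^6) * (z^2 + 2*z - 2*z^4 - z^3) * z^(2*k) + (z^6 - z^3) * (z + 2*z^4 - 2*z^2 - z^5) * z^k)" for k
    unfolding dot_def hn_eq Pm_eq Dm_mv vector_3 by algebra
  have "dot (hn v) (Dm 1 *v Pm v) = 0" unfolding * using e1 by simp
  moreover have "dot (hn v) (Dm 5 *v Pm v) = 0" unfolding * using e5 by simp
  ultimately show ?thesis using m by metis
qed

text \<open>Nonconsecutive indices differ by 2 or by 3 modulo 7. The parameter \<open>k\<close> is
  chosen as the exponent of the intersection point, in the orbit of \<open>v\<close> in the first
  case and of \<open>Pm v\<close> in the second.\<close>

lemma nonconsec_cases:
  assumes "nonconsec i j"
  obtains k where "k < 7" "i = k \<and> j = (k + 2) mod 7 \<or> j = k \<and> i = (k + 2) mod 7"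
  | k where "k < 7" "i = (k + 6) mod 7 \<and> j = (k + 2) mod 7 \<or> j = (k + 6) mod 7 \<and> i = (k + 2) mod 7"
proof -
  have ij: "i \<in> {0,1,2,3,4,5,6}" "j \<in> {0,1,2,3,4,5,6}" using nonconsec_less[OF assms] by auto
  have "(\<exists>k\<in>{0,1,2,3,4,5,6}. i = k \<and> j = (k + 2) mod 7 \<or> j = k \<and> i = (k + 2) mod 7) \<or>
    (\<exists>k\<in>{0,1,2,3,4,5,6}. i = (k + 6) mod 7 \<and> j = (k + 2) mod 7 \<or> j = (k + 6) mod 7 \<and> i = (k + 2) mod 7)"
    using ij assms unfolding nonconsec_def by (elim insertE emptyE) simp_all
  then consider k where "k \<in> {0,1,2,3,4,5,6}" "i = k \<and> j = (k + 2) mod 7 \<or> j = k \<and> i = (k + 2) mod 7"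
    | k where "k \<in> {0,1,2,3,4,5,6}" "i = (k + 6) mod 7 \<and> j = (k + 2) mod 7 \<or> j = (k + 6) mod 7 \<and> i = (k + 2) mod 7"
    by blast
  then show ?thesis
  proof cases
    case (1 k)
    then have "k < 7" by auto
    then show ?thesis using 1(2) by (rule that(1))
  next
    case (2 k)
    then have "k < 7" by auto
    then show ?thesis using 2(2) by (rule that(2))
  qed
qed

text \<open>Two of the lines share only one point, so exhibiting a common point for each of the
  fourteen pairs determines everything.\<close>

lemma residual_hept:
  assumes v: "torus v"
  shows "residual (hept v) = {pclass (Dm k *v v) | k. k < 7} \<union> {pclass (Dm k *v Pm v) | k. k < 7}"
proof -
  have nzv: "Dm k *v v \<noteq> 0" "Dm k *v Pm v \<noteq> 0" for k using v torus_Pm[OF v] torus_Dm torus_nz by blast+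
  have onv: "pclass (Dm k *v v) \<in> hl v i" if "(k + 6 * i) mod 7 \<in> {0, 5}" for k i
    unfolding hl_def pclass_in_line_of[OF nzv(1)] dot_Dm Dm_add using dot_hn_Dm[of "6 * i + k"] that
    by (simp add: add.commute)
  have onw: "pclass (Dm k *v Pm v) \<in> hl v i" if "(k + 6 * i) mod 7 \<in> {1, 5}" for k i
    unfolding hl_def pclass_in_line_of[OF nzv(2)] dot_Dm Dm_add using dot_hn_Pm[of "6 * i + k"] that
    by (simp add: add.commute)
  have a: "(k + 6 * k) mod 7 = 0" "(k + 6 * (k + 2)) mod 7 = 5" "(k + 6 * (k + 6)) mod 7 = 1" for k :: nat
    by presburger+
  have v2: "pclass (Dm k *v v) \<in> hl v k" "pclass (Dm k *v v) \<in> hl v ((k + 2) mod 7)" for k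
  proof -
    show "pclass (Dm k *v v) \<in> hl v k" by (rule onv) (simp only: a insert_iff simp_thms)
    have "pclass (Dm k *v v) \<in> hl v (k + 2)" by (rule onv) (simp only: a insert_iff simp_thms)
    then show "pclass (Dm k *v v) \<in> hl v ((k + 2) mod 7)" using hl_mod[of "(k + 2) mod 7" "k + 2"] by simp
  qed
  have w2: "pclass (Dm k *v Pm v) \<in> hl v ((k + 6) mod 7)" "pclass (Dm k *v Pm v) \<in> hl v ((k + 2) mod 7)" for k
  proof -
    have "pclass (Dm k *v Pm v) \<in> hl v (k + 6)" by (rule onw) (simp only: a insert_iff simp_thms)
    then show "pclass (Dm k *v Pm v) \<in> hl v ((k + 6) mod 7)" using hl_mod[of "(k + 6) mod 7" "k + 6"] by simp
    have "pclass (Dm k *v Pm v) \<in> hl v (k + 2)" by (rule onw) (simp only: a insert_iff simp_thms)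
    then show "pclass (Dm k *v Pm v) \<in> hl v ((k + 2) mod 7)" using hl_mod[of "(k + 2) mod 7" "k + 2"] by simp
  qed
  have once: "X = Y" if "X \<in> hl v i" "X \<in> hl v j" "Y \<in> hl v i" "Y \<in> hl v j" "i mod 7 \<noteq> j mod 7" for X Y i j
    using lines_meet_once[OF hl_inj[OF v that(5)]] that(1-4) unfolding hl_def by blast
  show ?thesis
  proof (intro set_eqI iffI)
    fix X assume "X \<in> residual (hept v)"
    then obtain i j where ij: "nonconsec i j" "X \<in> hept v ! i" "X \<in> hept v ! j" unfolding residual_def by auto
    have lt: "i < 7" "j < 7" "i \<noteq> j" using ij(1) unfolding nonconsec_def by auto
    have X: "X \<in> hl v i" "X \<in> hl v j" using ij lt by (auto simp: nth_hept)
    have ne: "i mod 7 \<noteq> j mod 7" using lt by simp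
    show "X \<in> {pclass (Dm k *v v) | k. k < 7} \<union> {pclass (Dm k *v Pm v) | k. k < 7}"
      using ij(1)
    proof (cases rule: nonconsec_cases)
      case (1 k)
      then have "X = pclass (Dm k *v v)" using once[OF X _ _ ne] v2[of k] by blast
      then show ?thesis using 1 by blast
    next
      case (2 k)
      then have "X = pclass (Dm k *v Pm v)" using once[OF X _ _ ne] w2[of k] by blast
      then show ?thesis using 2 by blast
    qed
  next
    fix X assume X: "X \<in> {pclass (Dm k *v v) | k. k < 7} \<union> {pclass (Dm k *v Pm v) | k. k < 7}"
    have nc: "nonconsec k ((k + 2) mod 7)" "nonconsec ((k + 6) mod 7) ((k + 2) mod 7)" if "k < 7" for k
    proof -
      have "k \<in> {0,1,2,3,4,5,6}" using that by auto
      then show "nonconsec k ((k + 2) mod 7)" "nonconsec ((k + 6) mod 7) ((k + 2) mod 7)"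
        unfolding nonconsec_def by auto
    qed
    from X consider k where "k < 7" "X = pclass (Dm k *v v)" | k where "k < 7" "X = pclass (Dm k *v Pm v)" by auto
    then show "X \<in> residual (hept v)"
    proof cases
      case (1 k)
      have "(k + 2) mod 7 < 7" by simp
      then have "X \<in> hept v ! k" "X \<in> hept v ! ((k + 2) mod 7)" using v2[of k] 1 by (simp_all add: nth_hept)
      then show ?thesis using nc(1)[OF 1(1)] unfolding residual_def by blast
    next
      case (2 k)
      have "(k + 2) mod 7 < 7" "(k + 6) mod 7 < 7" by simp_all
      then have "X \<in> hept v ! ((k + 6) mod 7)" "X \<in> hept v ! ((k + 2) mod 7)" using w2[of k] 2 by (simp_all add: nth_hept)
      then show ?thesis using nc(2)[OF 2(1)] unfolding residual_def by blast
    qed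
  qed
qed

section \<open>Automorphisms acting on the seven lines\<close>

lemma transpose_Dm: "transpose (Dm k) = Dm k"
  by (simp add: vec_eq_iff transpose_def Dm_def diag3_def)

lemma pmap_hl:
  assumes "klein_pair A B"
  shows "pmap A ` hl v i = line_of (transpose B *v (Dm (6 * i) *v hn v))"
  unfolding hl_def by (rule pmap_line_of[OF klein_pairD[OF assms]])

lemma act_phi_hept: "act (pmap (Dm 1)) (hept v) = rotate1 (hept v)"
proof -
  have *: "pmap (Dm 1) ` hl v i = hl v (Suc i)" for i
    unfolding pmap_hl[OF klein_pair_Dm] transpose_Dm Dm_add unfolding hl_def by simp
  have u: "[0..<7] = [0,1,2,3,4,5,6::nat]" by (simp add: upt_rec)
  have "hl v (Suc 6) = hl v 0" by (rule hl_mod) simp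
  then show ?thesis unfolding hept_def u act_def list.map rotate1.simps append.simps * by (simp add: eval_nat_numeral)
qed

lemma pmap_hl_eqD:
  assumes "klein_pair A B" "torus v" "pmap A ` hl v i = hl v j"
  obtains c where "transpose B *v (Dm (6 * i) *v hn v) = c *s (Dm (6 * j) *v hn v)"
proof -
  have "Dm (6 * j) *v hn v \<noteq> 0" using torus_hn[OF assms(2)] torus_Dm torus_nz by blast
  then show ?thesis using assms(3) that line_of_eqD unfolding pmap_hl[OF assms(1)] unfolding hl_def by metis
qed

text \<open>The quadratic periods: the characteristic polynomial of \<open>Dm 1\<close> is
  \<open>X^3 - ze X^2 + ze' X - 1\<close>.\<close>

definition ze :: complex where "ze = z + z^2 + z^4"
definition ze' :: complex where "ze' = z^3 + z^5 + z^6"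

lemma ze_rels: "ze + ze' = -1" "ze * ze' = 2"
proof -
  show "ze + ze' = -1" unfolding ze_def ze'_def using zsum by algebra
  show "ze * ze' = 2" unfolding ze_def ze'_def using zsum by algebra
qed

lemma ze_nz: "ze \<noteq> 0" "ze' \<noteq> 0"
  using ze_rels(2) by auto

lemma ze_cube_ne: "ze^3 \<noteq> ze'^3"
proof
  assume eq: "ze^3 = ze'^3"
  have "(ze - ze') * ((ze + ze')^2 - ze * ze') = 0" using eq by algebra
  then have "ze = ze'" unfolding ze_rels by simp
  then have "(ze + ze')^2 = 4 * (ze * ze')" by (simp add: power2_eq_square)
  then show False unfolding ze_rels by simp
qed

text \<open>Cayley-Hamilton for \<open>Dm 1\<close>.\<close>

lemma Dm_recurrence:
  "Dm (m + 3) *v u = ze *s (Dm (m + 2) *v u) - ze' *s (Dm (m + 1) *v u) + Dm m *v u"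
proof -
  have "(z^4)^3 = ze * (z^4)^2 - ze' * z^4 + 1" unfolding ze_def ze'_def using zsum by algebra
  moreover have "(z^2)^3 = ze * (z^2)^2 - ze' * z^2 + 1" unfolding ze_def ze'_def using zsum by algebra
  moreover have "z^3 = ze * z^2 - ze' * z + 1" unfolding ze_def ze'_def using zsum by algebra
  ultimately have r: "z^12 = ze * z^8 - ze' * z^4 + 1" "z^6 = ze * z^4 - ze' * z^2 + 1" "z^3 = ze * z^2 - ze' * z + 1"
    by (simp_all flip: power_mult)
  have "z ^ (4 * (m + 3)) = z ^ (4 * m) * z^12" "z ^ (4 * (m + 2)) = z ^ (4 * m) * z^8"
     "z ^ (4 * (m + 1)) = z ^ (4 * m) * z^4" "z ^ (2 * (m + 3)) = z ^ (2 * m) * z^6"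
     "z ^ (2 * (m + 2)) = z ^ (2 * m) * z^4" "z ^ (2 * (m + 1)) = z ^ (2 * m) * z^2"
     "z ^ (m + 3) = z ^ m * z^3" "z ^ (m + 2) = z ^ m * z^2" "z ^ (m + 1) = z ^ m * z"
    by (simp_all add: power_add distrib_left power2_eq_square power4_eq_xxxx)
  then show ?thesis unfolding vec3_eq_iff Dm_mv vector_3 vector_add_component vector_minus_component vector_smult_component
    using r by (simp only:) (simp add: algebra_simps)
qed

text \<open>The recurrence for the inverse \<open>Dm 6\<close>, with the periods exchanged: the
  previous one read backwards. The steps of 6 match the exponents in \<open>hl\<close>.\<close>

lemma Dm_recurrence6:
  "Dm (m + 18) *v u = ze' *s (Dm (m + 12) *v u) - ze *s (Dm (m + 6) *v u) + Dm m *v u"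
proof -
  have e: "Dm (m + 18) = Dm (m + 4)" "Dm (m + 12) = Dm (m + 4 + 1)" "Dm (m + 6) = Dm (m + 4 + 2)" "Dm m = Dm (m + 4 + 3)"
    by (auto intro!: Dm_eqI) presburger+
  show ?thesis unfolding e using Dm_recurrence[of "m + 4" u] by (simp add: vec_eq_iff del: mv3 Dm_mv)
qed

text \<open>A relation is a polynomial of degree at most two vanishing at the three eigenvalues
  \<open>z^4\<close>, \<open>z^2\<close>, \<open>z\<close>.\<close>

lemma Dm_independent:
  assumes "torus u" "a *s (Dm m *v u) + b *s (Dm (m + 1) *v u) + c *s (Dm (m + 2) *v u) = 0"
  shows "a = 0 \<and> b = 0 \<and> c = 0"
proof (rule quadratic_three_roots)
  have sq: "(z^4)^2 = z^8" "(z^2)^2 = z^4" by (simp_all flip: power_mult)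
  have p: "z ^ (4 * (m + 1)) = z ^ (4 * m) * z^4" "z ^ (4 * (m + 2)) = z ^ (4 * m) * (z^4)^2"
    "z ^ (2 * (m + 1)) = z ^ (2 * m) * z^2" "z ^ (2 * (m + 2)) = z ^ (2 * m) * (z^2)^2"
    "z ^ (m + 1) = z ^ m * z" "z ^ (m + 2) = z ^ m * z^2"
    unfolding sq by (simp_all add: power_add distrib_left power2_eq_square power4_eq_xxxx)
  have "z ^ (4 * m) * u$1 * (a + b * z^4 + c * (z^4)^2) = 0" "z ^ (2 * m) * u$2 * (a + b * z^2 + c * (z^2)^2) = 0"
    "z ^ m * u$3 * (a + b * z + c * z^2) = 0"
    using assms(2) unfolding vec3_eq_iff vector_add_component vector_smult_component Dm_mv vector_3 p
    by (simp_all only: zero_index distrib_left mult.assoc mult.left_commute mult.commute)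
  then show "a + b * z^4 + c * (z^4)^2 = 0" "a + b * z^2 + c * (z^2)^2 = 0" "a + b * z + c * z^2 = 0"
    using assms(1) unfolding torus_def by (metis mult_eq_0_iff power_not_zero z_nz)+
  have "z^4 \<noteq> z^2" "z^2 \<noteq> z^1" "z^4 \<noteq> z^1" by (simp_all only: z_pow_inj) simp_all
  then show "z^4 \<noteq> z^2" "z^2 \<noteq> z" "z^4 \<noteq> z" by simp_all
qed

lemma Dm_congD: "k mod 7 = l mod 7 \<Longrightarrow> Dm k *v v = Dm l *v v"
  using Dm_eqI by metis

text \<open>The coordinates of the fixed lines are eigenvectors of the inverse transpose. Four
  consecutive ones satisfy a recurrence with nonzero coefficients, so their eigenvalues agree; three
  of them span the space.\<close>

lemma klein_pair_fix_hept:
  assumes AB: "klein_pair A B" and v: "torus v" and fix_hept: "act (pmap A) (hept v) = hept v"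
  obtains c where "c \<noteq> 0" "\<And>x. A *v x = c *s x"
proof -
  define M where "M = transpose B"
  define n where "n = hn v"
  have tn: "torus n" unfolding n_def by (rule torus_hn[OF v])
  have "\<exists>c. M *v (Dm (6 * i) *v n) = c *s (Dm (6 * i) *v n)" if "i < 7" for i
  proof -
    have "pmap A ` hl v i = hl v i"
      using arg_cong[OF fix_hept, of "\<lambda>L. L ! i"] that by (simp add: nth_act nth_hept)
    then show ?thesis unfolding M_def n_def by (rule pmap_hl_eqD[OF AB v]) blast
  qed
  then obtain l where l: "\<And>i. i < 7 \<Longrightarrow> M *v (Dm (6 * i) *v n) = l i *s (Dm (6 * i) *v n)" by metis
  have ml: "M *v (Dm 0 *v n) = l 0 *s (Dm 0 *v n)" "M *v (Dm 6 *v n) = l 1 *s (Dm 6 *v n)"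
    "M *v (Dm 12 *v n) = l 2 *s (Dm 12 *v n)" "M *v (Dm 18 *v n) = l 3 *s (Dm 18 *v n)"
    using l[of 0] l[of 1] l[of 2] l[of 3] by (simp_all del: Dm_mv mv3)
  note rec = Dm_recurrence6[of 0 n, unfolded add_0]
  have "l 3 *s (Dm 18 *v n) = ze' *s (l 2 *s (Dm 12 *v n)) - ze *s (l 1 *s (Dm 6 *v n)) + l 0 *s (Dm 0 *v n)"
    unfolding ml[symmetric] unfolding rec
    by (simp add: matrix_vector_right_distrib matrix_vector_mult_diff_distrib vector_scalar_commute del: mv3 Dm_mv)
  then have z0: "(l 0 - l 3) *s (Dm 0 *v n) + (ze * (l 3 - l 1)) *s (Dm 6 *v n) + (ze' * (l 2 - l 3)) *s (Dm 12 *v n) = 0"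
    unfolding rec by (simp add: vec_eq_iff algebra_simps del: mv3 Dm_mv)
  \<comment> \<open>The exponents 12, 6, 0 are rewritten modulo 7 as the consecutive 5, 6,
    7.\<close>
  have "(ze' * (l 2 - l 3)) *s (Dm 5 *v n) + (ze * (l 3 - l 1)) *s (Dm (5 + 1) *v n) + (l 0 - l 3) *s (Dm (5 + 2) *v n) = 0"
    using z0 Dm_congD[of 12 5 n] Dm_congD[of 0 7 n] by (simp add: add.commute add.left_commute del: mv3 Dm_mv)
  from Dm_independent[OF tn this] have ll: "l 3 = l 0" "l 1 = l 0" "l 2 = l 0" using ze_nz by auto
  have M: "M *v x = l 0 *s x" for x
  proof -
    \<comment> \<open>Each row of \<open>M\<close> minus the scalar matrix is orthogonal to three
      line vectors, so it would be a common point of three lines unless it is zero.\<close>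
    have "M $ r - l 0 *s axis r 1 = 0" for r
    proof (rule hl_not_concurrent[OF v, of 0 _ 1 2])
      have d: "dot y (M $ r - l 0 *s axis r 1) = (M *v y) $ r - l 0 * y $ r" for y
        using exhaust_3[of r] by (auto simp: dot_def axis_def algebra_simps)
      show "dot (Dm (6 * 0) *v hn v) (M $ r - l 0 *s axis r 1) = 0"
        "dot (Dm (6 * 1) *v hn v) (M $ r - l 0 *s axis r 1) = 0"
        "dot (Dm (6 * 2) *v hn v) (M $ r - l 0 *s axis r 1) = 0"
        unfolding d using l[of 0] l[of 1] l[of 2] ll unfolding n_def by (simp_all del: mv3 Dm_mv)
    qed simp_all
    then have r: "M $ r = l 0 *s axis r 1" for r by (simp only: right_minus_eq)
    show ?thesis unfolding vec3_eq_iff mv3 r by (simp add: axis_def)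
  qed
  have B: "B *v x = l 0 *s x" for x
  proof -
    have "dot y (B *v x) = l 0 * dot y x" for y
    proof -
      have "dot y (B *v x) = dot (M *v y) x" by (simp add: M_def dot_def transpose_def algebra_simps)
      then show ?thesis unfolding M by simp
    qed
    from this[of "axis 1 1"] this[of "axis 2 1"] this[of "axis 3 1"] show ?thesis
      by (simp add: dot_def axis_def vec3_eq_iff del: mv3)
  qed
  have "l 0 \<noteq> 0"
  proof
    assume "l 0 = 0"
    then have "B *v e1 = 0" unfolding B by simp
    then show False using klein_pair_nz[OF klein_pair_sym[OF AB]] e_nz by blast
  qed
  moreover have "A *v x = (1 / l 0) *s x" for x
  proof -
    have "x = l 0 *s (A *v x)" using klein_pairD(1)[OF AB, of x] unfolding B vector_scalar_commute by simp
    then have "(1 / l 0) *s x = (1 / l 0) *s (l 0 *s (A *v x))" by simp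
    then show ?thesis using \<open>l 0 \<noteq> 0\<close> by (simp add: vector_smult_assoc del: mv3)
  qed
  ultimately show ?thesis by (intro that[of "1 / l 0"]) auto
qed

text \<open>A matrix reversing the heptagon would conjugate \<open>Dm 1\<close> to a multiple of its inverse; this is impossible
  since their characteristic polynomials differ by the exchange of \<open>ze\<close> and \<open>ze'\<close>.\<close>

lemma klein_pair_not_reversing:
  assumes AB: "klein_pair A B" and v: "torus v"
  shows "act (pmap A) (hept v) \<noteq> rev (hept v)"
proof
  assume rv: "act (pmap A) (hept v) = rev (hept v)"
  define M where "M = transpose B"
  define n where "n = hn v"
  have tn: "torus n" unfolding n_def by (rule torus_hn[OF v])
  have "\<exists>c. M *v (Dm (6 * i) *v n) = c *s (Dm (i + 1) *v n)" if i: "i < 7" for i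
  proof -
    have "pmap A ` hl v i = hl v (6 - i)"
      using arg_cong[OF rv, of "\<lambda>L. L ! i"] i by (simp add: nth_act nth_hept rev_nth)
    then obtain c where "M *v (Dm (6 * i) *v n) = c *s (Dm (6 * (6 - i)) *v n)"
      unfolding M_def n_def by (rule pmap_hl_eqD[OF AB v]) blast
    \<comment> \<open>Reversal sends index \<open>i\<close> to \<open>6 - i\<close>; in exponents it
      turns steps of 6 into steps of 1, hence one recurrence into the other.\<close>
    moreover have "(6 * (6 - i)) mod 7 = (i + 1) mod 7"
    proof -
      have "i \<in> {0,1,2,3,4,5,6}" using i by auto
      then show ?thesis by auto
    qed
    ultimately show ?thesis using Dm_congD by metis
  qed
  then obtain l where l: "\<And>i. i < 7 \<Longrightarrow> M *v (Dm (6 * i) *v n) = l i *s (Dm (i + 1) *v n)" by metis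
  have rel: "l (i + 3) * ze = ze' * l (i + 2)" "l (i + 3) * ze' = ze * l (i + 1)" if i: "i < 4" for i
  proof -
    have e: "6 * (i + 1) = 6 * i + 6" "6 * (i + 2) = 6 * i + 12" "6 * (i + 3) = 6 * i + 18" by simp_all
    have ml: "M *v (Dm (6 * i) *v n) = l i *s (Dm (i + 1) *v n)"
      "M *v (Dm (6 * i + 6) *v n) = l (i + 1) *s (Dm (i + 1 + 1) *v n)"
      "M *v (Dm (6 * i + 12) *v n) = l (i + 2) *s (Dm (i + 1 + 2) *v n)"
      "M *v (Dm (6 * i + 18) *v n) = l (i + 3) *s (Dm (i + 1 + 3) *v n)"
      unfolding e[symmetric] using l[of i] l[of "i + 1"] l[of "i + 2"] l[of "i + 3"] i
      by (simp_all add: eval_nat_numeral del: mv3 Dm_mv)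
    have "l (i + 3) *s (Dm (i + 1 + 3) *v n) = ze' *s (l (i + 2) *s (Dm (i + 1 + 2) *v n))
        - ze *s (l (i + 1) *s (Dm (i + 1 + 1) *v n)) + l i *s (Dm (i + 1) *v n)"
      unfolding ml[symmetric] Dm_recurrence6
      by (simp only: matrix_vector_right_distrib matrix_vector_mult_diff_distrib vector_scalar_commute)
    then have "(l (i + 3) - l i) *s (Dm (i + 1) *v n) + (ze * l (i + 1) - l (i + 3) * ze') *s (Dm (i + 1 + 1) *v n)
        + (l (i + 3) * ze - ze' * l (i + 2)) *s (Dm (i + 1 + 2) *v n) = 0"
      unfolding Dm_recurrence by (simp add: vec_eq_iff algebra_simps del: mv3 Dm_mv)
    from Dm_independent[OF tn this] show "l (i + 3) * ze = ze' * l (i + 2)" "l (i + 3) * ze' = ze * l (i + 1)" by auto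
  qed
  have r0: "l 3 * ze = ze' * l 2" by (rule rel(1)[of 0, OF zero_less_numeral, unfolded add_0])
  have r1: "l 4 * ze = ze' * l 3" "l 4 * ze' = ze * l 2" using rel[of 1] by (simp_all add: eval_nat_numeral)
  \<comment> \<open>Elimination of \<open>l 2\<close> and \<open>l 4\<close>. Then
    \<open>l 3 = 0\<close>, against the invertibility of \<open>M\<close>.\<close>
  have "l 3 * (ze^3 - ze'^3) = 0" using r0 r1 by algebra
  then have "l 3 = 0" using ze_cube_ne by simp
  then have "M *v (Dm 18 *v n) = 0" using l[of 3] by simp
  then have "dot (M *v (Dm 18 *v n)) x = 0" for x by (simp add: dot_def del: mv3)
  moreover have "dot (M *v y) x = dot y (B *v x)" for x y by (simp add: M_def dot_def transpose_def algebra_simps)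
  ultimately have "dot (Dm 18 *v n) (B *v (A *v x)) = 0" for x by metis
  then have "dot (Dm 18 *v n) x = 0" for x unfolding klein_pairD[OF AB] .
  from this[of "axis 1 1"] show False using tn by (simp add: dot_def axis_def torus_def del: mv3)
qed

section \<open>Adjoint and theta characteristic of the image heptagons\<close>

lemma ex_nonvanishing:
  assumes "feval d F = f" "d > 0" "v \<noteq> 0" "kf v = 0" "ord_at f (pclass v) n"
  shows "\<exists>P\<in>kleinC. \<not> vanishes d F P"
proof -
  obtain \<gamma> r where lp: "local_param \<gamma> r (pclass v)" using ex_local_param assms(3,4) by blast
  obtain s g where 1: "0 < s" "s \<le> r" "g holomorphic_on ball 0 s" "g 0 \<noteq> 0"
    "\<And>t. t \<in> ball 0 s \<Longrightarrow> f (\<gamma> t) = t ^ n * g t" using ord_atE[OF assms(5) lp] by metis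
  have "isCont g 0" using 1 by (metis centre_in_ball continuous_on_interior holomorphic_on_imp_continuous_on interior_open open_ball)
  then obtain e where e: "e > 0" "\<And>t. dist 0 t < e \<Longrightarrow> g t \<noteq> 0"
    using continuous_at_avoid[of 0 g 0] 1(4) by metis
  \<comment> \<open>A point of the parametrisation near 0 but not at 0, where both factors
    \<open>t^n\<close> and \<open>g\<close> are nonzero.\<close>
  define t :: complex where "t = of_real (min s e / 2)"
  have t: "t \<in> ball 0 s" "t \<noteq> 0" "dist 0 t < e" using e(1) 1(1) by (auto simp: t_def)
  have f: "f (\<gamma> t) \<noteq> 0" using 1(5)[OF t(1)] e(2)[OF t(3)] t(2) by simp
  have "feval d F (0 *s \<gamma> t) = 0 ^ d * feval d F (\<gamma> t)" by (rule is_form_homogeneous) simp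
  then have "f 0 = 0" using assms(1,2) by simp
  then have "\<gamma> t \<noteq> 0" using f by metis
  moreover have "kf (\<gamma> t) = 0" using lp t(1) 1(2) unfolding local_param_def feval_klein by auto
  ultimately show ?thesis using f assms(1)
    by (intro bexI[of _ "pclass (\<gamma> t)"]) (auto simp: vanishes_pclass)
qed

lemma pclass_in_orbit_iff:
  assumes "torus u" "kf u = 0" "torus v" "kf v = 0"
  shows "(\<exists>k<7. pclass u = pclass (Dm k *v v)) \<longleftrightarrow> pm u * qm v = qm u * pm v"
proof
  assume "\<exists>k<7. pclass u = pclass (Dm k *v v)"
  then obtain k c where "u = c *s (Dm k *v v)" unfolding pclass_eq_iff by blast
  moreover have "pm (c *s x) = c^4 * pm x" "qm (c *s x) = c^4 * qm x" for x
    by (simp_all add: pm_def qm_def power_mult_distrib eval_nat_numeral)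
  ultimately show "pm u * qm v = qm u * pm v" by (simp del: Dm_mv mv3)
next
  assume "pm u * qm v = qm u * pm v"
  then obtain c m where "c \<noteq> 0" "m < 7" "u = c *s (Dm m *v v)" by (rule torus_ratio[OF assms(1,3,2,4)])
  then show "\<exists>k<7. pclass u = pclass (Dm k *v v)" using pclass_smult by metis
qed

lemma residual_hept_iff:
  assumes v: "torus v" "kf v = 0" "kf (Pm v) = 0" and u: "u \<noteq> 0" "kf u = 0"
  shows "pclass u \<in> residual (hept v) \<longleftrightarrow>
    torus u \<and> (pm u * qm v = qm u * pm v \<or> pm u * qm (Pm v) = qm u * pm (Pm v))"
proof (cases "torus u")
  case True
  have "pclass u \<in> residual (hept v) \<longleftrightarrow> (\<exists>k<7. pclass u = pclass (Dm k *v v)) \<or> (\<exists>k<7. pclass u = pclass (Dm k *v Pm v))"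
    unfolding residual_hept[OF v(1)] by blast
  then show ?thesis using True
    unfolding pclass_in_orbit_iff[OF True u(2) v(1,2)] pclass_in_orbit_iff[OF True u(2) torus_Pm[OF v(1)] v(3)] by blast
next
  case False
  have "torus (Dm k *v v)" "torus (Dm k *v Pm v)" for k using v torus_Pm by (simp_all del: Dm_mv mv3)
  then show ?thesis using False unfolding residual_hept[OF v(1)]
    by (auto simp: pclass_eq_iff simp del: Dm_mv mv3)
qed

text \<open>The pullback of a quartic \<open>G\<close> by \<open>A\<close> vanishes on the residual
  points of \<open>hept v\<close>, so it is a multiple of the Klein form. Hence \<open>G\<close>
  itself vanishes on the curve.\<close>

lemma adjoint_act_hept:
  assumes v: "torus v" "kf v = 0" "kf (Pm v) = 0" and AB: "klein_pair A B"
  shows "adjoint_is (act (pmap A) (hept v)) klein_form"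
proof -
  have hp: "length (hept v) = 7" "set (hept v) \<subseteq> plines" using heptagon_hept[OF v(1)] unfolding heptagon_def by auto
  note tw = torus_Pm[OF v(1)]
  have kfp: "kf (Dm k *v v) = 0" "kf (Dm k *v Pm v) = 0" for k using v by (simp_all del: Dm_mv mv3)
  have nz: "Dm k *v v \<noteq> 0" "Dm k *v Pm v \<noteq> 0" for k using v tw torus_Dm torus_nz by blast+
  have res: "X \<in> residual (act (pmap A) (hept v)) \<longleftrightarrow> X \<in> P2 \<and> pmap B X \<in> residual (hept v)" for X
    by (rule residual_act[OF AB hp])
  have resA: "pclass (A *v x) \<in> residual (act (pmap A) (hept v))"
    if "x \<noteq> 0" "pclass x \<in> residual (hept v)" for x
    unfolding res using that klein_pair_nz[OF AB, of x] by (simp add: pmap_pclass klein_pairD[OF AB] del: mv3)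
  have resk: "pclass (Dm k *v v) \<in> residual (hept v)" "pclass (Dm k *v Pm v) \<in> residual (hept v)" if "k < 7" for k
    unfolding residual_hept[OF v(1)] using that by blast+
  show ?thesis unfolding adjoint_is_def
  proof (intro conjI ballI allI impI)
    fix X assume "X \<in> residual (act (pmap A) (hept v))"
    then have X: "X \<in> P2" "pmap B X \<in> residual (hept v)" unfolding res by auto
    obtain u where u: "X = pclass u" "u \<noteq> 0" using X(1) unfolding P2_def by auto
    have "Y \<in> kleinC" if "Y \<in> residual (hept v)" for Y
      using that nz kfp unfolding residual_hept[OF v(1)] by (auto simp del: Dm_mv mv3)
    then have "pclass (B *v u) \<in> kleinC" using X(2) unfolding u(1) pmap_pclass[OF u(2)] by blast
    then have "kf u = 0" using klein_pair_kf[OF klein_pair_sym[OF AB]] by simp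
    then show "vanishes 4 klein_form X" unfolding u(1) vanishes_pclass feval_klein .
  next
    fix G assume "nonzero_form 4 G \<and> (\<forall>P\<in>residual (act (pmap A) (hept v)). vanishes 4 G P)"
    then have G0: "feval 4 G (A *v x) = 0" if "x \<noteq> 0" "pclass x \<in> residual (hept v)" for x
      using resA[OF that] vanishes_pclass by blast
    obtain G' where G': "\<And>x. feval 4 G' x = feval 4 G (A *v x)"
      using is_form_compose[OF is_form_feval, of 4 G A] by (rule is_formE) blast
    obtain a where "\<forall>m\<in>monoms 4. G' m = a * klein_form m"
      using quartic_unique[OF v(1,2) tw v(3) Pm_pq[OF v], of G'] G0 nz resk unfolding G' by blast
    then have "feval 4 G' x = a * feval 4 klein_form x" for x
      unfolding feval_def sum_distrib_left by (intro sum.cong) (auto simp: algebra_simps)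
    then have "feval 4 G (A *v (B *v x)) = a * kf (B *v x)" for x unfolding G' feval_klein by blast
    then have "feval 4 G x = 0" if "kf x = 0" for x
      using that klein_pair_kf[OF klein_pair_sym[OF AB]] unfolding klein_pairD[OF AB] by simp
    \<comment> \<open>A second use of uniqueness, now for \<open>G\<close> itself, passes from
      values on the curve to coefficients.\<close>
    then show "\<exists>a. \<forall>m\<in>monoms 4. G m = a * klein_form m"
      using quartic_unique[OF v(1,2) tw v(3) Pm_pq[OF v], of G] kfp by blast
  qed
qed

lemma Hdiv_ord:
  assumes "u \<noteq> 0" "kf u = 0"
  shows "\<exists>h. ord_at (\<lambda>v. v$1) (pclass u) h \<and> Hdiv (pclass u) = int h"
proof -
  have "\<exists>h. ord_at (\<lambda>v. v$1) (pclass u) h"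
  proof (cases "torus u")
    case True
    then show ?thesis using ord_at_unit[OF is_form_coord, of u 1] unfolding torus_def by blast
  next
    case False
    then show ?thesis using kf_not_torus[OF assms(2,1)] ord_coords_e1(1) ord_coords_e2 ord_coords_e3 by auto
  qed
  then obtain h where h: "ord_at (\<lambda>v. v$1) (pclass u) h" by blast
  have "mult_at 1 x_form (pclass u) = int h"
    by (rule mult_at_eq[OF feval_x_form h ex_local_param[OF assms]])
  then show ?thesis using h assms unfolding Hdiv_def div_of_def by (intro exI[of _ h]) simp
qed

text \<open>With \<open>E\<close> the sum of the coordinate points, the pulled-back quintic has
  divisor \<open>residual + 2\<sigma>(E)\<close> and \<open>x^2 K\<close> has divisor
  \<open>2H + 2E + 2\<sigma>(E)\<close>. Their difference is
  \<open>(residual - 3H) - (2E - H)\<close>.\<close>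

lemma theta_act_hept:
  assumes v: "torus v" "kf v = 0" "kf (Pm v) = 0" and AB: "klein_pair A B"
  shows "lin_equiv (theta_of (act (pmap A) (hept v))) eta_sym"
proof -
  have hp: "length (hept v) = 7" "set (hept v) \<subseteq> plines" using heptagon_hept[OF v(1)] unfolding heptagon_def by auto
  note tw = torus_Pm[OF v(1)]
  define Q where "Q = quintic (qm v * qm (Pm v)) (rm v * rm (Pm v)) (pm v * pm (Pm v))"
  obtain F where F: "feval 5 F = (\<lambda>x. Q (B *v x))"
    using is_form_compose[OF is_form_quintic, of _ _ _ B] unfolding is_form_def Q_def by metis
  obtain K where K: "is_form 3 K" "\<And>u. u \<noteq> 0 \<Longrightarrow> kf u = 0 \<Longrightarrow>
     ord_at K (pclass u) ((if torus u then 0 else 2) + (if torus (B *v u) then 0 else 2))"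
    using ex_contact_cubic[OF AB] by blast
  have "is_form (2 + 3) (\<lambda>x. x$1^2 * K x)"
    using is_form_mult[OF is_form_power[OF is_form_coord, of 2] K(1)] by simp
  then obtain G where G: "feval 5 G = (\<lambda>x. x$1^2 * K x)" unfolding is_form_def by (metis numeral_plus_numeral add_num_simps)
  have Bp: "B *v u \<noteq> 0" "kf (B *v u) = 0" if "u \<noteq> 0" "kf u = 0" for u
    using that klein_pair_nz[OF klein_pair_sym[OF AB]] klein_pair_kf[OF klein_pair_sym[OF AB]] by auto
  have ordF: "ord_at (\<lambda>x. Q (B *v x)) (pclass u) (if torus (B *v u) then
      (if pm (B *v u) * qm v = qm (B *v u) * pm v then 1 else 0)
      + (if pm (B *v u) * qm (Pm v) = qm (B *v u) * pm (Pm v) then 1 else 0) else 2)" (is "ord_at _ _ (?n u)")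
    if "u \<noteq> 0" "kf u = 0" for u
    unfolding Q_def by (rule ord_at_transport[OF AB ord_quintic[OF v(1,2) tw v(3) Bp[OF that]]])
  have ordG: "ord_at (\<lambda>x. x$1^2 * K x) (pclass u) (2 * h + ((if torus u then 0 else 2) + (if torus (B *v u) then 0 else 2)))"
    if "u \<noteq> 0" "kf u = 0" "ord_at (\<lambda>v. v$1) (pclass u) h" for u h
    by (intro ord_at_mult ord_at_power K(2) that)
  have nF: "\<exists>P\<in>kleinC. \<not> vanishes 5 F P"
    by (rule ex_nonvanishing[OF F _ _ _ ordF]) (use e_nz kf_e in auto)
  have nG: "\<exists>P\<in>kleinC. \<not> vanishes 5 G P"
    by (rule ex_nonvanishing[OF G _ _ _ ordG]) (use e_nz kf_e ord_coords_e1 in auto)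
  have dist: "pclass e1 \<noteq> pclass e2" "pclass e2 \<noteq> pclass e3" "pclass e1 \<noteq> pclass e3"
    by (auto simp: pclass_eq_iff vec3_eq_iff e1_def e2_def e3_def axis_def)
  have Ediv: "pt_div (pclass e1) X + pt_div (pclass e2) X + pt_div (pclass e3) X
     = (if X \<in> {pclass e1, pclass e2, pclass e3} then 1 else 0)" for X
    using dist by (auto simp: pt_div_def)
  let ?L = "act (pmap A) (hept v)"
  have "theta_of ?L X - eta_sym X = div_of 5 F X - div_of 5 G X" for X
  proof (cases "X \<in> kleinC")
    case True
    then obtain u where u: "X = pclass u" "u \<noteq> 0" "kf u = 0" by (rule kleinC_cases)
    obtain h where h: "ord_at (\<lambda>v. v$1) (pclass u) h" "Hdiv (pclass u) = int h" using Hdiv_ord[OF u(2,3)] by blast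
    have dF: "div_of 5 F X = int (?n u)"
      using mult_at_eq[OF _ ordF[OF u(2,3)] ex_local_param[OF u(2,3)], of 5 F] True F unfolding div_of_def u(1) by simp
    have dG: "div_of 5 G X = int (2 * h + ((if torus u then 0 else 2) + (if torus (B *v u) then 0 else 2)))"
      using mult_at_eq[OF _ ordG[OF u(2,3) h(1)] ex_local_param[OF u(2,3)], of 5 G] True G unfolding div_of_def u(1) by simp
    have "X \<in> residual ?L \<longleftrightarrow> torus (B *v u) \<and> (pm (B *v u) * qm v = qm (B *v u) * pm v
        \<or> pm (B *v u) * qm (Pm v) = qm (B *v u) * pm (Pm v))"
      unfolding residual_act[OF AB hp] u(1) pmap_pclass[OF u(2)] residual_hept_iff[OF v Bp[OF u(2,3)]]
      using u(2) by simp
    \<comment> \<open>The two orbits have different p : q, so at most one of the two zeros of the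
      quintic occurs and the multiplicity is one.\<close>
    moreover have "\<not> (pm (B *v u) * qm v = qm (B *v u) * pm v \<and> pm (B *v u) * qm (Pm v) = qm (B *v u) * pm (Pm v))"
      if t: "torus (B *v u)"
    proof
      assume eq: "pm (B *v u) * qm v = qm (B *v u) * pm v \<and> pm (B *v u) * qm (Pm v) = qm (B *v u) * pm (Pm v)"
      have "pm (B *v u) * (pm v * qm (Pm v) - qm v * pm (Pm v)) = 0"
        using eq by (simp add: algebra_simps del: mv3)
      then show False using Pm_pq[OF v] torus_nz[OF t] by simp
    qed
    moreover have "X \<in> {pclass e1, pclass e2, pclass e3} \<longleftrightarrow> \<not> torus u"
      unfolding u(1) by (rule pclass_coordinate_point_iff[OF u(2,3)])
    ultimately show ?thesis
      unfolding theta_of_def eta_sym_def Ediv dF dG residual_div_def using h(2) u(1)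
      by (cases "torus (B *v u)"; cases "torus u") (auto simp del: mv3)
  next
    case False
    have "X \<notin> residual ?L"
    proof
      assume "X \<in> residual ?L"
      then have "vanishes 4 klein_form X" "X \<in> P2"
        using adjoint_act_hept[OF v AB] residual_act[OF AB hp] unfolding adjoint_is_def by auto
      then show False using False unfolding kleinC_def by simp
    qed
    moreover have "X \<notin> {pclass e1, pclass e2, pclass e3}" using False e_nz kf_e by auto
    ultimately show ?thesis unfolding theta_of_def eta_sym_def Ediv residual_div_def
      using False by (simp add: div_of_def Hdiv_def)
  qed
  then show ?thesis unfolding lin_equiv_def using nF nG by blast
qed

lemma good_heptagon_act_hept:
  assumes "torus v" "kf v = 0" "kf (Pm v) = 0" "klein_pair A B"
  shows "good_heptagon (act (pmap A) (hept v))"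
  unfolding good_heptagon_def
  using heptagon_act[OF assms(4) heptagon_hept[OF assms(1)]] adjoint_act_hept[OF assms] theta_act_hept[OF assms] by blast

end

section \<open>Counting the orbits of the heptagon and of its reversal\<close>

theorem theorem5p4:
  fixes \<zeta> :: complex and R1 :: ppoint
  assumes "\<zeta> ^ 7 = 1" and "\<zeta> \<noteq> 1"
    and "R1 \<in> kleinC" and "R1 \<notin> {pclass e1, pclass e2, pclass e3}"
    and "pmap (psi_mat \<zeta>) R1 \<in> kleinC"
  defines "R \<equiv> \<lambda>i::nat. (pmap (phi_mat \<zeta>) ^^ (i - 1)) R1"
  defines "P \<equiv> [join (R 6) (R 1), join (R 7) (R 2), join (R 1) (R 3), join (R 2) (R 4),
                 join (R 3) (R 5), join (R 4) (R 6), join (R 5) (R 7)]"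
  shows "(\<forall>Q\<in>orbit P. \<forall>\<sigma>\<in>AutC. act \<sigma> Q = Q \<longrightarrow> \<sigma> = pmap (mat 1))
       \<and> (\<forall>Q\<in>orbit P. good_heptagon Q)
       \<and> (\<exists>k. act (pmap (phi_mat \<zeta>)) P = rotate k P)
       \<and> card (orbit P) = 168
       \<and> card (cyc_classes (orbit P)) = 24
       \<and> orbit P \<union> orbit (rev P) \<subseteq> {Q. good_heptagon Q}
       \<and> card (orbit P \<union> orbit (rev P)) = 336"
proof -
  interpret klein_root \<zeta> using assms(1,2) by unfold_locales
  obtain v where v0: "R1 = pclass v" "v \<noteq> 0" "kf v = 0" by (rule kleinC_cases[OF assms(3)])
  have tv: "torus v" using assms(4) kf_not_torus[OF v0(3,2)] unfolding v0(1) by blast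
  have kP: "kf (Pm v) = 0" using assms(5) unfolding v0(1) pmap_pclass[OF v0(2)] Pm_def by simp
  have phi: "phi_mat \<zeta> = Dm 1" by (simp add: phi_mat_def Dm_def)
  have Rk: "(pmap (Dm 1) ^^ k) R1 = pclass (Dm k *v v)" for k
  proof (induction k)
    case 0
    show ?case using Dm_0[of 0 v] by (simp add: v0(1) del: Dm_mv mv3)
  next
    case (Suc k)
    have "Dm k *v v \<noteq> 0" using tv torus_Dm torus_nz by blast
    then show ?case using Suc by (simp add: pmap_pclass Dm_add del: Dm_mv mv3)
  qed
  have P: "P = hept v"
  proof -
    have u: "[0..<7] = [0,1,2,3,4,5,6::nat]" by (simp add: upt_rec)
    have R: "R i = pclass (Dm (i - 1) *v v)" for i unfolding R_def phi Rk ..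
    show ?thesis unfolding P_def hept_def u list.map R
      by (intro arg_cong2[where f = Cons] refl join_hl[OF tv]) simp_all
  qed
  have hp: "heptagon (hept v)" by (rule heptagon_hept[OF tv])
  have P2: "\<forall>l\<in>set (hept v). l \<subseteq> P2" using hp plines_subset_P2 unfolding heptagon_def by blast
  have AutE: "\<exists>A B. s = pmap A \<and> klein_pair A B" if "s \<in> AutC" for s using that unfolding AutC_eq by blast
  have AutI: "pmap A \<in> AutC" if "klein_pair A B" for A B using that unfolding AutC_eq by blast
  have aa: "act (pmap A) (act (pmap A') (hept v)) = act (pmap (A ** A')) (hept v)" if "klein_pair A' B'" for A A' B'
    by (rule act_act[OF that P2])
  have one: "act (pmap (mat 1)) (hept v) = hept v"
  proof -
    have "pmap (mat 1) ` l = l" if l: "l \<in> set (hept v)" for l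
    proof -
      have id: "pmap (mat 1) X = X" if "X \<in> P2" for X
        using that unfolding P2_def by (auto simp: pmap_pclass matrix_vector_mul_lid simp del: mv3)
      have "pmap (mat 1) ` l = (\<lambda>X. X) ` l"
        by (rule image_cong[OF refl]) (use P2 l id in blast)
      then show ?thesis by simp
    qed
    then show ?thesis unfolding act_def by (simp add: map_idI)
  qed
  have cancel: "act (pmap B) (act (pmap A) (hept v)) = hept v" if "klein_pair A B" for A B
  proof -
    have "B ** A = mat 1" by (rule matrix_eq_mv) (simp add: matrix_vector_mul_assoc[symmetric] klein_pairD[OF that] matrix_vector_mul_lid del: mv3)
    then show ?thesis using aa[OF that] one by simp
  qed
  \<comment> \<open>If two automorphisms have the same value on the heptagon, their quotient fixes
    all seven lines and is scalar.\<close>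
  have free: "pmap A = pmap A'" if A: "klein_pair A B" and A': "klein_pair A' B'"
    and eq: "act (pmap A) (hept v) = act (pmap A') (hept v)" for A B A' B'
  proof -
    have "act (pmap (B' ** A)) (hept v) = hept v"
      using aa[OF A, of B'] cancel[OF A'] unfolding eq by simp
    then obtain c where c: "c \<noteq> 0" "\<And>x. (B' ** A) *v x = c *s x"
      using klein_pair_fix_hept[OF klein_pair_comp[OF klein_pair_sym[OF A'] A] tv] by metis
    have "A *v x = c *s (A' *v x)" for x
    proof -
      have "A *v x = A' *v ((B' ** A) *v x)" by (simp add: matrix_vector_mul_assoc[symmetric] klein_pairD[OF A'] del: mv3)
      then show ?thesis unfolding c(2) vector_scalar_commute .
    qed
    then show ?thesis by (rule pmap_scalar[OF c(1)])
  qed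
  have orb: "orbit P = (\<lambda>s. act s (hept v)) ` AutC" unfolding orbit_def P by blast
  have inj: "inj_on (\<lambda>s. act s (hept v)) AutC"
    by (rule inj_onI) (metis AutE free)
  have card_orb: "card (orbit P) = 168" unfolding orb card_image[OF inj] by (rule card_AutC)
  have fin: "finite (orbit P)" using card_orb card.infinite by fastforce
  have fr: "s = pmap (mat 1)" if Q: "Q \<in> orbit P" "s \<in> AutC" "act s Q = Q" for Q s
  proof -
    obtain A B where A: "klein_pair A B" "Q = act (pmap A) (hept v)" using Q(1) AutE unfolding orb by blast
    obtain C E where C: "klein_pair C E" "s = pmap C" using AutE[OF Q(2)] by blast
    have "act (pmap (C ** A)) (hept v) = act (pmap A) (hept v)" using Q(3) aa[OF A(1)] unfolding A(2) C(2) by simp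
    then have "act (pmap (B ** (C ** A))) (hept v) = hept v"
      using aa[OF klein_pair_comp[OF C(1) A(1)], of B] cancel[OF A(1)] by simp
    then obtain c where c: "c \<noteq> 0" "\<And>x. (B ** (C ** A)) *v x = c *s x"
      using klein_pair_fix_hept[OF klein_pair_comp[OF klein_pair_sym[OF A(1)] klein_pair_comp[OF C(1) A(1)]] tv] by metis
    have "C *v y = c *s (mat 1 *v y)" for y
    proof -
      have "C *v y = A *v ((B ** (C ** A)) *v (B *v y))"
        by (simp add: matrix_vector_mul_assoc[symmetric] klein_pairD[OF A(1)] del: mv3)
      then show ?thesis unfolding c(2) vector_scalar_commute klein_pairD[OF A(1)] matrix_vector_mul_lid .
    qed
    then show ?thesis unfolding C(2) by (rule pmap_scalar[OF c(1)])
  qed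
  have good: "good_heptagon Q" if "Q \<in> orbit P" for Q
    using that AutE good_heptagon_act_hept[OF tv v0(3) kP] unfolding orb by blast
  have rotP: "act (pmap (phi_mat \<zeta>)) P = rotate 1 P" unfolding phi P using act_phi_hept by simp
  \<comment> \<open>Rotating the labels of an image under \<open>A\<close> is the same as applying
    \<open>A\<close> after \<open>Dm 1\<close>, so the orbit is a union of full cyclic
    classes.\<close>
  have rot_orb: "rotate1 Q \<in> orbit P" if Q: "Q \<in> orbit P" for Q
  proof -
    obtain A B where A: "klein_pair A B" "Q = act (pmap A) (hept v)" using Q AutE unfolding orb by blast
    have "rotate1 Q = act (pmap (A ** Dm 1)) (hept v)"
      unfolding A(2) act_rotate1[symmetric] act_phi_hept[symmetric] by (rule aa[OF klein_pair_Dm])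
    then show ?thesis using AutI[OF klein_pair_comp[OF A(1) klein_pair_Dm]] unfolding orb by blast
  qed
  have "7 * card (cyc_classes (orbit P)) = card (orbit P)"
    by (rule card_cyc_classes[OF fin _ _ rot_orb]) (use good in \<open>auto simp: good_heptagon_def heptagon_def\<close>)
  then have cyc: "card (cyc_classes (orbit P)) = 24" using card_orb by simp
  have orb_rev: "orbit (rev P) = rev ` orbit P" unfolding orbit_def by (auto simp: act_rev)
  have goodU: "orbit P \<union> orbit (rev P) \<subseteq> {Q. good_heptagon Q}"
    unfolding orb_rev using good good_heptagon_rev by auto
  \<comment> \<open>A common element would yield an automorphism sending the heptagon to its
    reversal.\<close>
  have disj: "orbit P \<inter> rev ` orbit P = {}"
  proof (rule ccontr)
    assume "orbit P \<inter> rev ` orbit P \<noteq> {}"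
    then obtain Q Q' where "Q \<in> orbit P" "Q' \<in> orbit P" "Q = rev Q'" by blast
    then obtain A B A' B' where A: "klein_pair A B" and A': "klein_pair A' B'"
      and eq: "act (pmap A) (hept v) = rev (act (pmap A') (hept v))" using AutE unfolding orb by blast
    have "act (pmap (B' ** A)) (hept v) = act (pmap B') (rev (act (pmap A') (hept v)))"
      using aa[OF A, of B'] unfolding eq by simp
    also have "\<dots> = rev (hept v)" unfolding act_rev cancel[OF A'] ..
    finally show False using klein_pair_not_reversing[OF klein_pair_comp[OF klein_pair_sym[OF A'] A] tv] by blast
  qed
  have "card (orbit P \<union> orbit (rev P)) = 336"
    unfolding orb_rev card_Un_disjoint[OF fin finite_imageI[OF fin] disj]
    by (simp add: card_image card_orb)
  then show ?thesis using fr good rotP card_orb cyc goodU by blast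
qed

end
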